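(* Let $f$ and $g$ be transcendental meromorphic functions on $\mathbb{C}$ with hyper-orders $\rho_2(f)<1$ and $\rho_2(g)<1$ such that $N(r,f)+N(r,1/f)=S(r,f)$ and $N(r,g)+N(r,1/g)=S(r,g)$. Let $a(z)$ be a meromorphic function, not identically zero, which is a small function of both $f$ and $g$, i.e. $T(r,a)=S(r,f)$ and $T(r,a)=S(r,g)$. Let $c$ be a non-zero complex number, and let $L$ be any one of the following operators on meromorphic functions $h$: (1) $L(h)=h(z+c)$; (2) $L(h)=h(z+c)-h(z)$; (3) $L(h)=h^{(k)}(z+c)$, where $k\geq 1$ is an integer. Then at least one of the two functions $f^{2}(z)L(g)-a(z)$ and $g^{2}(z)L(f)-a(z)$ has infinitely many zeros.
   Context: Standard Nevanlinna theory notation is used: for a meromorphic function $f$ on $\mathbb{C}$, $N(r,f)$ is the integrated counting function of poles (with multiplicity), $m(r,f)$ the proximity function, and $T(r,f)=m(r,f)+N(r,f)$ the characteristic function. The hyper-order of $f$ is $\rho_{2}(f)=\limsup_{r\to\infty}\frac{\log\log T(r,f)}{\log r}$. $S(r,f)$ denotes any quantity of growth $o(T(r,f))$ as $r\to\infty$, outside a possible exceptional set of finite linear measure. A meromorphic function $a$ is a small function of $f$ if $T(r,a)=S(r,f)$. $h^{(k)}$ denotes the $k$th derivative of $h$.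
   Formalization: In case (2) it is additionally assumed that neither f(z+c)-f(z) nor g(z+c)-g(z) vanishes identically; without this the claim fails, e.g. for f=g=exp, c=2πi, a=1, where both expressions are the constant -1. *)

theory Defs
  imports "HOL-Complex_Analysis.Complex_Analysis" "HOL-Library.Landau_Symbols"
begin

text \<open>
  A meromorphic function on the plane is a total function \<open>f\<close> with
  \<^prop>\<open>f meromorphic_on UNIV\<close>. Its values at poles and at removable singularities are arbitrary,
  so every notion below is insensitive to changing \<open>f\<close> on a set without limit points. In particular,
  identities between meromorphic functions are required only up to such a set, i.e. with respect
  to the filter \<open>cosparse UNIV\<close> (binder \<open>\<forall>\<^sub>\<approx>\<close>).
\<close>

subsection \<open>Nevanlinna functionals\<close>

text \<open>
  At a pole \<^term>\<open>zorder f z\<close> is minus the multiplicity. A meromorphic function has only finitely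
  many poles in a closed disc, so the sum is never a sum over an infinite set.
\<close>

definition pole_count :: "real \<Rightarrow> (complex \<Rightarrow> complex) \<Rightarrow> nat" where
  "pole_count r f = (\<Sum>z | norm z \<le> r \<and> is_pole f z. nat (- zorder f z))"

definition nev_N :: "real \<Rightarrow> (complex \<Rightarrow> complex) \<Rightarrow> real" where
  "nev_N r f =
     integral {0..r} (\<lambda>t. (real (pole_count t f) - real (pole_count 0 f)) / t)
       + real (pole_count 0 f) * ln r"

text \<open>\<open>log\<^sup>+ 0 = 0\<close> holds here because \<^prop>\<open>ln 0 = (0::real)\<close>.\<close>

definition log_plus :: "real \<Rightarrow> real" where
  "log_plus x = max 0 (ln x)"

definition nev_m :: "real \<Rightarrow> (complex \<Rightarrow> complex) \<Rightarrow> real" where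
  "nev_m r f =
     1 / (2 * pi) * integral {0..2 * pi} (\<lambda>\<theta>. log_plus (norm (f (of_real r * cis \<theta>))))"

definition nev_T :: "real \<Rightarrow> (complex \<Rightarrow> complex) \<Rightarrow> real" where
  "nev_T r f = nev_m r f + nev_N r f"

definition hyper_order :: "(complex \<Rightarrow> complex) \<Rightarrow> ereal" where
  "hyper_order f = Limsup at_top (\<lambda>r. ereal (ln (ln (nev_T r f)) / ln r))"

text \<open>\<open>nev_S f \<phi>\<close> means \<open>\<phi>(r) = S(r, f)\<close>; the exceptional set \<open>E\<close> may depend on \<open>\<phi>\<close>.\<close>

definition nev_S :: "(complex \<Rightarrow> complex) \<Rightarrow> (real \<Rightarrow> real) \<Rightarrow> bool" where
  "nev_S f \<phi> \<longleftrightarrow>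
     (\<exists>E \<in> lmeasurable. \<phi> \<in> o[inf at_top (principal (- E))](\<lambda>r. nev_T r f))"

definition small_function :: "(complex \<Rightarrow> complex) \<Rightarrow> (complex \<Rightarrow> complex) \<Rightarrow> bool" where
  "small_function a f \<longleftrightarrow> a meromorphic_on UNIV \<and> nev_S f (\<lambda>r. nev_T r a)"

subsection \<open>Transcendental meromorphic functions and zeros\<close>

definition transcendental_meromorphic :: "(complex \<Rightarrow> complex) \<Rightarrow> bool" where
  "transcendental_meromorphic f \<longleftrightarrow>
     f meromorphic_on UNIV \<and>
     \<not> (\<exists>p q. q \<noteq> 0 \<and> (\<forall>\<^sub>\<approx>z. f z = poly p z / poly q z))"

definition identically_zero :: "(complex \<Rightarrow> complex) \<Rightarrow> bool" where
  "identically_zero f \<longleftrightarrow> (\<forall>\<^sub>\<approx>z. f z = 0)"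

text \<open>
  Zeros are defined by the limit, in the same way as \<^const>\<open>is_pole\<close>: the value stored at \<open>z\<close> is
  arbitrary when one of the constituents of \<open>f\<close> has a pole there. For a function meromorphic on
  the plane these are the points where its continuous extension takes the value \<open>0\<close>.
\<close>

definition zeros :: "(complex \<Rightarrow> complex) \<Rightarrow> complex set" where
  "zeros f = {z. f \<midarrow>z\<rightarrow> 0}"

subsection \<open>The operators\<close>

definition shift_op :: "complex \<Rightarrow> (complex \<Rightarrow> complex) \<Rightarrow> complex \<Rightarrow> complex" where
  "shift_op c h = (\<lambda>z. h (z + c))"

definition difference_op :: "complex \<Rightarrow> (complex \<Rightarrow> complex) \<Rightarrow> complex \<Rightarrow> complex" where
  "difference_op c h = (\<lambda>z. h (z + c) - h z)"

definition deriv_shift_op ::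
    "nat \<Rightarrow> complex \<Rightarrow> (complex \<Rightarrow> complex) \<Rightarrow> complex \<Rightarrow> complex" where
  "deriv_shift_op k c h = (\<lambda>z. (deriv ^^ k) h (z + c))"

text \<open>
  Unlike the other two operators, \<^const>\<open>difference_op\<close> annihilates some transcendental functions,
  namely those of period \<open>c\<close>. Results about zeros of expressions such as
  \<open>f\<^sup>2 \<cdot> difference_op c g - a\<close> need the differences not to vanish identically: for
  \<open>f = g = exp\<close>, \<open>c = 2\<pi>i\<close> and \<open>a = 1\<close> this expression is the constant \<open>-1\<close>.
\<close>

end

theory Submission
  imports Defs
begin

text \<open>
  Suppose both expressions have finitely many zeros and put \<open>T(r) = T(r, f) + T(r, g)\<close>. Since
  \<open>ln T(r) = o(r)\<close>, there are arbitrarily large radii \<open>r\<close> with \<open>T(r + K) \<le> 2 T(r)\<close>, for every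
  constant \<open>K\<close>. On such radii exceptional sets of finite measure disappear by monotonicity, and
  functions with few zeros and poles are easy to control: in the Poisson--Jensen formula the Blaschke
  factors of zeros and poles contribute at most the counting functions. Hence \<open>g'/g\<close> and
  \<open>L(g)/g\<close> have characteristic \<open>o(T)\<close>, and so does every function that almost omits \<open>0\<close>, \<open>1\<close>
  and \<open>\<infinity>\<close>. Applied to \<open>u = f\<^sup>2 L(g) / a\<close> this shows that \<open>f\<^sup>2 g\<close>, and by symmetry \<open>g\<^sup>2 f\<close>, has
  characteristic \<open>o(T)\<close>; but \<open>f\<^sup>3 = (f\<^sup>2 g)\<^sup>2 / (g\<^sup>2 f)\<close>, so \<open>T = o(T)\<close>, which is absurd.
\<close>

subsection \<open>Circle means and the Poisson kernel\<close>

text \<open>In the shift quotient the main term carries the factor |c| / (R - t), where R is the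
  larger radius in the Poisson integral. It becomes o(T) only if R - t can be a large constant K
  while T grows by at most a fixed factor. This is where hyper-order below one is spent, and why one
  sequence of radii must work for all K. The logarithmic derivative needs only a bounded gap, since
  its T stands under a logarithm. In both estimates the Blaschke sums are bounded by full counting
  functions instead of increments, which is affordable because these counting functions are small by
  hypothesis. S(r,f) and S(r,g) have different comparison functions and exceptional sets. Measuring
  everything against T(r,f) + T(r,g) along a single filter makes them interchangeable. The estimates
  use only circles that avoid zeros and poles, so that the integrands are continuous. The remaining
  radii are countably many, and the filter ignores them.\<close>

definition cmean :: "real \<Rightarrow> (complex \<Rightarrow> 'a::euclidean_space) \<Rightarrow> 'a" where
  "cmean r v = (1 / (2 * pi)) *\<^sub>R integral {0..2 * pi} (\<lambda>\<theta>. v (of_real r * cis \<theta>))"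

lemma nev_m_eq_cmean: "nev_m r f = cmean r (\<lambda>z. log_plus (norm (f z)))"
  by (simp add: nev_m_def cmean_def)

lemma continuous_on_circle:
  fixes v :: "complex \<Rightarrow> 'a::topological_space"
  assumes "continuous_on (sphere 0 r) v" "0 \<le> r"
  shows "continuous_on A (\<lambda>\<theta>. v (of_real r * cis \<theta>))"
  by (rule continuous_on_compose2[OF assms(1)])
     (use assms(2) in \<open>auto intro!: continuous_intros simp: norm_mult\<close>)

lemma circle_integrable:
  fixes v :: "complex \<Rightarrow> 'a::euclidean_space"
  assumes "continuous_on (sphere 0 r) v" "0 \<le> r"
  shows "(\<lambda>\<theta>. v (of_real r * cis \<theta>)) integrable_on {0..2 * pi}"
  by (rule integrable_continuous_real[OF continuous_on_circle[OF assms]])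

lemma cmean_cong:
  assumes "\<And>z. norm z = r \<Longrightarrow> v z = w z" "0 \<le> r"
  shows "cmean r v = cmean r w"
  unfolding cmean_def using assms by (auto intro!: integral_cong simp: norm_mult)

lemma cmean_const [simp]: "cmean r (\<lambda>_. c) = c"
  by (simp add: cmean_def)

lemma cmean_add:
  assumes "continuous_on (sphere 0 r) v" "continuous_on (sphere 0 r) w" "0 \<le> r"
  shows "cmean r (\<lambda>z. v z + w z) = cmean r v + cmean r w"
  using assms by (simp add: cmean_def integral_add circle_integrable scaleR_add_right)

lemma cmean_diff:
  assumes "continuous_on (sphere 0 r) v" "continuous_on (sphere 0 r) w" "0 \<le> r"
  shows "cmean r (\<lambda>z. v z - w z) = cmean r v - cmean r w"
  using assms by (simp add: cmean_def integral_diff circle_integrable scaleR_diff_right)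

lemma cmean_cmult: "cmean r (\<lambda>z. c * v z) = c * (cmean r v :: real)"
  by (simp add: cmean_def)

lemma cmean_uminus: "cmean r (\<lambda>z. - v z) = - cmean r v"
  by (simp add: cmean_def)

lemma cmean_sum:
  assumes "finite A" "\<And>i. i \<in> A \<Longrightarrow> continuous_on (sphere 0 r) (v i)" "0 \<le> r"
  shows "cmean r (\<lambda>z. \<Sum>i\<in>A. v i z) = (\<Sum>i\<in>A. cmean r (v i))"
  using assms by (simp add: cmean_def integral_sum circle_integrable scaleR_sum_right)

lemma cmean_mono:
  fixes v w :: "complex \<Rightarrow> real"
  assumes "continuous_on (sphere 0 r) v" "continuous_on (sphere 0 r) w" "0 \<le> r"
    and "\<And>z. norm z = r \<Longrightarrow> v z \<le> w z"
  shows "cmean r v \<le> cmean r w"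
proof -
  have "integral {0..2*pi} (\<lambda>\<theta>. v (of_real r * cis \<theta>)) \<le> integral {0..2*pi} (\<lambda>\<theta>. w (of_real r * cis \<theta>))"
    by (rule integral_le) (use assms in \<open>auto intro!: circle_integrable simp: norm_mult\<close>)
  thus ?thesis by (simp add: cmean_def divide_right_mono)
qed

lemma cmean_nonneg:
  fixes v :: "complex \<Rightarrow> real"
  assumes "\<And>z. norm z = r \<Longrightarrow> 0 \<le> v z" "0 \<le> r"
  shows "0 \<le> cmean r v"
proof -
  have "0 \<le> integral {0..2*pi} (\<lambda>\<theta>. v (of_real r * cis \<theta>))"
  proof (cases "(\<lambda>\<theta>. v (of_real r * cis \<theta>)) integrable_on {0..2*pi}")
    case True
    thus ?thesis by (rule integral_nonneg) (use assms in \<open>auto simp: norm_mult\<close>)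
  qed (simp add: not_integrable_integral)
  thus ?thesis by (simp add: cmean_def)
qed

lemma cmean_norm_le:
  fixes v :: "complex \<Rightarrow> complex"
  assumes "continuous_on (sphere 0 r) v" "0 \<le> r"
  shows "norm (cmean r v) \<le> cmean r (\<lambda>z. norm (v z))"
proof -
  have "norm (integral {0..2*pi} (\<lambda>\<theta>. v (of_real r * cis \<theta>)))
     \<le> integral {0..2*pi} (\<lambda>\<theta>. norm (v (of_real r * cis \<theta>)))"
    by (rule integral_norm_bound_integral)
       (use assms in \<open>auto intro!: circle_integrable circle_integrable[where v="\<lambda>z. norm (v z)"] continuous_on_norm\<close>)
  thus ?thesis by (simp add: cmean_def divide_right_mono)
qed

lemma cmean_bounded_linear:
  assumes "bounded_linear L" "continuous_on (sphere 0 r) v" "0 \<le> r"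
  shows "L (cmean r v) = cmean r (\<lambda>z. L (v z))"
proof -
  interpret L: bounded_linear L by fact
  show ?thesis
    unfolding cmean_def
    by (subst L.scaleR, subst integral_linear[OF circle_integrable[OF assms(2,3)] assms(1), symmetric])
       (simp add: o_def)
qed

lemmas Re_cmean = cmean_bounded_linear[OF bounded_linear_Re]
lemmas cnj_cmean = cmean_bounded_linear[OF bounded_linear_cnj]

section \<open>Cauchy, Schwarz and Poisson formulas for circle means\<close>

lemma Cauchy_mean:
  assumes h: "h holomorphic_on cball 0 r" and z: "norm z < r"
  shows "cmean r (\<lambda>w. h w * w / (w - z)) = h z"
proof -
  have "((\<lambda>u. h u/(u-z)) has_contour_integral (2 * of_real pi * \<i> * h z)) (circlepath 0 r)"
    by (rule Cauchy_integral_circlepath_simple) (use h z in auto)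
  hence "((\<lambda>t. h (of_real r * cis t) / (of_real r * cis t - z) * of_real r * \<i> * cis t) has_integral
        (2 * of_real pi * \<i> * h z)) {0..2*pi}"
    unfolding circlepath_def by (subst (asm) has_contour_integral_part_circlepath_iff) auto
  from has_integral_mult_right[OF this, of "-\<i>"]
  have "((\<lambda>t. h (of_real r * cis t) * (of_real r * cis t) / (of_real r * cis t - z)) has_integral
        (2 * of_real pi * h z)) {0..2*pi}"
    by (simp add: field_simps)
  hence "integral {0..2*pi} (\<lambda>t. h (of_real r * cis t) * (of_real r * cis t) / (of_real r * cis t - z))
     = (2 * of_real pi * h z)" by (rule integral_unique)
  thus ?thesis by (simp add: cmean_def scaleR_conv_of_real)
qed

lemma mean_value:
  assumes "h holomorphic_on cball 0 r" "0 < r"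
  shows "cmean r h = h 0"
proof -
  have "cmean r h = cmean r (\<lambda>w. h w * w / (w - 0))"
    by (rule cmean_cong) (use assms in auto)
  also have "\<dots> = h 0" by (rule Cauchy_mean) (use assms in auto)
  finally show ?thesis .
qed

lemma mean_value_Re:
  assumes "h holomorphic_on cball 0 r" "0 < r"
  shows "cmean r (\<lambda>z. Re (h z)) = Re (h 0)"
proof -
  have "continuous_on (sphere 0 r) h"
    by (rule continuous_on_subset[OF holomorphic_on_imp_continuous_on[OF assms(1)]]) auto
  thus ?thesis using Re_cmean[of r h] mean_value[OF assms] assms(2) by simp
qed

text \<open>For \<open>p \<noteq> 0\<close> the expression vanishes only at the reflection
  \<open>R\<^sup>2 / cnj p\<close> of \<open>p\<close> in the circle, which lies outside the closed
  disc. It is the denominator of the Blaschke factor.\<close>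

lemma denominator_nonzero:
  assumes "norm p < R" "norm w \<le> R"
  shows "of_real (R\<^sup>2) - cnj p * w \<noteq> (0::complex)"
proof
  have R: "0 < R" using assms norm_ge_zero[of p] by linarith
  assume "of_real (R\<^sup>2) - cnj p * w = (0::complex)"
  hence "norm (cnj p * w) = norm (of_real (R\<^sup>2) :: complex)" by simp
  hence "norm p * norm w = R\<^sup>2" by (simp add: norm_mult norm_power)
  moreover have "norm p * norm w \<le> norm p * R" using assms by (intro mult_left_mono) auto
  moreover have "norm p * R < R * R" using assms R by (intro mult_strict_right_mono) auto
  ultimately show False by (simp add: power2_eq_square)
qed

text \<open>The mean of \<open>cnj (h w)\<close> against the Cauchy kernel is constant, because
  \<open>cnj w = R\<^sup>2 / w\<close> on the circle turns it into the conjugate of a holomorphic mean.\<close>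

lemma Schwarz_mean:
  assumes h: "h holomorphic_on cball 0 R" and z: "norm z < R"
  shows "cmean R (\<lambda>w. 2 * of_real (Re (h w)) * (w / (w - z))) = h z + cnj (h 0)"
proof -
  have R: "0 < R" using z norm_ge_zero[of z] by linarith
  have ch: "continuous_on (sphere 0 R) h"
    by (rule continuous_on_subset[OF holomorphic_on_imp_continuous_on[OF h]]) auto
  have ck: "continuous_on (sphere 0 R) (\<lambda>w. w / (w - z))"
    using z by (auto intro!: continuous_intros)
  have 1: "cmean R (\<lambda>w. h w * (w / (w - z))) = h z"
    using Cauchy_mean[OF h z] by simp
  define k where "k = (\<lambda>w. h w * of_real (R\<^sup>2) / (of_real (R\<^sup>2) - cnj z * w))"
  have k: "k holomorphic_on cball 0 R" unfolding k_def
    by (intro holomorphic_intros h) (use denominator_nonzero[OF z] in auto)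
  have ck': "continuous_on (sphere 0 R) k"
    by (rule continuous_on_subset[OF holomorphic_on_imp_continuous_on[OF k]]) auto
  have "cmean R (\<lambda>w. cnj (h w) * (w / (w - z))) = cmean R (\<lambda>w. cnj (k w))"
  proof (rule cmean_cong)
    fix w :: complex assume w: "norm w = R"
    have ww: "w * cnj w = of_real (R\<^sup>2)" using w by (simp add: complex_norm_square [symmetric] del: of_real_power)
    have wz: "w \<noteq> z" "w \<noteq> 0" using w z R by auto
    have "of_real (R\<^sup>2) - z * cnj w = cnj w * (w - z)" using ww by (simp add: algebra_simps)
    hence "cnj (k w) = cnj (h w) * (w * cnj w) / (cnj w * (w - z))"
      unfolding k_def ww by simp
    also have "\<dots> = cnj (h w) * (w / (w - z))" using wz by (simp add: divide_simps)
    finally show "cnj (h w) * (w / (w - z)) = cnj (k w)" by simp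
  qed (use R in auto)
  also have "\<dots> = cnj (k 0)" using cnj_cmean[OF ck'] mean_value[OF k R] R by simp
  also have "\<dots> = cnj (h 0)" using R by (simp add: k_def)
  finally have 2: "cmean R (\<lambda>w. cnj (h w) * (w / (w - z))) = cnj (h 0)" .
  have "cmean R (\<lambda>w. 2 * of_real (Re (h w)) * (w / (w - z)))
      = cmean R (\<lambda>w. h w * (w / (w - z)) + cnj (h w) * (w / (w - z)))"
    by (rule cmean_cong) (use R in \<open>simp_all only: complex_add_cnj of_real_mult of_real_numeral
      mult.commute[of 2] less_imp_le flip: distrib_right\<close>)
  also have "\<dots> = h z + cnj (h 0)"
    by (subst cmean_add) (use R 1 2 in \<open>auto intro!: continuous_on_mult continuous_on_cnj ch ck simp del: times_divide_eq_right\<close>)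
  finally show ?thesis .
qed

text \<open>The Poisson kernel, with \<open>norm w\<close> in place of a fixed radius, so that it
  can be averaged over \<open>z\<close> as well as over \<open>w\<close>.\<close>

definition PK :: "complex \<Rightarrow> complex \<Rightarrow> real" where
  "PK z w = ((norm w)\<^sup>2 - (norm z)\<^sup>2) / (norm (w - z))\<^sup>2"

text \<open>The first form shows that the kernel is harmonic in \<open>z\<close>; the second ties it
  to the Cauchy kernel in \<open>Schwarz_mean\<close>.\<close>

lemma PK_eq_Re:
  fixes w z :: complex
  assumes "w \<noteq> z"
  shows "PK z w = Re ((w + z) / (w - z))"
    and "PK z w = 2 * Re (w / (w - z)) - 1"
proof -
  have "(w + z) / (w - z) = (w + z) * cnj (w - z) / of_real ((norm (w - z))\<^sup>2)"
    by (rule complex_div_cnj)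
  moreover have "Re ((w + z) * cnj (w - z)) = (norm w)\<^sup>2 - (norm z)\<^sup>2"
    unfolding cmod_power2 by (simp add: algebra_simps power2_eq_square)
  ultimately show 1: "PK z w = Re ((w + z) / (w - z))"
    by (simp add: PK_def Re_divide_of_real)
  have "(w + z) / (w - z) = 2 * (w / (w - z)) - 1" using assms by (simp add: field_simps)
  also have "Re \<dots> = 2 * Re (w / (w - z)) - 1" by (simp only: minus_complex.simps Re_complex_of_real one_complex.simps mult_2 plus_complex.simps)
  finally show "PK z w = 2 * Re (w / (w - z)) - 1" using 1 by simp
qed

lemma continuous_on_PK:
  assumes "norm z < R"
  shows "continuous_on (sphere 0 R) (PK z)"
  unfolding PK_def using assms by (auto intro!: continuous_intros)

lemma PK_nonneg: "norm z \<le> norm w \<Longrightarrow> 0 \<le> PK z w"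
  by (simp add: PK_def)

text \<open>Write the kernel as \<open>2 * Re (w / (w - z)) - 1\<close>. The first part gives the
  real part of the Schwarz formula, and the \<open>- 1\<close> subtracts the mean value
  \<open>Re (h 0)\<close>, which cancels the contribution of \<open>cnj (h 0)\<close>.\<close>

lemma Poisson_mean:
  assumes h: "h holomorphic_on cball 0 R" and z: "norm z < R"
  shows "cmean R (\<lambda>w. Re (h w) * PK z w) = Re (h z)"
proof -
  have R: "0 < R" using z norm_ge_zero[of z] by linarith
  have ch: "continuous_on (sphere 0 R) h"
    by (rule continuous_on_subset[OF holomorphic_on_imp_continuous_on[OF h]]) auto
  have ck: "continuous_on (sphere 0 R) (\<lambda>w. w / (w - z))"
    using z by (auto intro!: continuous_intros)
  have "cmean R (\<lambda>w. Re (h w) * PK z w)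
      = cmean R (\<lambda>w. Re (2 * of_real (Re (h w)) * (w / (w - z))) - Re (h w))"
  proof (rule cmean_cong)
    fix w :: complex assume w: "norm w = R"
    hence "w \<noteq> z" using z by auto
    have *: "Re (2 * of_real a * b) = 2 * a * Re b" for a b by simp
    show "Re (h w) * PK z w = Re (2 * of_real (Re (h w)) * (w / (w - z))) - Re (h w)"
      unfolding PK_eq_Re(2)[OF \<open>w \<noteq> z\<close>] * by (simp add: algebra_simps)
  qed (use R in auto)
  also have "\<dots> = cmean R (\<lambda>w. Re (2 * of_real (Re (h w)) * (w / (w - z)))) - cmean R (\<lambda>w. Re (h w))"
    by (rule cmean_diff) (use R ch ck in \<open>auto intro!: continuous_intros simp del: times_divide_eq_right\<close>)
  also have "cmean R (\<lambda>w. Re (2 * of_real (Re (h w)) * (w / (w - z)))) = Re (h z + cnj (h 0))"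
    by (subst Schwarz_mean[OF assms, symmetric], subst Re_cmean)
       (use R ch ck in \<open>auto intro!: continuous_intros simp del: times_divide_eq_right\<close>)
  also have "cmean R (\<lambda>w. Re (h w)) = Re (h 0)" by (rule mean_value_Re) fact+
  finally show ?thesis by simp
qed

text \<open>In the variable \<open>z\<close> the kernel is the real part of a holomorphic function
  whose value at the origin is \<open>1\<close>.\<close>

lemma cmean_PK:
  assumes "norm w = R" "0 < r" "r < R"
  shows "cmean r (\<lambda>z. PK z w) = 1"
proof -
  have "cmean r (\<lambda>z. PK z w) = cmean r (\<lambda>z. Re ((w + z) / (w - z)))"
    by (rule cmean_cong) (use assms in \<open>auto intro!: PK_eq_Re\<close>)
  also have "\<dots> = Re ((w + 0) / (w - 0))"
    by (rule mean_value_Re) (use assms in \<open>auto intro!: holomorphic_intros\<close>)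
  also have "\<dots> = 1" using assms by auto
  finally show ?thesis .
qed

lemma cmean_swap:
  fixes V :: "complex \<Rightarrow> complex \<Rightarrow> real"
  assumes "continuous_on (sphere 0 r \<times> sphere 0 R) (\<lambda>(z, w). V z w)" "0 \<le> r" "0 \<le> R"
  shows "cmean r (\<lambda>z. cmean R (V z)) = cmean R (\<lambda>w. cmean r (\<lambda>z. V z w))"
proof -
  have "continuous_on (cbox (0,0) (2*pi,2*pi)) (\<lambda>x::real\<times>real. (case (of_real r * cis (fst x), of_real R * cis (snd x)) of (z,w) \<Rightarrow> V z w))"
    by (rule continuous_on_compose2[OF assms(1)])
       (use assms(2,3) in \<open>auto intro!: continuous_intros simp: norm_mult\<close>)
  hence "continuous_on (cbox (0,0) (2*pi,2*pi)) (\<lambda>(x::real,y::real). V (of_real r * cis x) (of_real R * cis y))"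
    by (simp add: case_prod_unfold)
  from integral_swap_continuous[OF this] show ?thesis
    by (simp add: cmean_def)
qed

text \<open>Swap the two means and apply \<open>cmean_PK\<close>. A pointwise bound by a Poisson
  integral thereby turns, after averaging over the inner circle, into a bound by a plain mean over
  the outer one.\<close>

lemma cmean_Poisson_integral:
  fixes v :: "complex \<Rightarrow> real"
  assumes v: "continuous_on (sphere 0 R) v" and r: "0 < r" "r < R"
  shows "cmean r (\<lambda>z. cmean R (\<lambda>w. v w * PK z w)) = cmean R v"
    and "continuous_on (sphere 0 r) (\<lambda>z. cmean R (\<lambda>w. v w * PK z w))"
proof -
  have cv: "continuous_on (sphere 0 r \<times> sphere 0 R) (\<lambda>x. v (snd x))"
    by (rule continuous_on_compose2[OF v]) (auto intro!: continuous_intros)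
  have c: "continuous_on (sphere 0 r \<times> sphere 0 R) (\<lambda>(z, w). v w * PK z w)"
    unfolding PK_def case_prod_unfold
    by (intro continuous_intros cv) (use r in auto)
  have "cmean r (\<lambda>z. cmean R (\<lambda>w. v w * PK z w)) = cmean R (\<lambda>w. cmean r (\<lambda>z. v w * PK z w))"
    by (rule cmean_swap[OF c]) (use r in auto)
  also have "\<dots> = cmean R v"
    by (rule cmean_cong) (use r in \<open>auto simp: cmean_cmult cmean_PK\<close>)
  finally show "cmean r (\<lambda>z. cmean R (\<lambda>w. v w * PK z w)) = cmean R v" .
  have "continuous_on (sphere 0 r \<times> cbox 0 (2*pi)) (\<lambda>x. (case (fst x, of_real R * cis (snd x)) of (z,w) \<Rightarrow> v w * PK z w))"
    by (rule continuous_on_compose2[OF c])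
       (use r in \<open>auto intro!: continuous_intros simp: norm_mult\<close>)
  hence "continuous_on (sphere 0 r \<times> cbox 0 (2*pi)) (\<lambda>(z,t). v (of_real R * cis t) * PK z (of_real R * cis t))"
    by (simp add: case_prod_unfold)
  from integral_continuous_on_param[OF this]
  show "continuous_on (sphere 0 r) (\<lambda>z. cmean R (\<lambda>w. v w * PK z w))"
    unfolding cmean_def by (intro continuous_intros) simp_all
qed

section \<open>Circle means of logarithms of moduli\<close>

lemma log_norm_mean:
  assumes h: "h holomorphic_on ball 0 R" and nz: "\<And>z. norm z < R \<Longrightarrow> h z \<noteq> 0" and r: "0 < r" "r < R"
  shows "cmean r (\<lambda>z. ln (norm (h z))) = ln (norm (h 0))"
proof -
  obtain g where g: "g holomorphic_on ball 0 R" "\<And>z. z \<in> ball 0 R \<Longrightarrow> h z = exp (g z)"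
    by (rule contractible_imp_holomorphic_log[OF h]) (use nz in \<open>auto intro: convex_imp_contractible\<close>)
  have "cmean r (\<lambda>z. ln (norm (h z))) = cmean r (\<lambda>z. Re (g z))"
    by (rule cmean_cong) (use g r in auto)
  also have "\<dots> = Re (g 0)"
    by (rule mean_value_Re) (use r in \<open>auto intro!: holomorphic_on_subset[OF g(1)]\<close>)
  also have "\<dots> = ln (norm (h 0))" using g(2)[of 0] r by simp
  finally show ?thesis .
qed

text \<open>For \<open>p\<close> outside the circle, \<open>z - p\<close> has no zero in a larger
  disc. For \<open>p\<close> inside, \<open>norm (z - p)\<close> equals the modulus of
  \<open>of_real (r\<^sup>2) - cnj p * z\<close> divided by \<open>r\<close> on the circle, and the
  latter function is free of zeros up to the radius \<open>r\<^sup>2 / norm p > r\<close>.\<close>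

lemma cmean_log_linear:
  assumes r: "0 < r" "r \<noteq> norm p"
  shows "cmean r (\<lambda>z. ln (norm (z - p))) = ln (max r (norm p))"
proof (cases "r < norm p")
  case True
  have "cmean r (\<lambda>z. ln (norm (z - p))) = ln (norm (0 - p))"
    by (rule log_norm_mean[where R="norm p"]) (use r True in \<open>auto intro!: holomorphic_intros\<close>)
  thus ?thesis using True by simp
next
  case False
  hence p: "norm p < r" using r by simp
  have "cmean r (\<lambda>z. ln (norm (z - p))) = cmean r (\<lambda>z. ln (norm (of_real (r\<^sup>2) - cnj p * z)) - ln r)"
  proof (rule cmean_cong)
    fix z :: complex assume z: "norm z = r"
    have zz: "z * cnj z = of_real (r\<^sup>2)" using z by (simp add: complex_norm_square [symmetric] del: of_real_power)
    have "norm (of_real (r\<^sup>2) - cnj p * z) = norm (z * cnj (z - p))"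
      using zz by (simp add: algebra_simps)
    also have "\<dots> = r * norm (z - p)" using z unfolding norm_mult complex_mod_cnj by simp
    finally have "norm (of_real (r\<^sup>2) - cnj p * z) = r * norm (z - p)" .
    moreover have "norm (z - p) > 0" using z p by auto
    ultimately show "ln (norm (z - p)) = ln (norm (of_real (r\<^sup>2) - cnj p * z)) - ln r"
      using r by (simp add: ln_mult)
  qed (use r in auto)
  also have "\<dots> = cmean r (\<lambda>z. ln (norm (of_real (r\<^sup>2) - cnj p * z))) - ln r"
    by (subst cmean_diff) (use r denominator_nonzero[OF p] in \<open>auto intro!: continuous_intros\<close>)
  also have "cmean r (\<lambda>z. ln (norm (of_real (r\<^sup>2) - cnj p * z))) = ln (norm (of_real (r\<^sup>2) - cnj p * 0))"
  proof (cases "p = 0")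
    case False
    have *: "r < r\<^sup>2 / norm p" using p False r by (simp add: field_simps power2_eq_square)
    show ?thesis
    proof (rule log_norm_mean[OF _ _ r(1) *])
      fix z :: complex assume "norm z < r\<^sup>2 / norm p"
      hence "norm (cnj p * z) < r\<^sup>2" using False by (simp add: norm_mult field_simps)
      hence "norm (cnj p * z) < norm (of_real (r\<^sup>2) :: complex)" by (simp add: norm_power)
      thus "of_real (r\<^sup>2) - cnj p * z \<noteq> 0" by auto
    qed (auto intro!: holomorphic_intros)
  qed auto
  finally show ?thesis using p r by (simp add: max_def norm_power ln_realpow)
qed

subsection \<open>Divisors and Blaschke factorization\<close>

text \<open>By \<open>meromorphic_zero_or_nonzero\<close> these are exactly the meromorphic
  functions on the plane that do not vanish identically. The class is closed under products and
  quotients, and \<open>zorder\<close> is additive on it.\<close>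

definition nonzero_meromorphic :: "(complex \<Rightarrow> complex) \<Rightarrow> bool" where
  "nonzero_meromorphic f \<longleftrightarrow> f meromorphic_on UNIV \<and> (\<forall>\<^sub>\<approx>z. f z \<noteq> 0)"

text \<open>The condition concerns the stored values, so circles through points with arbitrary
  values at removable singularities are excluded together with those through zeros and poles. Only
  countably many radii are lost (\<open>countable_not_regular\<close>).\<close>

definition regular_on_circle :: "(complex \<Rightarrow> complex) \<Rightarrow> real \<Rightarrow> bool" where
  "regular_on_circle f r \<longleftrightarrow> 0 < r \<and> (\<forall>z. norm z = r \<longrightarrow> f analytic_on {z} \<and> f z \<noteq> 0)"

section \<open>Closure properties of meromorphic functions that are not identically zero\<close>

lemma meromorphic_zero_or_nonzero:
  "f meromorphic_on UNIV \<Longrightarrow> (\<forall>\<^sub>\<approx>z. f z = 0) \<or> nonzero_meromorphic f"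
  using meromorphic_imp_constant_or_avoid[of f UNIV 0] by (auto simp: nonzero_meromorphic_def)

lemma nonzero_meromorphicD:
  assumes "nonzero_meromorphic f"
  shows "f meromorphic_on A" "eventually (\<lambda>w. f w \<noteq> 0) (at z)" "frequently (\<lambda>w. f w \<noteq> 0) (at z)"
    "isolated_singularity_at f z" "not_essential f z"
proof -
  show "f meromorphic_on A" using assms meromorphic_on_subset by (auto simp: nonzero_meromorphic_def)
  show "eventually (\<lambda>w. f w \<noteq> 0) (at z)"
    using assms eventually_cosparse_imp_eventually_at[of _ UNIV z UNIV] by (auto simp: nonzero_meromorphic_def)
  thus "frequently (\<lambda>w. f w \<noteq> 0) (at z)" by (intro eventually_frequently) auto
  show "isolated_singularity_at f z" "not_essential f z"
    using assms by (auto simp: nonzero_meromorphic_def meromorphic_on_altdef)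
qed

lemma nonzero_meromorphic_const: "c \<noteq> 0 \<Longrightarrow> nonzero_meromorphic (\<lambda>_. c)"
  by (auto simp: nonzero_meromorphic_def)

lemma nonzero_meromorphic_mult:
  assumes "nonzero_meromorphic f" "nonzero_meromorphic g"
  shows "nonzero_meromorphic (\<lambda>z. f z * g z)"
proof -
  have "\<forall>\<^sub>\<approx>z. f z \<noteq> 0" "\<forall>\<^sub>\<approx>z. g z \<noteq> 0" using assms by (auto simp: nonzero_meromorphic_def)
  hence "\<forall>\<^sub>\<approx>z. f z * g z \<noteq> 0" by eventually_elim simp
  thus ?thesis using assms by (auto simp: nonzero_meromorphic_def intro!: meromorphic_intros)
qed

lemma nonzero_meromorphic_divide:
  assumes "nonzero_meromorphic f" "nonzero_meromorphic g"
  shows "nonzero_meromorphic (\<lambda>z. f z / g z)"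
proof -
  have "\<forall>\<^sub>\<approx>z. f z \<noteq> 0" "\<forall>\<^sub>\<approx>z. g z \<noteq> 0" using assms by (auto simp: nonzero_meromorphic_def)
  hence "\<forall>\<^sub>\<approx>z. f z / g z \<noteq> 0" by eventually_elim simp
  thus ?thesis using assms by (auto simp: nonzero_meromorphic_def intro!: meromorphic_intros)
qed

lemma nonzero_meromorphic_inverse:
  "nonzero_meromorphic f \<Longrightarrow> nonzero_meromorphic (\<lambda>z. 1 / f z)"
  using nonzero_meromorphic_divide[OF nonzero_meromorphic_const[of 1]] by simp

lemma nonzero_meromorphic_power:
  "nonzero_meromorphic f \<Longrightarrow> nonzero_meromorphic (\<lambda>z. f z ^ n)"
  by (induction n) (auto intro: nonzero_meromorphic_const nonzero_meromorphic_mult)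

lemma nonzero_meromorphic_powi:
  assumes "nonzero_meromorphic f"
  shows "nonzero_meromorphic (\<lambda>z. f z powi n)"
proof -
  have "\<forall>\<^sub>\<approx>z. f z \<noteq> 0" using assms by (auto simp: nonzero_meromorphic_def)
  hence "\<forall>\<^sub>\<approx>z. f z powi n \<noteq> 0" by eventually_elim simp
  thus ?thesis using assms by (auto simp: nonzero_meromorphic_def intro!: meromorphic_intros)
qed

lemma nonzero_meromorphic_prod:
  "(\<And>p. p \<in> A \<Longrightarrow> nonzero_meromorphic (f p)) \<Longrightarrow> nonzero_meromorphic (\<lambda>z. \<Prod>p\<in>A. f p z)"
  by (induction A rule: infinite_finite_induct)
     (auto intro: nonzero_meromorphic_const nonzero_meromorphic_mult)

lemma nonzero_meromorphic_cong:
  assumes "\<forall>\<^sub>\<approx>z. f z = g z"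
  shows "nonzero_meromorphic f \<longleftrightarrow> nonzero_meromorphic g"
proof -
  have "(\<forall>\<^sub>\<approx>z. f z \<noteq> 0) \<longleftrightarrow> (\<forall>\<^sub>\<approx>z. g z \<noteq> 0)"
    by (rule eventually_subst) (use assms in eventually_elim, auto)
  thus ?thesis using meromorphic_on_cong'[OF assms refl] by (simp add: nonzero_meromorphic_def)
qed

lemma eventually_cosparse_translate:
  assumes "\<forall>\<^sub>\<approx>z. P z"
  shows "\<forall>\<^sub>\<approx>z. P (z + c :: complex)"
proof -
  have "\<forall>\<^sub>F z in at x. P (z + c)" for x
  proof -
    have "\<forall>\<^sub>F z in at (x + c). P z"
      using eventually_cosparse_imp_eventually_at[OF assms] by auto
    moreover have "filterlim (\<lambda>z. z + c) (at (x + c)) (at x)"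
      by (auto simp: filterlim_at eventually_at_filter intro!: tendsto_intros always_eventually)
    ultimately show ?thesis using eventually_compose_filterlim by blast
  qed
  thus ?thesis by (simp add: eventually_cosparse_open_eq)
qed

lemma meromorphic_shift:
  assumes "f meromorphic_on UNIV"
  shows "(\<lambda>z. f (z + c)) meromorphic_on UNIV"
  by (rule meromorphic_on_compose[OF assms]) (auto intro!: analytic_intros)

lemma nonzero_meromorphic_shift:
  "nonzero_meromorphic f \<Longrightarrow> nonzero_meromorphic (\<lambda>z. f (z + c))"
  using eventually_cosparse_translate[of "\<lambda>z. f z \<noteq> 0" c]
  by (simp add: nonzero_meromorphic_def meromorphic_shift)

lemma zorder_eq_0_analytic:
  assumes "f analytic_on {z}" "f z \<noteq> 0"
  shows "zorder f z = 0"
proof -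
  obtain S where "open S" "z \<in> S" "f holomorphic_on S"
    using assms(1) by (auto simp: analytic_at)
  thus ?thesis by (intro zorder_eqI[of S z f]) (use assms in auto)
qed

lemma is_pole_iff_zorder:
  assumes "nonzero_meromorphic f"
  shows "is_pole f z \<longleftrightarrow> zorder f z < 0"
  using isolated_pole_imp_neg_zorder[of f z] zorder_neg_imp_is_pole[of f z] nonzero_meromorphicD[OF assms]
  by auto

lemma regular_cosparse:
  assumes "nonzero_meromorphic f"
  shows "\<forall>\<^sub>\<approx>z. f analytic_on {z} \<and> f z \<noteq> 0"
  using assms by (auto simp: nonzero_meromorphic_def intro: eventually_conj meromorphic_on_imp_analytic_cosparse)

lemma countable_not_regular:
  assumes "nonzero_meromorphic f"
  shows "countable {r. 0 < r \<and> \<not> regular_on_circle f r}"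
proof -
  define B where "B = {z. \<not> (f analytic_on {z} \<and> f z \<noteq> 0)}"
  have "B sparse_in UNIV" using regular_cosparse[OF assms] by (simp only: eventually_cosparse B_def)
  hence "countable (norm ` B)" using sparse_imp_countable[of UNIV B] by simp
  moreover have "{r. 0 < r \<and> \<not> regular_on_circle f r} \<subseteq> norm ` B"
    by (auto simp: regular_on_circle_def B_def)
  ultimately show ?thesis by (rule countable_subset[rotated])
qed

lemma finite_zorder_support:
  assumes "nonzero_meromorphic f"
  shows "finite {p. norm p \<le> r \<and> zorder f p \<noteq> 0}"
proof -
  define B where "B = {z. \<not> (f analytic_on {z} \<and> f z \<noteq> 0)}"
  have "B sparse_in UNIV" using regular_cosparse[OF assms] by (simp only: eventually_cosparse B_def)
  hence "finite (cball 0 r \<inter> B)" by (intro sparse_in_compact_finite) (auto intro: sparse_in_subset)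
  moreover have "{p. norm p \<le> r \<and> zorder f p \<noteq> 0} \<subseteq> cball 0 r \<inter> B"
    using zorder_eq_0_analytic by (auto simp: B_def)
  ultimately show ?thesis by (rule finite_subset[rotated])
qed

section \<open>Divisors and their counting functions\<close>

definition zer :: "(complex \<Rightarrow> complex) \<Rightarrow> complex \<Rightarrow> real" where
  "zer f p = real (nat (zorder f p))"

definition pol :: "(complex \<Rightarrow> complex) \<Rightarrow> complex \<Rightarrow> real" where
  "pol f p = real (nat (- zorder f p))"

text \<open>The convention \<open>ln 0 = 0\<close> gives a point at the origin the weight \<open>ln r\<close>.\<close>

definition counting :: "(complex \<Rightarrow> real) \<Rightarrow> real \<Rightarrow> real" where
  "counting D r = (\<Sum>p | norm p \<le> r \<and> D p \<noteq> 0. D p * (ln r - ln (norm p)))"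

lemma zorder_eq_zer_pol: "real_of_int (zorder f p) = zer f p - pol f p"
  by (simp add: zer_def pol_def)

lemma zer_nonneg [simp]: "0 \<le> zer f p" and pol_nonneg [simp]: "0 \<le> pol f p"
  by (simp_all add: zer_def pol_def)

lemma finite_pol: "nonzero_meromorphic f \<Longrightarrow> finite {p. norm p \<le> r \<and> pol f p \<noteq> 0}"
  by (rule finite_subset[OF _ finite_zorder_support[of f r]]) (auto simp: pol_def)

lemma finite_zer: "nonzero_meromorphic f \<Longrightarrow> finite {p. norm p \<le> r \<and> zer f p \<noteq> 0}"
  by (rule finite_subset[OF _ finite_zorder_support[of f r]]) (auto simp: zer_def)

text \<open>A pole \<open>p \<noteq> 0\<close> contributes the integral of \<open>1 / t\<close> over
  \<open>{norm p..r}\<close>. The pole at the origin is removed from the integrand and returns as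
  the \<open>ln r\<close> term, which is its weight in \<open>counting\<close> because
  \<open>ln 0 = 0\<close>.\<close>

lemma nev_N_eq_counting:
  assumes f: "nonzero_meromorphic f" and r: "0 < r"
  shows "nev_N r f = counting (pol f) r"
proof -
  define P where "P = {p. norm p \<le> r \<and> is_pole f p}"
  have P_eq: "P = {p. norm p \<le> r \<and> pol f p \<noteq> 0}"
    by (auto simp: P_def is_pole_iff_zorder[OF f] pol_def)
  have fin: "finite P" unfolding P_eq by (rule finite_pol[OF f])
  have pc: "real (pole_count t f) = (\<Sum>p\<in>P. if norm p \<le> t then pol f p else 0)" if "t \<le> r" for t
  proof -
    have "real (pole_count t f) = (\<Sum>p | norm p \<le> t \<and> is_pole f p. pol f p)"
      by (simp add: pole_count_def pol_def)
    also have "{p. norm p \<le> t \<and> is_pole f p} = {p\<in>P. norm p \<le> t}" using that by (auto simp: P_def)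
    also have "(\<Sum>p\<in>{p\<in>P. norm p \<le> t}. pol f p) = (\<Sum>p\<in>P. if norm p \<le> t then pol f p else 0)"
      using fin by (simp add: sum.inter_filter)
    finally show ?thesis .
  qed
  have I: "((\<lambda>t. if t \<in> {norm p..r} then pol f p * (1 / t) else 0) has_integral
       pol f p * (ln r - ln (norm p))) {0..r}" if "p \<in> P - {0}" for p
  proof -
    have p: "0 < norm p" "norm p \<le> r" using that by (auto simp: P_def)
    have pos: "0 < x" if "norm p \<le> x" for x using p that by linarith
    have "((\<lambda>t. 1 / t) has_integral (ln r - ln (norm p))) {norm p..r}"
      by (rule fundamental_theorem_of_calculus)
         (use p(2) pos in \<open>auto intro!: derivative_eq_intros simp flip: has_real_derivative_iff_has_vector_derivative\<close>)
    hence "((\<lambda>t. pol f p * (1 / t)) has_integral pol f p * (ln r - ln (norm p))) {norm p..r}"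
      by (rule has_integral_mult_right)
    thus ?thesis by (subst has_integral_restrict) (use p in auto)
  qed
  have "((\<lambda>t. \<Sum>p\<in>P-{0}. if t \<in> {norm p..r} then pol f p * (1 / t) else 0) has_integral
       (\<Sum>p\<in>P-{0}. pol f p * (ln r - ln (norm p)))) {0..r}"
    by (rule has_integral_sum) (use fin I in auto)
  also have "?this \<longleftrightarrow> ((\<lambda>t. (real (pole_count t f) - real (pole_count 0 f)) / t) has_integral
       (\<Sum>p\<in>P-{0}. pol f p * (ln r - ln (norm p)))) {0..r}"
  proof (rule has_integral_cong)
    fix t assume t: "t \<in> {0..r}"
    have "real (pole_count t f) - real (pole_count 0 f) =
       (\<Sum>p\<in>P. (if norm p \<le> t then pol f p else 0) - (if norm p \<le> 0 then pol f p else 0))"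
      using t by (subst (1 2) pc) (auto simp: sum_subtractf)
    also have "\<dots> = (\<Sum>p\<in>P-{0}. if norm p \<le> t then pol f p else 0)"
      by (rule sum.mono_neutral_cong_right) (use fin t in auto)
    finally have *: "real (pole_count t f) - real (pole_count 0 f) = \<dots>" .
    show "(\<Sum>p\<in>P-{0}. if t \<in> {norm p..r} then pol f p * (1 / t) else 0)
       = (real (pole_count t f) - real (pole_count 0 f)) / t"
      unfolding * sum_divide_distrib by (intro sum.cong) (use t in auto)
  qed
  finally have "integral {0..r} (\<lambda>t. (real (pole_count t f) - real (pole_count 0 f)) / t)
     = (\<Sum>p\<in>P-{0}. pol f p * (ln r - ln (norm p)))" by (rule integral_unique)
  moreover have "real (pole_count 0 f) = (if 0 \<in> P then pol f 0 else 0)"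
    using r fin by (subst pc) (auto simp: sum.delta cong: if_cong)
  ultimately show ?thesis unfolding nev_N_def counting_def P_eq[symmetric]
    using fin by (cases "0 \<in> P") (auto simp: sum.remove[of P 0])
qed

lemma counting_eq_sum:
  assumes "finite Z" "{p. norm p \<le> r \<and> D p \<noteq> 0} \<subseteq> Z" "Z \<subseteq> {p. norm p \<le> r}"
  shows "counting D r = (\<Sum>p\<in>Z. D p * (ln r - ln (norm p)))"
  unfolding counting_def by (rule sum.mono_neutral_left) (use assms in auto)

text \<open>The weight of the origin is \<open>ln r\<close>, which explains the recurring assumption
  \<open>1 \<le> r\<close>.\<close>

lemma counting_weight_nonneg: "1 \<le> r \<Longrightarrow> norm (p::complex) \<le> r \<Longrightarrow> 0 \<le> ln r - ln (norm p)"
  by (cases "p = 0") auto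

lemma counting_nonneg:
  assumes "1 \<le> r" "\<And>p. 0 \<le> D p"
  shows "0 \<le> counting D r"
  unfolding counting_def by (intro sum_nonneg mult_nonneg_nonneg) (use assms counting_weight_nonneg in auto)

lemma counting_le:
  assumes "finite {p. norm p \<le> r \<and> E p \<noteq> 0}" "\<And>p. 0 \<le> D p" "\<And>p. D p \<le> E p" "1 \<le> r"
  shows "counting D r \<le> counting E r"
proof -
  have "D p = 0" if "E p = 0" for p using assms(2,3)[of p] that by simp
  hence "counting D r = (\<Sum>p | norm p \<le> r \<and> E p \<noteq> 0. D p * (ln r - ln (norm p)))"
    by (intro counting_eq_sum) (use assms in auto)
  also have "\<dots> \<le> counting E r" unfolding counting_def
    by (intro sum_mono mult_right_mono) (use assms counting_weight_nonneg in auto)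
  finally show ?thesis .
qed

lemma counting_add:
  assumes "finite {p. norm p \<le> r \<and> D p \<noteq> 0}" "finite {p. norm p \<le> r \<and> E p \<noteq> 0}"
  shows "counting (\<lambda>p. D p + E p) r = counting D r + counting E r"
proof -
  define Z where "Z = {p. norm p \<le> r \<and> D p \<noteq> 0} \<union> {p. norm p \<le> r \<and> E p \<noteq> 0}"
  have "counting D r = (\<Sum>p\<in>Z. D p * (ln r - ln (norm p)))"
    "counting E r = (\<Sum>p\<in>Z. E p * (ln r - ln (norm p)))"
    "counting (\<lambda>p. D p + E p) r = (\<Sum>p\<in>Z. (D p + E p) * (ln r - ln (norm p)))"
    by (rule counting_eq_sum; use assms in \<open>auto simp: Z_def\<close>)+
  thus ?thesis by (simp add: sum.distrib distrib_right)
qed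

lemma counting_mono:
  assumes fin: "finite {p. norm p \<le> s \<and> D p \<noteq> 0}" and "\<And>p. 0 \<le> D p" "1 \<le> r" "r \<le> s"
  shows "counting D r \<le> counting D s"
proof -
  have "counting D r \<le> (\<Sum>p | norm p \<le> r \<and> D p \<noteq> 0. D p * (ln s - ln (norm p)))"
    unfolding counting_def by (intro sum_mono mult_left_mono) (use assms in auto)
  also have "\<dots> \<le> counting D s" unfolding counting_def
    by (rule sum_mono2) (use assms counting_weight_nonneg[of s] in auto)
  finally show ?thesis .
qed

section \<open>Factoring out a finite divisor\<close>

lemma zorder_prod_powi:
  assumes "\<And>p. p \<in> Z \<Longrightarrow> nonzero_meromorphic (b p)"
  shows "zorder (\<lambda>z. \<Prod>p\<in>Z. b p z powi n p) q = (\<Sum>p\<in>Z. n p * zorder (b p) q)"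
proof -
  have "zorder (\<lambda>z. \<Prod>p\<in>Z. b p z powi n p) q = (\<Sum>p\<in>Z. zorder (\<lambda>z. b p z powi n p) q)"
    by (rule zorder_prod)
       (use assms in \<open>auto intro!: nonzero_meromorphicD nonzero_meromorphic_powi nonzero_meromorphic_prod\<close>)
  also have "\<dots> = (\<Sum>p\<in>Z. n p * zorder (b p) q)"
    by (intro sum.cong refl zorder_power_int) (use assms in \<open>auto intro!: nonzero_meromorphicD\<close>)
  finally show ?thesis .
qed

text \<open>At a point of order zero the stored value of \<open>f\<close> may still be wrong, so
  analyticity and nonvanishing can be claimed only after \<open>remove_sings\<close>.\<close>

lemma zorder_0_remove_sings:
  assumes f: "nonzero_meromorphic f" and z: "zorder f z = 0"
  shows "remove_sings f analytic_on {z}" "remove_sings f z \<noteq> 0"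
proof -
  obtain r where r: "zor_poly f z z \<noteq> 0" "r > 0" "zor_poly f z holomorphic_on cball z r"
      "\<And>w. w \<in> cball z r - {z} \<Longrightarrow> f w = zor_poly f z w * (w - z) powi (zorder f z)"
    using zorder_exist[OF nonzero_meromorphicD(4,5,3)[OF f], of z] by blast
  have "zor_poly f z analytic_on {z}"
    using r by (auto simp: analytic_at intro!: exI[of _ "ball z r"] intro: holomorphic_on_subset)
  hence "zor_poly f z \<midarrow>z\<rightarrow> zor_poly f z z" using analytic_at_imp_isCont isContD by blast
  moreover have "eventually (\<lambda>w. w \<in> cball z r - {z}) (at z)"
    using eventually_at_in_open'[of "ball z r" z] r(2) by (auto simp: eventually_at_filter elim!: eventually_mono)
  hence "eventually (\<lambda>w. zor_poly f z w = f w) (at z)"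
    by eventually_elim (use r(4) z in auto)
  ultimately have lim: "f \<midarrow>z\<rightarrow> zor_poly f z z" by (rule Lim_transform_eventually)
  show "remove_sings f analytic_on {z}"
    by (rule remove_sings_analytic_at[OF nonzero_meromorphicD(4)[OF f] lim])
  show "remove_sings f z \<noteq> 0" using remove_sings_eqI[OF lim] r(1) by simp
qed

text \<open>Dividing by the product of the \<open>b p\<close> leaves order zero everywhere in
  \<open>S\<close>, so after removal of singularities there is a holomorphic logarithm. The factors
  are kept abstract because they are Blaschke factors on a disc in one application and
  \<open>z - p\<close> on the whole plane in the other.\<close>

lemma factorization_on_contractible:
  assumes f: "nonzero_meromorphic f" and S: "open S" "contractible S"
    and Z: "finite Z" "{p\<in>S. zorder f p \<noteq> 0} \<subseteq> Z"
    and b: "\<And>p. p \<in> Z \<Longrightarrow> nonzero_meromorphic (b p)"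
      "\<And>p. p \<in> Z \<Longrightarrow> zorder (b p) p = 1"
      "\<And>p q. p \<in> Z \<Longrightarrow> q \<in> S \<Longrightarrow> q \<noteq> p \<Longrightarrow> zorder (b p) q = 0"
  obtains h where "h holomorphic_on S"
    "\<And>z. z \<in> S \<Longrightarrow> f analytic_on {z} \<Longrightarrow> (\<And>p. p \<in> Z \<Longrightarrow> b p analytic_on {z} \<and> b p z \<noteq> 0)
      \<Longrightarrow> f z = exp (h z) * (\<Prod>p\<in>Z. b p z powi zorder f p)"
proof -
  define B where "B = (\<lambda>z. \<Prod>p\<in>Z. b p z powi (- zorder f p))"
  define F where "F = (\<lambda>z. f z * B z)"
  have B: "nonzero_meromorphic B" unfolding B_def
    by (intro nonzero_meromorphic_prod nonzero_meromorphic_powi b)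
  have F: "nonzero_meromorphic F" unfolding F_def by (intro nonzero_meromorphic_mult f B)
  have zF: "zorder F q = 0" if q: "q \<in> S" for q
  proof -
    have "zorder F q = zorder f q + zorder B q" unfolding F_def
      by (intro zorder_mult nonzero_meromorphicD f B)
    also have "zorder B q = (\<Sum>p\<in>Z. - zorder f p * zorder (b p) q)"
      unfolding B_def by (rule zorder_prod_powi) (rule b)
    also have "\<dots> = (\<Sum>p\<in>Z. if p = q then - zorder f p else 0)"
      by (intro sum.cong refl) (use b q in auto)
    also have "\<dots> = - zorder f q" using Z q by (auto simp: sum.delta)
    finally show ?thesis by simp
  qed
  have "remove_sings F analytic_on S"
    using zorder_0_remove_sings(1)[OF F zF] analytic_on_analytic_at by blast
  hence holo: "remove_sings F holomorphic_on S" by (rule analytic_imp_holomorphic)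
  obtain h where h: "h holomorphic_on S" "\<And>z. z \<in> S \<Longrightarrow> remove_sings F z = exp (h z)"
    by (rule contractible_imp_holomorphic_log[OF holo S(2)]) (use zorder_0_remove_sings(2)[OF F zF] in auto)
  show ?thesis
  proof (rule that[OF h(1)])
    fix z assume z: "z \<in> S" "f analytic_on {z}" and bz: "\<And>p. p \<in> Z \<Longrightarrow> b p analytic_on {z} \<and> b p z \<noteq> 0"
    have "F analytic_on {z}" unfolding F_def B_def
      by (intro analytic_intros z) (use bz in auto)
    hence "F z = exp (h z)" using h(2)[OF z(1)] by simp
    moreover have "B z * (\<Prod>p\<in>Z. b p z powi zorder f p) = 1"
      unfolding B_def prod.distrib[symmetric]
      by (rule prod.neutral) (use bz in \<open>auto simp: power_int_minus\<close>)
    ultimately show "f z = exp (h z) * (\<Prod>p\<in>Z. b p z powi zorder f p)"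
      unfolding F_def by (metis mult.assoc mult.right_neutral)
  qed
qed

definition blaschke :: "real \<Rightarrow> complex \<Rightarrow> complex \<Rightarrow> complex" where
  "blaschke R p z = of_real R * (z - p) / (of_real (R\<^sup>2) - cnj p * z)"

lemma nonzero_meromorphic_linear:
  assumes "a \<noteq> 0 \<or> b \<noteq> 0"
  shows "nonzero_meromorphic (\<lambda>z. a + b * z)"
proof -
  have "finite {z. a + b * z = 0}"
  proof (rule finite_subset)
    show "{z. a + b * z = 0} \<subseteq> {- a / b}" using assms
      by (auto simp: field_simps add_eq_0_iff2)
  qed auto
  hence "\<forall>\<^sub>\<approx>z. a + b * z \<noteq> 0" by (simp add: eventually_cosparse finite_imp_sparse)
  thus ?thesis by (auto simp: nonzero_meromorphic_def intro!: meromorphic_intros)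
qed

lemma nonzero_meromorphic_blaschke:
  assumes "R > 0"
  shows "nonzero_meromorphic (blaschke R p)"
proof -
  have "nonzero_meromorphic (\<lambda>z. of_real R * ((- p) + 1 * z) / (of_real (R\<^sup>2) + (- cnj p) * z))"
    by (intro nonzero_meromorphic_divide nonzero_meromorphic_mult nonzero_meromorphic_linear
        nonzero_meromorphic_const) (use assms in auto)
  thus ?thesis by (simp add: blaschke_def[abs_def])
qed

lemma norm_blaschke_circle:
  assumes "norm z = R" "norm p < R"
  shows "norm (blaschke R p z) = 1"
proof -
  have zz: "z * cnj z = of_real (R\<^sup>2)" using assms by (simp add: complex_norm_square [symmetric] del: of_real_power)
  have "of_real (R\<^sup>2) - cnj p * z = z * cnj (z - p)" using zz by (simp add: algebra_simps)
  hence "blaschke R p z = of_real R * (z - p) / (z * cnj (z - p))" by (simp add: blaschke_def)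
  moreover have "z \<noteq> p" "R > 0" using assms norm_ge_zero[of p] by auto
  ultimately show ?thesis using assms by (auto simp: norm_mult norm_divide simp del: complex_cnj_diff)
qed

lemma norm_blaschke_le_1:
  assumes "norm z \<le> R" "norm p < R"
  shows "norm (blaschke R p z) \<le> 1"
proof -
  have R: "R > 0" using assms norm_ge_zero[of p] by linarith
  have "(norm (of_real (R\<^sup>2) - cnj p * z))\<^sup>2 - (norm (of_real R * (z - p)))\<^sup>2
      = (R\<^sup>2 - (norm p)\<^sup>2) * (R\<^sup>2 - (norm z)\<^sup>2)"
    unfolding cmod_power2 by (simp add: algebra_simps power2_eq_square)
  moreover have "(norm p)\<^sup>2 \<le> R\<^sup>2" "(norm z)\<^sup>2 \<le> R\<^sup>2" using assms R by (auto intro!: power_mono)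
  ultimately have "(norm (of_real R * (z - p)))\<^sup>2 \<le> (norm (of_real (R\<^sup>2) - cnj p * z))\<^sup>2"
    using mult_nonneg_nonneg[of "R\<^sup>2 - (norm p)\<^sup>2" "R\<^sup>2 - (norm z)\<^sup>2"] by linarith
  hence "norm (of_real R * (z - p)) \<le> norm (of_real (R\<^sup>2) - cnj p * z)"
    by (rule power2_le_imp_le) simp
  thus ?thesis unfolding blaschke_def norm_divide
    using denominator_nonzero[OF assms(2,1)] by (subst divide_le_eq_1) auto
qed

lemma blaschke_eq_0_iff:
  assumes "norm z \<le> R" "norm p < R"
  shows "blaschke R p z = 0 \<longleftrightarrow> z = p"
proof -
  have "R > 0" using assms norm_ge_zero[of p] by linarith
  thus ?thesis using denominator_nonzero[OF assms(2,1)] by (auto simp: blaschke_def)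
qed

lemma Blaschke_factorization:
  assumes f: "nonzero_meromorphic f" and R: "regular_on_circle f R"
  defines "Z \<equiv> {p. norm p \<le> R \<and> zorder f p \<noteq> 0}"
  obtains h where "h holomorphic_on cball 0 R"
    "\<And>z. norm z \<le> R \<Longrightarrow> f analytic_on {z} \<Longrightarrow> f z \<noteq> 0
      \<Longrightarrow> f z = exp (h z) * (\<Prod>p\<in>Z. blaschke R p z powi zorder f p)"
proof -
  have R0: "R > 0" using R by (simp add: regular_on_circle_def)
  have finZ: "finite Z" unfolding Z_def by (rule finite_zorder_support[OF f])
  have Zlt: "norm p < R" if "p \<in> Z" for p
  proof (rule ccontr)
    assume "\<not> norm p < R"
    hence "norm p = R" using that by (simp add: Z_def)
    hence "zorder f p = 0" using R by (auto simp: regular_on_circle_def intro: zorder_eq_0_analytic)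
    thus False using that by (simp add: Z_def)
  qed
  define Q where "Q = {p. norm p \<le> 2 * R \<and> zorder f p \<noteq> 0}"
  have finQ: "finite Q" unfolding Q_def by (rule finite_zorder_support[OF f])
  \<comment> \<open>\<open>h\<close> has to be holomorphic on the closed disc, so the factorization
    is carried out on a slightly larger open disc of radius \<open>R'\<close>. The set
    \<open>A\<close> collects the moduli that \<open>R'\<close> must stay below: zeros and poles of
    \<open>f\<close> beyond \<open>R\<close>, and the poles of the Blaschke factors, of modulus
    \<open>R\<^sup>2 / norm p\<close>. The element \<open>2 * R\<close> keeps \<open>R'\<close>
    inside the disc whose divisor is \<open>Q\<close>.\<close>
  define A where "A = insert (2 * R) ({x \<in> norm ` Q. x > R} \<union> (\<lambda>p. R\<^sup>2 / norm p) ` (Z - {0}))"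
  have A: "finite A" "A \<noteq> {}" using finZ finQ by (auto simp: A_def)
  have "R < R\<^sup>2 / norm p" if "p \<in> Z - {0}" for p
  proof -
    have "R * norm p < R * R" using Zlt[of p] that R0 by (intro mult_strict_left_mono) auto
    thus ?thesis using that by (simp add: power2_eq_square pos_less_divide_eq)
  qed
  hence "R < x" if "x \<in> A" for x using that R0 by (auto simp: A_def)
  hence "R < Min A" using A by simp
  then obtain R' where R': "R < R'" "R' < Min A" using dense by blast
  hence R'A: "R' < x" if "x \<in> A" for x using that A by simp
  have den: "of_real (R\<^sup>2) - cnj p * z \<noteq> 0" if "p \<in> Z" "norm z < R'" for p z
  proof (cases "p = 0")
    case False
    have "R' < R\<^sup>2 / norm p" using that False by (intro R'A) (auto simp: A_def)
    hence "norm z < R\<^sup>2 / norm p" using that by linarith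
    hence "norm (cnj p * z) < R\<^sup>2" using False by (simp add: norm_mult field_simps)
    hence "norm (cnj p * z) < norm (of_real (R\<^sup>2) :: complex)" by (simp add: norm_power)
    thus ?thesis by auto
  qed (use R0 in auto)
  have holo: "blaschke R p holomorphic_on ball 0 R'" if "p \<in> Z" for p
    unfolding blaschke_def[abs_def] by (intro holomorphic_intros) (use den that in auto)
  have sub: "{p\<in>ball 0 R'. zorder f p \<noteq> 0} \<subseteq> Z"
  proof
    fix p assume p: "p \<in> {p\<in>ball 0 R'. zorder f p \<noteq> 0}"
    have "R' < 2 * R" by (rule R'A) (auto simp: A_def)
    hence "p \<in> Q" using p by (auto simp: Q_def)
    hence "\<not> R < norm p" using R'A[of "norm p"] p by (auto simp: A_def)
    thus "p \<in> Z" using p by (auto simp: Z_def)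
  qed
  obtain h where h: "h holomorphic_on ball 0 R'"
    "\<And>z. z \<in> ball 0 R' \<Longrightarrow> f analytic_on {z} \<Longrightarrow> (\<And>p. p \<in> Z \<Longrightarrow> blaschke R p analytic_on {z} \<and> blaschke R p z \<noteq> 0)
      \<Longrightarrow> f z = exp (h z) * (\<Prod>p\<in>Z. blaschke R p z powi zorder f p)"
  proof (rule factorization_on_contractible[OF f _ _ finZ sub, of "blaschke R"])
    show "zorder (blaschke R p) p = 1" if "p \<in> Z" for p
    proof (rule zorder_eqI)
      show "(\<lambda>z. of_real R / (of_real (R\<^sup>2) - cnj p * z)) holomorphic_on ball 0 R'"
        by (intro holomorphic_intros) (use den that in auto)
    qed (use den[OF that, of p] Zlt[OF that] R' R0 in \<open>auto simp: blaschke_def\<close>)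
    show "zorder (blaschke R p) q = 0" if "p \<in> Z" "q \<in> ball 0 R'" "q \<noteq> p" for p q
    proof (rule zorder_eq_0_analytic)
      show "blaschke R p analytic_on {q}" 
        using holo[OF that(1)] that(2) by (auto simp: analytic_at intro!: exI[of _ "ball 0 R'"])
      show "blaschke R p q \<noteq> 0" using den[OF that(1), of q] that R0 by (auto simp: blaschke_def)
    qed
  qed (use nonzero_meromorphic_blaschke[OF R0] in \<open>auto intro: convex_imp_contractible\<close>)
  show ?thesis
  proof (rule that)
    show "h holomorphic_on cball 0 R" by (rule holomorphic_on_subset[OF h(1)]) (use R' in auto)
    fix z assume z: "norm z \<le> R" "f analytic_on {z}" "f z \<noteq> 0"
    show "f z = exp (h z) * (\<Prod>p\<in>Z. blaschke R p z powi zorder f p)"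
    proof (rule h(2))
      fix p assume p: "p \<in> Z"
      have "z \<noteq> p" using p zorder_eq_0_analytic[OF z(2,3)] by (auto simp: Z_def)
      moreover have "blaschke R p analytic_on {z}"
        using holo[OF p] z(1) R' by (auto simp: analytic_at intro!: exI[of _ "ball 0 R'"])
      ultimately show "blaschke R p analytic_on {z} \<and> blaschke R p z \<noteq> 0"
        using blaschke_eq_0_iff[OF z(1) Zlt[OF p]] by simp
    qed (use z R' in auto)
  qed
qed

subsection \<open>Jensen's formula and monotonicity of the characteristic\<close>

lemma log_plus_nonneg [simp]: "0 \<le> log_plus x" and ln_le_log_plus: "ln x \<le> log_plus x"
  by (simp_all add: log_plus_def)

text \<open>In this form there is no singularity at \<open>0\<close>, which gives continuity also at
  zeros of the function.\<close>

lemma log_plus_eq_ln_max: "0 \<le> x \<Longrightarrow> log_plus x = ln (max 1 x)"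
  by (cases "x = 0"; cases "x \<le> 1") (auto simp: log_plus_def max_def)

lemma continuous_on_log_plus: "continuous_on {0..} log_plus"
proof -
  have "continuous_on {0..} (\<lambda>x::real. ln (max 1 x))" by (intro continuous_intros) auto
  thus ?thesis by (subst continuous_on_cong[OF refl log_plus_eq_ln_max]) auto
qed

lemma continuous_on_log_plus_norm:
  "continuous_on A f \<Longrightarrow> continuous_on A (\<lambda>z. log_plus (norm (f z)))"
  by (rule continuous_on_compose2[OF continuous_on_log_plus]) (auto intro: continuous_on_norm)

lemma log_plus_leI: "0 \<le> y \<Longrightarrow> ln x \<le> y \<Longrightarrow> log_plus x \<le> y"
  by (simp add: log_plus_def)

lemma log_plus_mono: "0 \<le> x \<Longrightarrow> x \<le> y \<Longrightarrow> log_plus x \<le> log_plus y"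
  by (simp add: log_plus_eq_ln_max)

lemma log_plus_minus: "0 < x \<Longrightarrow> log_plus x - log_plus (1 / x) = ln x"
  by (simp add: log_plus_def ln_div)

lemma log_plus_plus: "0 < x \<Longrightarrow> log_plus x + log_plus (1 / x) = \<bar>ln x\<bar>"
  by (auto simp: log_plus_def ln_div)

section \<open>Proximity functions on regular circles\<close>

lemma regular_on_circleD:
  assumes "regular_on_circle f r"
  shows "0 < r" "continuous_on (sphere 0 r) f" "norm z = r \<Longrightarrow> f z \<noteq> 0"
    "norm z = r \<Longrightarrow> f analytic_on {z}" "norm z = r \<Longrightarrow> zorder f z = 0"
proof -
  show "0 < r" "norm z = r \<Longrightarrow> f z \<noteq> 0" "norm z = r \<Longrightarrow> f analytic_on {z}"
    "norm z = r \<Longrightarrow> zorder f z = 0"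
    using assms by (auto simp: regular_on_circle_def intro: zorder_eq_0_analytic)
  have "f analytic_on sphere 0 r"
    using assms by (subst analytic_on_analytic_at) (auto simp: regular_on_circle_def)
  thus "continuous_on (sphere 0 r) f"
    by (intro holomorphic_on_imp_continuous_on analytic_imp_holomorphic)
qed

lemma continuous_on_ln_norm:
  assumes "regular_on_circle f r"
  shows "continuous_on (sphere 0 r) (\<lambda>z. ln (norm (f z)))"
  using regular_on_circleD[OF assms] by (auto intro!: continuous_intros)

lemma regular_on_circle_inverse:
  assumes "regular_on_circle f r"
  shows "regular_on_circle (\<lambda>z. 1 / f z) r"
  using assms by (auto simp: regular_on_circle_def intro!: analytic_intros)

lemma nev_m_sum_eq:
  assumes "regular_on_circle f r"
  shows "nev_m r f + nev_m r (\<lambda>z. 1 / f z) = cmean r (\<lambda>z. \<bar>ln (norm (f z))\<bar>)"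
proof -
  note r = regular_on_circleD[OF assms] and r' = regular_on_circleD[OF regular_on_circle_inverse[OF assms]]
  have "nev_m r f + nev_m r (\<lambda>z. 1 / f z) = cmean r (\<lambda>z. log_plus (norm (f z)) + log_plus (norm (1 / f z)))"
    unfolding nev_m_eq_cmean
    by (rule cmean_add[symmetric]) (use r r' in \<open>auto intro!: continuous_on_log_plus_norm\<close>)
  also have "\<dots> = cmean r (\<lambda>z. \<bar>ln (norm (f z))\<bar>)"
    by (rule cmean_cong) (use r in \<open>auto simp: norm_divide log_plus_plus\<close>)
  finally show ?thesis .
qed

lemma nev_m_diff_eq:
  assumes "regular_on_circle f r"
  shows "nev_m r f - nev_m r (\<lambda>z. 1 / f z) = cmean r (\<lambda>z. ln (norm (f z)))"
proof -
  note r = regular_on_circleD[OF assms] and r' = regular_on_circleD[OF regular_on_circle_inverse[OF assms]]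
  have "nev_m r f - nev_m r (\<lambda>z. 1 / f z) = cmean r (\<lambda>z. log_plus (norm (f z)) - log_plus (norm (1 / f z)))"
    unfolding nev_m_eq_cmean
    by (rule cmean_diff[symmetric]) (use r r' in \<open>auto intro!: continuous_on_log_plus_norm\<close>)
  also have "\<dots> = cmean r (\<lambda>z. ln (norm (f z)))"
    by (rule cmean_cong) (use r in \<open>auto simp: norm_divide log_plus_minus\<close>)
  finally show ?thesis .
qed

lemma nev_m_nonneg: "0 \<le> r \<Longrightarrow> 0 \<le> nev_m r f"
  unfolding nev_m_eq_cmean by (rule cmean_nonneg) auto

lemma zorder_inverse:
  assumes "nonzero_meromorphic f"
  shows "zorder (\<lambda>z. 1 / f z) p = - zorder f p"
proof -
  have "zorder (\<lambda>z. 1 / f z) p = zorder (\<lambda>_. 1) p - zorder f p"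
    by (intro zorder_divide) (use nonzero_meromorphicD[OF assms] nonzero_meromorphicD[OF nonzero_meromorphic_const[of 1]] in auto)
  thus ?thesis by (simp add: zorder_eq_0_analytic)
qed

lemma pol_inverse: "nonzero_meromorphic f \<Longrightarrow> pol (\<lambda>z. 1 / f z) = zer f"
  by (auto simp: pol_def zer_def zorder_inverse)

lemma support_norm_less:
  assumes "regular_on_circle f R" "norm p \<le> R" "zorder f p \<noteq> 0"
  shows "norm p < R"
  using regular_on_circleD(5)[OF assms(1), of p] assms(2,3) by linarith

lemma ln_powi: "ln (x powi n) = of_int n * ln (x::real)"
  by (cases n rule: int_cases4) (auto simp: ln_realpow power_int_minus ln_inverse)

text \<open>Blaschke factors have modulus one on the circle of radius \<open>R\<close>, so
  \<open>Re h\<close> has the boundary values \<open>ln (norm (f z))\<close>. Inserting the Poisson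
  integral for \<open>Re (h z)\<close> into the third conclusion gives the Poisson-Jensen
  formula.\<close>

lemma log_factorization:
  assumes f: "nonzero_meromorphic f" and R: "regular_on_circle f R"
  defines "Z \<equiv> {p. norm p \<le> R \<and> zorder f p \<noteq> 0}"
  obtains h where "h holomorphic_on cball 0 R"
    "\<And>z. norm z \<le> R \<Longrightarrow> f analytic_on {z} \<Longrightarrow> f z \<noteq> 0
      \<Longrightarrow> f z = exp (h z) * (\<Prod>p\<in>Z. blaschke R p z powi zorder f p)"
    "\<And>z. norm z \<le> R \<Longrightarrow> f analytic_on {z} \<Longrightarrow> f z \<noteq> 0
      \<Longrightarrow> ln (norm (f z)) = Re (h z) + (\<Sum>p\<in>Z. (zer f p - pol f p) * ln (norm (blaschke R p z)))"
    "\<And>z. norm z = R \<Longrightarrow> Re (h z) = ln (norm (f z))"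
proof -
  obtain h where h: "h holomorphic_on cball 0 R"
    "\<And>z. norm z \<le> R \<Longrightarrow> f analytic_on {z} \<Longrightarrow> f z \<noteq> 0
      \<Longrightarrow> f z = exp (h z) * (\<Prod>p\<in>Z. blaschke R p z powi zorder f p)"
    using Blaschke_factorization[OF f R] unfolding Z_def by blast
  have finZ: "finite Z" unfolding Z_def by (rule finite_zorder_support[OF f])
  have Zlt: "norm p < R" if "p \<in> Z" for p
    using support_norm_less[OF R, of p] that by (simp add: Z_def)
  have ln: "ln (norm (f z)) = Re (h z) + (\<Sum>p\<in>Z. (zer f p - pol f p) * ln (norm (blaschke R p z)))"
    if z: "norm z \<le> R" "f analytic_on {z}" "f z \<noteq> 0" for z
  proof -
    have nz: "blaschke R p z \<noteq> 0" if "p \<in> Z" for p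
      using blaschke_eq_0_iff[OF z(1) Zlt[OF that]] zorder_eq_0_analytic[OF z(2,3)] that by (auto simp: Z_def)
    have "norm (f z) = exp (Re (h z)) * (\<Prod>p\<in>Z. norm (blaschke R p z) powi zorder f p)"
      by (subst h(2)[OF z]) (simp add: norm_mult norm_power_int flip: prod_norm)
    also have "ln \<dots> = Re (h z) + (\<Sum>p\<in>Z. ln (norm (blaschke R p z) powi zorder f p))"
      using nz finZ by (subst ln_mult) (auto simp: ln_prod)
    finally show ?thesis by (simp add: ln_powi zorder_eq_zer_pol)
  qed
  moreover have "Re (h z) = ln (norm (f z))" if z: "norm z = R" for z
    using ln[of z] regular_on_circleD(3,4)[OF R z] z Zlt by (simp add: norm_blaschke_circle)
  ultimately show ?thesis using that h by blast
qed

text \<open>The left side is the mean of \<open>Re h\<close>, hence \<open>Re (h 0)\<close>. Since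
  \<open>f\<close> may have a zero or a pole at the origin, \<open>Re (h 0)\<close> is computed as a
  limit; \<open>zor_poly f 0 0\<close> is the leading Laurent coefficient there.\<close>

lemma Jensen_formula:
  assumes f: "nonzero_meromorphic f" and R: "regular_on_circle f R"
  shows "cmean R (\<lambda>z. ln (norm (f z))) = ln (norm (zor_poly f 0 0)) + counting (zer f) R - counting (pol f) R"
proof -
  define Z where "Z = {p. norm p \<le> R \<and> zorder f p \<noteq> 0}"
  have finZ: "finite Z" unfolding Z_def by (rule finite_zorder_support[OF f])
  have Zlt: "norm p < R" if "p \<in> Z" for p
    using support_norm_less[OF R, of p] that by (simp add: Z_def)
  note R0 = regular_on_circleD(1)[OF R]
  obtain h where h: "h holomorphic_on cball 0 R"
    "\<And>z. norm z \<le> R \<Longrightarrow> f analytic_on {z} \<Longrightarrow> f z \<noteq> 0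
      \<Longrightarrow> f z = exp (h z) * (\<Prod>p\<in>Z. blaschke R p z powi zorder f p)"
    "\<And>z. norm z \<le> R \<Longrightarrow> f analytic_on {z} \<Longrightarrow> f z \<noteq> 0
      \<Longrightarrow> ln (norm (f z)) = Re (h z) + (\<Sum>p\<in>Z. (zer f p - pol f p) * ln (norm (blaschke R p z)))"
    "\<And>z. norm z = R \<Longrightarrow> Re (h z) = ln (norm (f z))"
    using log_factorization[OF f R, folded Z_def] by blast
  define n where "n = zorder f 0"
  define ord where "ord = (\<lambda>p. zer f p - pol f p)"
  define c where "c = zor_poly f 0 0"
  have ord0: "ord 0 = of_int n" by (simp add: ord_def n_def zorder_eq_zer_pol)
  have c0: "c \<noteq> 0"
    using zorder_exist[OF nonzero_meromorphicD(4,5,3)[OF f], of 0] by (simp add: c_def)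
  obtain r where r: "r > 0" "zor_poly f 0 holomorphic_on cball 0 r"
      "\<And>w. w \<in> cball 0 r - {0} \<Longrightarrow> f w = zor_poly f 0 w * (w - 0) powi n \<and> zor_poly f 0 w \<noteq> 0"
    using zorder_exist[OF nonzero_meromorphicD(4,5,3)[OF f], of 0] unfolding n_def by blast
  have "zor_poly f 0 \<midarrow>0\<rightarrow> c"
    using r(1,2) unfolding c_def
    by (metis analytic_at_ball analytic_at_imp_isCont ball_subset_cball holomorphic_on_subset isContD)
  hence lim1: "((\<lambda>w. ln (norm (zor_poly f 0 w))) \<longlongrightarrow> ln (norm c)) (at 0)"
    by (intro tendsto_intros) (use c0 in auto)
  have lim2: "((\<lambda>w. \<Sum>p\<in>Z-{0}. ord p * ln (norm (blaschke R p w))) \<longlongrightarrow>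
      (\<Sum>p\<in>Z-{0}. ord p * ln (norm (blaschke R p 0)))) (at 0)"
  proof (intro tendsto_intros)
    fix p assume p: "p \<in> Z - {0}"
    show "blaschke R p \<midarrow>0\<rightarrow> blaschke R p 0"
      unfolding blaschke_def by (intro tendsto_intros) (use R0 in auto)
    show "norm (blaschke R p 0) \<noteq> 0" using blaschke_eq_0_iff[of 0 R p] Zlt[of p] p R0 by auto
  qed
  have lim3: "((\<lambda>w. Re (h w)) \<longlongrightarrow> Re (h 0)) (at 0)"
  proof (intro tendsto_intros)
    have "h analytic_on {0}" using h(1) R0
      by (auto simp: analytic_at intro!: exI[of _ "ball 0 R"] intro: holomorphic_on_subset)
    thus "h \<midarrow>0\<rightarrow> h 0" using analytic_at_imp_isCont isContD by blast
  qed
  have "eventually (\<lambda>w. f analytic_on {w} \<and> f w \<noteq> 0) (at 0)"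
    using eventually_cosparse_imp_eventually_at[OF regular_cosparse[OF f], of 0 UNIV] by simp
  moreover have "eventually (\<lambda>w. w \<in> ball 0 (min r R) - {0}) (at (0::complex))"
    using r(1) R0 by (intro eventually_at_in_open) auto
  ultimately have "eventually (\<lambda>w. ln (norm (zor_poly f 0 w)) + of_int n * ln R
     - (\<Sum>p\<in>Z-{0}. ord p * ln (norm (blaschke R p w))) = Re (h w)) (at 0)"
  proof eventually_elim
    case (elim w)
    hence w: "w \<noteq> 0" "norm w < r" "norm w < R" by auto
    have fw: "f w = zor_poly f 0 w * w powi n" "zor_poly f 0 w \<noteq> 0" using r(3)[of w] w by auto
    have "ln (norm (f w)) = ln (norm (zor_poly f 0 w)) + of_int n * ln (norm w)"
      unfolding fw(1) norm_mult norm_power_int by (subst ln_mult) (use fw w in \<open>auto simp: ln_powi\<close>)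
    moreover have "ln (norm (f w)) = Re (h w) + (\<Sum>p\<in>Z. ord p * ln (norm (blaschke R p w)))"
      unfolding ord_def by (rule h(3)) (use elim w in auto)
    \<comment> \<open>The factor at the origin has modulus \<open>norm w / R\<close>. Its
      \<open>ln (norm w)\<close> cancels the one that comes from the Laurent expansion of
      \<open>f\<close>, and only \<open>of_int n * ln R\<close> survives in the limit.\<close>
    moreover have "(\<Sum>p\<in>Z. ord p * ln (norm (blaschke R p w)))
        = of_int n * (ln (norm w) - ln R) + (\<Sum>p\<in>Z-{0}. ord p * ln (norm (blaschke R p w)))"
    proof (cases "0 \<in> Z")
      case True
      have "norm (blaschke R 0 w) = norm w / R"
        using R0 by (simp add: blaschke_def norm_divide norm_mult norm_power power2_eq_square)
      hence "ln (norm (blaschke R 0 w)) = ln (norm w) - ln R" using w R0 by (simp add: ln_div)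
      thus ?thesis using True finZ by (simp add: sum.remove[of Z 0] ord0)
    next
      case False
      hence "n = 0" using R0 by (simp add: Z_def n_def)
      thus ?thesis using False by simp
    qed
    ultimately show ?case by (simp add: algebra_simps)
  qed
  moreover have "((\<lambda>w. ln (norm (zor_poly f 0 w)) + of_int n * ln R
     - (\<Sum>p\<in>Z-{0}. ord p * ln (norm (blaschke R p w)))) \<longlongrightarrow>
     ln (norm c) + of_int n * ln R - (\<Sum>p\<in>Z-{0}. ord p * ln (norm (blaschke R p 0)))) (at 0)"
    by (intro tendsto_intros lim1 lim2)
  ultimately have "((\<lambda>w. Re (h w)) \<longlongrightarrow>
     ln (norm c) + of_int n * ln R - (\<Sum>p\<in>Z-{0}. ord p * ln (norm (blaschke R p 0)))) (at 0)"
    by (rule Lim_transform_eventually[rotated])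
  hence "Re (h 0) = ln (norm c) + of_int n * ln R - (\<Sum>p\<in>Z-{0}. ord p * ln (norm (blaschke R p 0)))"
    using lim3 tendsto_unique by (metis at_neq_bot)
  also have "(\<Sum>p\<in>Z-{0}. ord p * ln (norm (blaschke R p 0))) = (\<Sum>p\<in>Z-{0}. - (ord p * (ln R - ln (norm p))))"
  proof (rule sum.cong)
    fix p assume p: "p \<in> Z - {0}"
    have "norm (blaschke R p 0) = norm p / R"
      using R0 by (simp add: blaschke_def norm_divide norm_mult norm_power power2_eq_square)
    thus "ord p * ln (norm (blaschke R p 0)) = - (ord p * (ln R - ln (norm p)))"
      using p R0 by (simp add: ln_div algebra_simps)
  qed auto
  also have "ln (norm c) + of_int n * ln R - \<dots> = ln (norm c) + (\<Sum>p\<in>Z. ord p * (ln R - ln (norm p)))"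
  proof (cases "0 \<in> Z")
    case True
    thus ?thesis using finZ by (simp add: sum.remove[of Z 0] ord0 sum_negf)
  next
    case False
    hence "n = 0" using R0 by (simp add: Z_def n_def)
    thus ?thesis using False by (simp add: sum_negf)
  qed
  also have "(\<Sum>p\<in>Z. ord p * (ln R - ln (norm p)))
      = (\<Sum>p\<in>Z. zer f p * (ln R - ln (norm p))) - (\<Sum>p\<in>Z. pol f p * (ln R - ln (norm p)))"
    by (simp add: ord_def left_diff_distrib sum_subtractf)
  also have "(\<Sum>p\<in>Z. zer f p * (ln R - ln (norm p))) = counting (zer f) R"
    by (rule counting_eq_sum[symmetric]) (use finZ in \<open>auto simp: Z_def zer_def\<close>)
  also have "(\<Sum>p\<in>Z. pol f p * (ln R - ln (norm p))) = counting (pol f) R"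
    by (rule counting_eq_sum[symmetric]) (use finZ in \<open>auto simp: Z_def pol_def\<close>)
  finally have "Re (h 0) = ln (norm c) + counting (zer f) R - counting (pol f) R" by simp
  moreover have "cmean R (\<lambda>z. ln (norm (f z))) = cmean R (\<lambda>z. Re (h z))"
    by (rule cmean_cong) (use h(4) R0 in auto)
  moreover have "\<dots> = Re (h 0)" by (rule mean_value_Re[OF h(1) R0])
  ultimately show ?thesis by (simp add: c_def)
qed

text \<open>Jensen's formula rearranged. The error is an exact constant, the same for all radii, and
  therefore negligible against \<open>T\<close>.\<close>

lemma nev_T_inverse:
  assumes f: "nonzero_meromorphic f" and R: "regular_on_circle f R"
  shows "nev_T R (\<lambda>z. 1 / f z) = nev_T R f - ln (norm (zor_poly f 0 0))"
  using Jensen_formula[OF assms] nev_m_diff_eq[OF R] regular_on_circleD(1)[OF R]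
  by (simp add: nev_T_def nev_N_eq_counting f nonzero_meromorphic_inverse pol_inverse)

lemma nev_N_nonneg: "nonzero_meromorphic f \<Longrightarrow> 1 \<le> r \<Longrightarrow> 0 \<le> nev_N r f"
  by (simp add: nev_N_eq_counting counting_nonneg)

lemma nev_N_mono: "nonzero_meromorphic f \<Longrightarrow> 1 \<le> r \<Longrightarrow> r \<le> s \<Longrightarrow> nev_N r f \<le> nev_N s f"
  by (simp add: nev_N_eq_counting counting_mono finite_pol)

section \<open>Circle means of Blaschke factors\<close>

lemma ln_blaschke:
  assumes "norm z \<le> R" "norm p < R" "z \<noteq> p"
  shows "ln (norm (blaschke R p z)) = ln R + ln (norm (z - p)) - ln (norm (of_real (R\<^sup>2) - cnj p * z))"
    and "ln (norm (blaschke R p z)) \<le> 0"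
proof -
  have R: "R > 0" using assms(2) norm_ge_zero[of p] by linarith
  have "norm (blaschke R p z) > 0" using blaschke_eq_0_iff[OF assms(1,2)] assms(3) by simp
  thus "ln (norm (blaschke R p z)) \<le> 0" using norm_blaschke_le_1[OF assms(1,2)] by simp
  show "ln (norm (blaschke R p z)) = ln R + ln (norm (z - p)) - ln (norm (of_real (R\<^sup>2) - cnj p * z))"
    using denominator_nonzero[OF assms(2,1)] assms(3) R
    by (simp add: blaschke_def norm_divide norm_mult ln_div ln_mult del: of_real_power)
qed

lemma continuous_on_ln_blaschke:
  assumes "norm p < R" "r \<le> R" "norm p \<noteq> r"
  shows "continuous_on (sphere 0 r) (\<lambda>z. ln (norm (blaschke R p z)))"
proof -
  have "blaschke R p z \<noteq> 0" if "norm z = r" for z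
    using blaschke_eq_0_iff[of z R p] that assms by auto
  thus ?thesis unfolding blaschke_def[abs_def]
    using denominator_nonzero[OF assms(1)] assms(2) by (auto intro!: continuous_intros)
qed

lemma ln_denominator_mean:
  assumes p: "norm p < R" and r: "0 < r" "r + norm c < R"
  shows "cmean r (\<lambda>z. ln (norm (of_real (R\<^sup>2) - cnj p * (z + c)))) = ln (norm (of_real (R\<^sup>2) - cnj p * c))"
proof -
  have "cmean r (\<lambda>z. ln (norm (of_real (R\<^sup>2) - cnj p * (z + c)))) = ln (norm (of_real (R\<^sup>2) - cnj p * (0 + c)))"
  proof (rule log_norm_mean[where R="R - norm c"])
    fix z :: complex assume "norm z < R - norm c"
    hence "norm (z + c) \<le> R" using norm_triangle_ineq[of z c] by linarith
    thus "of_real (R\<^sup>2) - cnj p * (z + c) \<noteq> 0" by (rule denominator_nonzero[OF p])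
  qed (use r in \<open>auto intro!: holomorphic_intros\<close>)
  thus ?thesis by simp
qed

text \<open>The numerator is a linear factor with zero \<open>p - c\<close>. The denominator has no
  zero as long as \<open>norm z < R - norm c\<close>, so its logarithmic mean is its value at the
  centre. The shifted version serves the estimate of \<open>f (z + c) / f z\<close>.\<close>

lemma cmean_ln_blaschke_shift:
  assumes p: "norm p < R" and r: "0 < r" "r + norm c < R" and "norm (p - c) \<noteq> r"
  shows "cmean r (\<lambda>z. ln (norm (blaschke R p (z + c))))
    = ln R + ln (max r (norm (p - c))) - ln (norm (of_real (R\<^sup>2) - cnj p * c))"
    and "continuous_on (sphere 0 r) (\<lambda>z. ln (norm (blaschke R p (z + c))))"
proof -
  have zc: "norm (z + c) \<le> R" if "norm z = r" for z
    using norm_triangle_ineq[of z c] r that by linarith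
  have ne: "z \<noteq> p - c" if "norm z = r" for z using that assms(4) by auto
  have den: "of_real (R\<^sup>2) - cnj p * (z + c) \<noteq> 0" if "norm z = r" for z
    using denominator_nonzero[OF p zc[OF that]] .
  have c1: "continuous_on (sphere 0 r) (\<lambda>z. ln (norm (z - (p - c))))"
    using ne by (auto intro!: continuous_intros)
  have c2: "continuous_on (sphere 0 r) (\<lambda>z. ln (norm (of_real (R\<^sup>2) - cnj p * (z + c))))"
  proof (intro continuous_intros ballI)
    fix z :: complex assume "z \<in> sphere 0 r"
    thus "norm (of_real (R\<^sup>2) - cnj p * (z + c)) \<noteq> 0" using den[of z] by simp
  qed
  have eq: "ln (norm (blaschke R p (z + c))) = (ln R + ln (norm (z - (p - c)))) - ln (norm (of_real (R\<^sup>2) - cnj p * (z + c)))"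
    if "norm z = r" for z
    using ln_blaschke(1)[OF zc[OF that] p] ne[OF that] by (simp add: algebra_simps)
  show "continuous_on (sphere 0 r) (\<lambda>z. ln (norm (blaschke R p (z + c))))"
    by (subst continuous_on_cong[OF refl eq])
       (auto intro!: continuous_on_diff continuous_on_add continuous_on_const c1 c2 simp del: of_real_power)
  have "cmean r (\<lambda>z. ln (norm (blaschke R p (z + c))))
     = cmean r (\<lambda>z. (ln R + ln (norm (z - (p - c)))) - ln (norm (of_real (R\<^sup>2) - cnj p * (z + c))))"
    by (rule cmean_cong) (use eq r in auto)
  also have "\<dots> = ln R + ln (max r (norm (p - c))) - ln (norm (of_real (R\<^sup>2) - cnj p * c))"
  proof -
    have c3: "continuous_on (sphere 0 r) (\<lambda>z. ln R + ln (norm (z - (p - c))))"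
      by (intro continuous_on_add continuous_on_const c1)
    show ?thesis
      using cmean_diff[OF c3 c2] cmean_add[OF continuous_on_const c1, of "ln R"]
        cmean_log_linear[of r "p - c"] ln_denominator_mean[OF p r] r assms(4)
      by simp
  qed
  finally show "cmean r (\<lambda>z. ln (norm (blaschke R p (z + c)))) = \<dots>" .
qed

lemma cmean_ln_blaschke:
  assumes p: "norm p < R" and r: "0 < r" "r < R" and "norm p \<noteq> r"
  shows "cmean r (\<lambda>z. - ln (norm (blaschke R p z))) = ln R - ln (max r (norm p))"
proof -
  have "R > 0" using r by simp
  hence "ln (norm (of_real (R\<^sup>2) :: complex)) = 2 * ln R" by (simp add: norm_power ln_realpow)
  thus ?thesis
    using cmean_ln_blaschke_shift(1)[of p R r 0] assms by (simp add: cmean_uminus)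
qed

text \<open>Each point contributes \<open>ln R - ln (max r (norm p))\<close>, which is its weight in
  \<open>counting D R\<close> minus its weight in \<open>counting D r\<close>.\<close>

lemma cmean_sum_ln_blaschke:
  assumes fin: "finite Z" and Z: "\<And>p. p \<in> Z \<Longrightarrow> norm p < R \<and> norm p \<noteq> r" and r: "1 \<le> r" "r < R"
    and D: "\<And>p. 0 \<le> D p" "{p. norm p \<le> R \<and> D p \<noteq> 0} \<subseteq> Z"
  shows "cmean r (\<lambda>z. \<Sum>p\<in>Z. D p * - ln (norm (blaschke R p z))) = counting D R - counting D r"
    and "cmean r (\<lambda>z. \<Sum>p\<in>Z. D p * - ln (norm (blaschke R p z))) \<le> counting D R"
    and "continuous_on (sphere 0 r) (\<lambda>z. \<Sum>p\<in>Z. D p * - ln (norm (blaschke R p z)))"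
proof -
  have c: "continuous_on (sphere 0 r) (\<lambda>z. D p * - ln (norm (blaschke R p z)))" if "p \<in> Z" for p
    using Z[OF that] r by (intro continuous_intros continuous_on_ln_blaschke) auto
  show "continuous_on (sphere 0 r) (\<lambda>z. \<Sum>p\<in>Z. D p * - ln (norm (blaschke R p z)))"
    by (intro continuous_on_sum c)
  have "cmean r (\<lambda>z. \<Sum>p\<in>Z. D p * - ln (norm (blaschke R p z)))
      = (\<Sum>p\<in>Z. D p * cmean r (\<lambda>z. - ln (norm (blaschke R p z))))"
    by (subst cmean_sum[OF fin c]) (use r in \<open>auto simp: cmean_cmult[symmetric]\<close>)
  also have "\<dots> = (\<Sum>p\<in>Z. D p * (ln R - ln (max r (norm p))))"
    by (intro sum.cong refl, subst cmean_ln_blaschke) (use Z r in auto)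
  also have "\<dots> = (\<Sum>p\<in>Z. D p * (ln R - ln (norm p)) - (if norm p \<le> r then D p * (ln r - ln (norm p)) else 0))"
    by (intro sum.cong refl) (auto simp: max_def algebra_simps)
  also have "\<dots> = (\<Sum>p\<in>Z. D p * (ln R - ln (norm p))) - (\<Sum>p\<in>{p\<in>Z. norm p \<le> r}. D p * (ln r - ln (norm p)))"
    using fin by (simp add: sum_subtractf sum.inter_filter)
  also have "(\<Sum>p\<in>Z. D p * (ln R - ln (norm p))) = counting D R"
    by (rule counting_eq_sum[symmetric]) (use fin Z D in \<open>auto simp: less_imp_le\<close>)
  also have "(\<Sum>p\<in>{p\<in>Z. norm p \<le> r}. D p * (ln r - ln (norm p))) = counting D r"
    by (rule counting_eq_sum[symmetric]) (use fin r D(2) in auto)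
  finally show *: "cmean r (\<lambda>z. \<Sum>p\<in>Z. D p * - ln (norm (blaschke R p z))) = counting D R - counting D r" .
  show "cmean r (\<lambda>z. \<Sum>p\<in>Z. D p * - ln (norm (blaschke R p z))) \<le> counting D R"
    using * counting_nonneg[OF r(1) D(1)] by simp
qed

text \<open>On the inner circle \<open>log_plus (norm (f z))\<close> is at most the Poisson integral
  of \<open>log_plus (norm (f w))\<close> plus the Blaschke terms of the poles; those of the zeros
  have the favourable sign. The means of the two parts are \<open>nev_m R f\<close> and the
  increment of the counting function of the poles.\<close>

lemma nev_T_mono:
  assumes f: "nonzero_meromorphic f" and r: "regular_on_circle f r" and R: "regular_on_circle f R"
    and le: "1 \<le> r" "r \<le> R"
  shows "nev_T r f \<le> nev_T R f"
proof (cases "r = R")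
  case False
  hence rR: "r < R" using le by simp
  define Z where "Z = {p. norm p \<le> R \<and> zorder f p \<noteq> 0}"
  have finZ: "finite Z" unfolding Z_def by (rule finite_zorder_support[OF f])
  have Z: "norm p < R \<and> norm p \<noteq> r" if "p \<in> Z" for p
    using support_norm_less[OF R, of p] regular_on_circleD(5)[OF r, of p] that by (auto simp: Z_def)
  obtain h where h: "h holomorphic_on cball 0 R"
    "\<And>z. norm z \<le> R \<Longrightarrow> f analytic_on {z} \<Longrightarrow> f z \<noteq> 0
      \<Longrightarrow> f z = exp (h z) * (\<Prod>p\<in>Z. blaschke R p z powi zorder f p)"
    "\<And>z. norm z \<le> R \<Longrightarrow> f analytic_on {z} \<Longrightarrow> f z \<noteq> 0
      \<Longrightarrow> ln (norm (f z)) = Re (h z) + (\<Sum>p\<in>Z. (zer f p - pol f p) * ln (norm (blaschke R p z)))"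
    "\<And>z. norm z = R \<Longrightarrow> Re (h z) = ln (norm (f z))"
    using log_factorization[OF f R, folded Z_def] by blast
  note Rc = regular_on_circleD[OF R] and rc = regular_on_circleD[OF r]
  have ch: "continuous_on (sphere 0 R) h"
    by (rule continuous_on_subset[OF holomorphic_on_imp_continuous_on[OF h(1)]]) auto
  define v where "v = (\<lambda>w. log_plus (norm (f w)))"
  have cv: "continuous_on (sphere 0 R) v" unfolding v_def by (intro continuous_on_log_plus_norm Rc)
  define P where "P = (\<lambda>z. cmean R (\<lambda>w. v w * PK z w))"
  define G where "G = (\<lambda>z. \<Sum>p\<in>Z. pol f p * - ln (norm (blaschke R p z)))"
  have cG: "cmean r G = counting (pol f) R - counting (pol f) r" "continuous_on (sphere 0 r) G"
    unfolding G_def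
    by (rule cmean_sum_ln_blaschke[OF finZ Z]; use le rR in \<open>auto simp: Z_def pol_def\<close>)+
  have P: "cmean r P = cmean R v" "continuous_on (sphere 0 r) P"
    unfolding P_def using cmean_Poisson_integral[OF cv rc(1) rR] by auto
  have "log_plus (norm (f z)) \<le> P z + G z" if z: "norm z = r" for z
  proof (rule log_plus_leI)
    have zR: "norm z \<le> R" "norm z < R" using z rR by auto
    have nz: "z \<noteq> p" if "p \<in> Z" for p using Z[OF that] z by auto
    have ln0: "ln (norm (blaschke R p z)) \<le> 0" if "p \<in> Z" for p
      using ln_blaschke(2)[OF zR(1)] Z[OF that] nz[OF that] by auto
    have "0 \<le> P z" unfolding P_def
      by (rule cmean_nonneg) (use Rc zR in \<open>auto intro!: PK_nonneg mult_nonneg_nonneg simp: v_def\<close>)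
    moreover have "0 \<le> G z" unfolding G_def
      by (intro sum_nonneg mult_nonneg_nonneg) (use ln0 in auto)
    ultimately show "0 \<le> P z + G z" by simp
    have "ln (norm (f z)) = Re (h z) + (\<Sum>p\<in>Z. (zer f p - pol f p) * ln (norm (blaschke R p z)))"
      using h(3)[OF zR(1)] rc(3,4)[OF z] by blast
    also have "Re (h z) = cmean R (\<lambda>w. Re (h w) * PK z w)" using Poisson_mean[OF h(1) zR(2)] by simp
    also have "\<dots> \<le> P z" unfolding P_def
    proof (rule cmean_mono)
      fix w :: complex assume w: "norm w = R"
      show "Re (h w) * PK z w \<le> v w * PK z w" unfolding h(4)[OF w] v_def
        by (intro mult_right_mono ln_le_log_plus PK_nonneg) (use w zR in auto)
    qed (use Rc ch cv zR in \<open>auto intro!: continuous_intros continuous_on_PK\<close>)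
    also have "(\<Sum>p\<in>Z. (zer f p - pol f p) * ln (norm (blaschke R p z))) \<le> G z"
      unfolding G_def
    proof (rule sum_mono)
      fix p assume p: "p \<in> Z"
      show "(zer f p - pol f p) * ln (norm (blaschke R p z)) \<le> pol f p * - ln (norm (blaschke R p z))"
        using mult_nonneg_nonpos[OF zer_nonneg[of f p] ln0[OF p]] by (simp add: algebra_simps)
    qed
    finally show "ln (norm (f z)) \<le> P z + G z" by simp
  qed
  hence "nev_m r f \<le> cmean r (\<lambda>z. P z + G z)" unfolding nev_m_eq_cmean
    by (intro cmean_mono) (use rc P cG in \<open>auto intro!: continuous_on_log_plus_norm continuous_intros\<close>)
  also have "\<dots> = nev_m R f + counting (pol f) R - counting (pol f) r"
    by (subst cmean_add) (use rc P cG in \<open>auto simp: v_def nev_m_eq_cmean\<close>)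
  finally show ?thesis using rc(1) Rc(1) by (simp add: nev_T_def nev_N_eq_counting[OF f])
qed auto

subsection \<open>Shift quotients and logarithmic derivatives\<close>

lemma PK_le:
  assumes "norm z < norm w"
  shows "PK z w \<le> (norm w + norm z) / (norm w - norm z)"
proof -
  have d: "norm w - norm z \<le> norm (w - z)" by (rule norm_triangle_ineq2)
  hence "(norm w - norm z)\<^sup>2 \<le> (norm (w - z))\<^sup>2" using assms by (intro power_mono) auto
  hence "PK z w \<le> ((norm w)\<^sup>2 - (norm z)\<^sup>2) / (norm w - norm z)\<^sup>2"
    unfolding PK_def using assms by (intro divide_left_mono) (auto intro!: power_mono mult_pos_pos)
  also have "\<dots> = (norm w + norm z) / (norm w - norm z)"
    using assms by (simp add: power2_eq_square square_diff_square_factored)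
  finally show ?thesis .
qed

text \<open>Subtract the Schwarz formulas at \<open>z'\<close> and \<open>z\<close>: the term
  \<open>cnj (h 0)\<close> cancels, and the kernels differ by
  \<open>w * (z' - z) / ((w - z') * (w - z))\<close>. The hypothesis on \<open>z'\<close> yields
  \<open>norm (w - z') \<ge> norm (w - z) / 2\<close>. The Poisson kernel is kept instead of being
  estimated by (R + |z|) / (R - |z|). Averaging over \<open>z\<close> later replaces it by 1,
  whereas that factor would grow with the radius and destroy the shift estimate.\<close>

lemma holomorphic_increment_bound:
  assumes h: "h holomorphic_on cball 0 R" and z: "norm z < R" and z': "2 * norm (z' - z) \<le> R - norm z"
  shows "norm (h z' - h z) \<le> 4 * norm (z' - z) / (R - norm z) * cmean R (\<lambda>w. \<bar>Re (h w)\<bar> * PK z w)"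
proof -
  define d where "d = norm (z' - z)"
  have R: "R > 0" using z norm_ge_zero[of z] by linarith
  have z'R: "norm z' < R" using norm_triangle_ineq[of z "z' - z"] z' z by simp
  have ch: "continuous_on (sphere 0 R) (\<lambda>w. complex_of_real (Re (h w)))"
    by (intro continuous_intros, rule continuous_on_subset[OF holomorphic_on_imp_continuous_on[OF h]]) auto
  hence chr: "continuous_on (sphere 0 R) (\<lambda>w. Re (h w))"
    using continuous_on_Re[OF ch] by simp
  have c: "continuous_on (sphere 0 R) (\<lambda>w. 2 * of_real (Re (h w)) * (w / (w - x)))" if "norm x < R" for x
    using that by (intro continuous_intros ch) auto
  define E where "E = (\<lambda>w. 2 * of_real (Re (h w)) * (w / (w - z')) - 2 * of_real (Re (h w)) * (w / (w - z)))"
  have cE: "continuous_on (sphere 0 R) E"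
    unfolding E_def by (intro continuous_on_diff c z z'R)
  have "cmean R E = (h z' + cnj (h 0)) - (h z + cnj (h 0))"
    unfolding Schwarz_mean[OF h z, symmetric] Schwarz_mean[OF h z'R, symmetric] E_def
    using R by (intro cmean_diff c z z'R) simp
  hence "norm (h z' - h z) = norm (cmean R E)" by simp
  also have "\<dots> \<le> cmean R (\<lambda>w. norm (E w))"
    using R by (intro cmean_norm_le cE) simp
  also have "\<dots> \<le> cmean R (\<lambda>w. 4 * d / (R - norm z) * (\<bar>Re (h w)\<bar> * PK z w))"
  proof (rule cmean_mono)
    fix w :: complex assume w: "norm w = R"
    have wz: "R - norm z \<le> norm (w - z)" using norm_triangle_ineq2[of w z] w by simp
    have "norm (w - z) \<le> norm (w - z') + d"
      using norm_triangle_ineq[of "w - z'" "z' - z"] by (simp add: d_def)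
    hence wz': "norm (w - z) / 2 \<le> norm (w - z')" using z' wz by (simp add: d_def)
    have pos: "0 < norm (w - z)" "0 < norm (w - z')" "w \<noteq> z" "w \<noteq> z'" using wz wz' z z'R w by auto
    have "w / (w - z') - w / (w - z) = w * (z' - z) / ((w - z') * (w - z))"
      using pos by (simp add: diff_frac_eq right_diff_distrib)
    hence "E w = of_real (2 * Re (h w)) * (w * (z' - z) / ((w - z') * (w - z)))"
      by (simp only: E_def right_diff_distrib[symmetric] of_real_mult of_real_numeral)
    hence "norm (E w) = 2 * \<bar>Re (h w)\<bar> * R * d / (norm (w - z') * norm (w - z))"
      using w by (simp add: norm_mult norm_divide d_def abs_mult)
    also have "\<dots> \<le> 2 * \<bar>Re (h w)\<bar> * R * d / (norm (w - z) / 2 * norm (w - z))"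
      using pos wz' R by (intro divide_left_mono mult_right_mono mult_pos_pos) (auto simp: d_def)
    also have "\<dots> = 4 * d * R * \<bar>Re (h w)\<bar> / (norm (w - z))\<^sup>2"
      by (simp add: power2_eq_square mult_ac)
    \<comment> \<open>Enlarging \<open>R\<close> to \<open>R + norm z\<close> produces the numerator
      \<open>R\<^sup>2 - (norm z)\<^sup>2\<close> of the Poisson kernel, at the cost of the divisor
      \<open>R - norm z\<close>.\<close>
    also have "\<dots> \<le> 4 * d * (R + norm z) * \<bar>Re (h w)\<bar> / (norm (w - z))\<^sup>2"
      by (intro divide_right_mono mult_right_mono mult_left_mono) (auto simp: d_def)
    also have "\<dots> = 4 * d / (R - norm z) * (\<bar>Re (h w)\<bar> * PK z w)"
    proof -
      have "R\<^sup>2 - (norm z)\<^sup>2 = (R + norm z) * (R - norm z)"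
        by (simp add: power2_eq_square square_diff_square_factored)
      thus ?thesis unfolding PK_def w using z by simp
    qed
    finally show "norm (E w)
      \<le> 4 * d / (R - norm z) * (\<bar>Re (h w)\<bar> * PK z w)" .
  next
    show "continuous_on (sphere 0 R) (\<lambda>w. norm (E w))" by (intro continuous_on_norm cE)
    show "continuous_on (sphere 0 R) (\<lambda>w. 4 * d / (R - norm z) * (\<bar>Re (h w)\<bar> * PK z w))"
      by (intro continuous_on_mult continuous_on_const continuous_on_rabs chr continuous_on_PK z)
  qed (use R in auto)
  also have "\<dots> = 4 * d / (R - norm z) * cmean R (\<lambda>w. \<bar>Re (h w)\<bar> * PK z w)" by (rule cmean_cmult)
  finally show ?thesis by (simp add: d_def)
qed

text \<open>Divide the increment bound by \<open>norm (z' - z)\<close> and let \<open>z'\<close>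
  tend to \<open>z\<close>.\<close>

lemma holomorphic_deriv_bound:
  assumes h: "h holomorphic_on cball 0 R" and z: "norm z < R"
  shows "norm (deriv h z) \<le> 4 / (R - norm z) * cmean R (\<lambda>w. \<bar>Re (h w)\<bar> * PK z w)"
proof -
  have "(h has_field_derivative deriv h z) (at z)"
    by (rule holomorphic_derivI[where S="ball 0 R"]) (use z in \<open>auto intro!: holomorphic_on_subset[OF h]\<close>)
  hence "((\<lambda>z'. norm ((h z' - h z) / (z' - z))) \<longlongrightarrow> norm (deriv h z)) (at z)"
    unfolding has_field_derivative_iff by (intro tendsto_norm)
  moreover have "eventually (\<lambda>z'. norm ((h z' - h z) / (z' - z)) \<le> 4 / (R - norm z) * cmean R (\<lambda>w. \<bar>Re (h w)\<bar> * PK z w)) (at z)"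
  proof -
    have "eventually (\<lambda>z'. z' \<in> ball z ((R - norm z) / 2) - {z}) (at z)"
      by (rule eventually_at_in_open) (use z in auto)
    thus ?thesis
    proof eventually_elim
      case (elim z')
      hence "norm (h z' - h z) \<le> 4 * norm (z' - z) / (R - norm z) * cmean R (\<lambda>w. \<bar>Re (h w)\<bar> * PK z w)"
        by (intro holomorphic_increment_bound[OF h z]) (auto simp: dist_norm norm_minus_commute)
      thus ?case using elim by (auto simp: norm_divide divide_le_eq mult_ac)
    qed
  qed
  ultimately show ?thesis by (rule tendsto_upperbound) auto
qed

section \<open>Translations and the shift quotient\<close>

lemma zorder_translate: "zorder (\<lambda>z. f (z + c)) q = zorder f (q + c)"
proof -
  have "zorder (\<lambda>z. f (z + c)) q = zorder (\<lambda>u. f (u + (q + c))) 0"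
    by (subst zorder_shift) (simp add: add.assoc)
  also have "\<dots> = zorder f (q + c)" by (rule zorder_shift[symmetric])
  finally show ?thesis .
qed

lemma pol_translate: "pol (\<lambda>z. f (z + c)) q = pol f (q + c)"
  by (simp add: pol_def zorder_translate)

text \<open>On the circle \<open>\<bar>z\<bar> = t\<close> the Blaschke product of the zeros contributes at most
  \<open>- ln \<bar>B(z)\<bar>\<close> and that of the poles at most \<open>- ln \<bar>B(z + c)\<bar>\<close>, because \<open>\<bar>B\<bar> \<le> 1\<close>.\<close>

lemma nev_m_shift_quotient:
  assumes f: "nonzero_meromorphic f" and R: "regular_on_circle f R" and t: "regular_on_circle f t"
    and tc: "regular_on_circle (\<lambda>z. f (z + c)) t"
    and le: "1 \<le> t" "2 * norm c \<le> R - t" "0 < norm c"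
  shows "nev_m t (\<lambda>z. f (z + c) / f z) \<le>
    4 * norm c / (R - t) * (nev_m R f + nev_m R (\<lambda>z. 1 / f z))
    + nev_N R (\<lambda>z. 1 / f z) + nev_N (R + norm c) (\<lambda>z. f (z + c))"
proof -
  have tR: "t < R" "t + norm c < R" "1 \<le> R + norm c" using le by linarith+
  define Z where "Z = {p. norm p \<le> R \<and> zorder f p \<noteq> 0}"
  have finZ: "finite Z" unfolding Z_def by (rule finite_zorder_support[OF f])
  have Z: "norm p < R \<and> norm p \<noteq> t" if "p \<in> Z" for p
    using support_norm_less[OF R, of p] regular_on_circleD(5)[OF t, of p] that by (auto simp: Z_def)
  have Zc: "norm (p - c) \<noteq> t" if "p \<in> Z" for p
    using regular_on_circleD(5)[OF tc, of "p - c"] that by (auto simp: Z_def zorder_translate)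
  obtain h where h: "h holomorphic_on cball 0 R"
    "\<And>z. norm z \<le> R \<Longrightarrow> f analytic_on {z} \<Longrightarrow> f z \<noteq> 0
      \<Longrightarrow> f z = exp (h z) * (\<Prod>p\<in>Z. blaschke R p z powi zorder f p)"
    "\<And>z. norm z \<le> R \<Longrightarrow> f analytic_on {z} \<Longrightarrow> f z \<noteq> 0
      \<Longrightarrow> ln (norm (f z)) = Re (h z) + (\<Sum>p\<in>Z. (zer f p - pol f p) * ln (norm (blaschke R p z)))"
    "\<And>z. norm z = R \<Longrightarrow> Re (h z) = ln (norm (f z))"
    using log_factorization[OF f R, folded Z_def] by blast
  note Rc = regular_on_circleD[OF R] and tcirc = regular_on_circleD[OF t] and tcc = regular_on_circleD[OF tc]
  define v where "v = (\<lambda>w. \<bar>ln (norm (f w))\<bar>)"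
  have cv: "continuous_on (sphere 0 R) v" unfolding v_def
    by (intro continuous_on_rabs continuous_on_ln_norm R)
  define K where "K = 4 * norm c / (R - t)"
  define P where "P = (\<lambda>z. cmean R (\<lambda>w. v w * PK z w))"
  define G1 where "G1 = (\<lambda>z. \<Sum>p\<in>Z. zer f p * - ln (norm (blaschke R p z)))"
  define G2 where "G2 = (\<lambda>z. \<Sum>p\<in>Z. pol f p * - ln (norm (blaschke R p (z + c))))"
  have P: "cmean t P = cmean R v" "continuous_on (sphere 0 t) P"
    unfolding P_def using cmean_Poisson_integral[OF cv tcirc(1) tR(1)] by auto
  have G1: "cmean t G1 \<le> counting (zer f) R" "continuous_on (sphere 0 t) G1"
    unfolding G1_def
    by (rule cmean_sum_ln_blaschke[OF finZ Z]; use le tR in \<open>auto simp: Z_def zer_def\<close>)+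
  have G2: "continuous_on (sphere 0 t) G2" unfolding G2_def
    using Z Zc tcirc tR
    by (intro continuous_on_sum continuous_on_mult continuous_on_const continuous_on_minus
        cmean_ln_blaschke_shift(2)) auto
  have "cmean t G2 = (\<Sum>p\<in>Z. cmean t (\<lambda>z. pol f p * - ln (norm (blaschke R p (z + c)))))"
    unfolding G2_def using Z Zc tcirc tR
    by (intro cmean_sum finZ continuous_on_mult continuous_on_const continuous_on_minus
        cmean_ln_blaschke_shift(2)) auto
  also have "\<dots> \<le> (\<Sum>p\<in>Z. pol f p * (ln (R + norm c) - ln (norm (p - c))))"
  proof (rule sum_mono)
    fix p assume p: "p \<in> Z"
    have R0: "R > 0" using Rc by simp
    \<comment> \<open>The denominator is bounded by \<open>R * (R + norm c)\<close>. Its factor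
      \<open>R\<close> cancels the \<open>ln R\<close> of the Blaschke numerator, which leaves the
      weight of the pole \<open>p - c\<close> of the shifted function in the disc of radius
      \<open>R + norm c\<close>.\<close>
    have "norm (of_real (R\<^sup>2) - cnj p * c) \<le> norm (of_real (R\<^sup>2) :: complex) + norm (cnj p * c)"
      by (rule norm_triangle_ineq4)
    also have "\<dots> \<le> R * R + R * norm c"
      using Z[OF p] R0 by (auto simp: norm_mult norm_power power2_eq_square intro!: mult_right_mono)
    also have "\<dots> = R * (R + norm c)" by (simp add: algebra_simps)
    finally have "ln (norm (of_real (R\<^sup>2) - cnj p * c)) \<le> ln (R * (R + norm c))"
      using denominator_nonzero[of p R c] Z[OF p] tR le R0
      by (subst ln_le_cancel_iff) (auto intro!: mult_pos_pos add_pos_nonneg)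
    also have "\<dots> = ln R + ln (R + norm c)" using R0 by (subst ln_mult) (auto simp: add_nonneg_eq_0_iff)
    finally have 1: "ln (norm (of_real (R\<^sup>2) - cnj p * c)) \<le> ln R + ln (R + norm c)" .
    \<comment> \<open>For \<open>p = c\<close> the left side is \<open>ln 0 = 0\<close>, so
      \<open>1 \<le> t\<close> is used here.\<close>
    have 2: "ln (norm (p - c)) \<le> ln (max t (norm (p - c)))"
      using le by (cases "p = c") (auto simp: max_def)
    have "cmean t (\<lambda>z. pol f p * - ln (norm (blaschke R p (z + c))))
        = pol f p * - (ln R + ln (max t (norm (p - c))) - ln (norm (of_real (R\<^sup>2) - cnj p * c)))"
      unfolding cmean_cmult cmean_uminus
      by (subst cmean_ln_blaschke_shift(1)) (use Z[OF p] Zc[OF p] tR tcirc(1) in auto)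
    also have "\<dots> \<le> pol f p * (ln (R + norm c) - ln (norm (p - c)))"
      using 1 2 by (intro mult_left_mono) auto
    finally show "cmean t (\<lambda>z. pol f p * - ln (norm (blaschke R p (z + c))))
       \<le> pol f p * (ln (R + norm c) - ln (norm (p - c)))" .
  qed
  also have "\<dots> = (\<Sum>q\<in>(\<lambda>p. p - c) ` Z. pol (\<lambda>z. f (z + c)) q * (ln (R + norm c) - ln (norm q)))"
    by (subst sum.reindex) (auto simp: pol_translate inj_on_def)
  also have "\<dots> = (\<Sum>q\<in>{q\<in>(\<lambda>p. p - c) ` Z. pol (\<lambda>z. f (z + c)) q \<noteq> 0}. pol (\<lambda>z. f (z + c)) q * (ln (R + norm c) - ln (norm q)))"
    by (rule sum.mono_neutral_right) (use finZ in auto)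
  also have "\<dots> \<le> counting (pol (\<lambda>z. f (z + c))) (R + norm c)"
    unfolding counting_def
  proof (rule sum_mono2)
    show "finite {p. norm p \<le> R + norm c \<and> pol (\<lambda>z. f (z + c)) p \<noteq> 0}"
      by (rule finite_pol[OF nonzero_meromorphic_shift[OF f]])
    have "norm (p - c) \<le> R + norm c" if "p \<in> Z" for p
      using norm_triangle_ineq4[of p c] Z[OF that] by linarith
    thus "{q\<in>(\<lambda>p. p - c) ` Z. pol (\<lambda>z. f (z + c)) q \<noteq> 0} \<subseteq> {p. norm p \<le> R + norm c \<and> pol (\<lambda>z. f (z + c)) p \<noteq> 0}"
      by auto
    fix q assume "q \<in> {p. norm p \<le> R + norm c \<and> pol (\<lambda>z. f (z + c)) p \<noteq> 0} - {q\<in>(\<lambda>p. p - c) ` Z. pol (\<lambda>z. f (z + c)) q \<noteq> 0}"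
    thus "0 \<le> pol (\<lambda>z. f (z + c)) q * (ln (R + norm c) - ln (norm q))"
      using tR(3) by (intro mult_nonneg_nonneg counting_weight_nonneg pol_nonneg) simp_all
  qed
  finally have G2m: "cmean t G2 \<le> counting (pol (\<lambda>z. f (z + c))) (R + norm c)" .
  have "log_plus (norm (f (z + c) / f z)) \<le> K * P z + G1 z + G2 z" if z: "norm z = t" for z
  proof (rule log_plus_leI)
    have zR: "norm z \<le> R" "norm z < R" "norm (z + c) \<le> R"
      using z tR norm_triangle_ineq[of z c] by auto
    have ln0: "ln (norm (blaschke R p z)) \<le> 0" "ln (norm (blaschke R p (z + c))) \<le> 0" if "p \<in> Z" for p
    proof -
      have "z \<noteq> p" "z + c \<noteq> p" using Z[OF that] Zc[OF that] z by auto
      thus "ln (norm (blaschke R p z)) \<le> 0" "ln (norm (blaschke R p (z + c))) \<le> 0"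
        using ln_blaschke(2)[OF zR(1)] ln_blaschke(2)[OF zR(3)] Z[OF that] by auto
    qed
    have G0: "0 \<le> G1 z" "0 \<le> G2 z" unfolding G1_def G2_def
      by (intro sum_nonneg mult_nonneg_nonneg; use ln0 in auto)+
    have "Re (h (z + c)) - Re (h z) \<le> norm (h (z + c) - h z)"
      using complex_Re_le_cmod[of "h (z + c) - h z"] by simp
    also have "\<dots> \<le> 4 * norm c / (R - t) * cmean R (\<lambda>w. \<bar>Re (h w)\<bar> * PK z w)"
      using holomorphic_increment_bound[OF h(1) zR(2), of "z + c"] le z by simp
    also have "cmean R (\<lambda>w. \<bar>Re (h w)\<bar> * PK z w) = P z" unfolding P_def
      by (rule cmean_cong) (use h(4) Rc in \<open>auto simp: v_def\<close>)
    finally have hh: "Re (h (z + c)) - Re (h z) \<le> K * P z" by (simp add: K_def)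
    have "0 \<le> P z" unfolding P_def
      by (rule cmean_nonneg) (use Rc zR in \<open>auto intro!: PK_nonneg mult_nonneg_nonneg simp: v_def\<close>)
    hence KP: "0 \<le> K * P z" using tR by (simp add: K_def)
    thus "0 \<le> K * P z + G1 z + G2 z" using G0 by simp
    have fz: "f analytic_on {z}" "f z \<noteq> 0" using tcirc(3,4)[OF z] by auto
    have fzc: "f (z + c) \<noteq> 0" using tcc(3)[OF z] .
    have afzc: "f analytic_on {z + c}"
    proof -
      have "(\<lambda>x. f (x + c)) \<circ> (\<lambda>x. x - c) analytic_on {z + c}"
        by (rule analytic_on_compose) (use tcc(4)[OF z] in \<open>auto intro!: analytic_intros\<close>)
      thus ?thesis by (simp add: o_def)
    qed
    have "ln (norm (f (z + c) / f z)) = ln (norm (f (z + c))) - ln (norm (f z))"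
      using fz fzc by (simp add: norm_divide ln_div)
    also have "\<dots> = Re (h (z + c)) - Re (h z) + (\<Sum>p\<in>Z. (zer f p - pol f p) *
        (ln (norm (blaschke R p (z + c))) - ln (norm (blaschke R p z))))"
      using h(3)[OF zR(1) fz] h(3)[OF zR(3) afzc fzc] by (simp add: sum_subtractf right_diff_distrib)
    also have "\<dots> \<le> K * P z + (\<Sum>p\<in>Z. zer f p * - ln (norm (blaschke R p z)) + pol f p * - ln (norm (blaschke R p (z + c))))"
    proof (intro add_mono hh sum_mono)
      fix p assume p: "p \<in> Z"
      show "(zer f p - pol f p) * (ln (norm (blaschke R p (z + c))) - ln (norm (blaschke R p z)))
        \<le> zer f p * - ln (norm (blaschke R p z)) + pol f p * - ln (norm (blaschke R p (z + c)))"
        using mult_nonneg_nonpos[OF zer_nonneg[of f p] ln0(2)[OF p]] mult_nonneg_nonpos[OF pol_nonneg[of f p] ln0(1)[OF p]]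
        by (simp add: algebra_simps)
    qed
    also have "\<dots> = K * P z + G1 z + G2 z" by (simp only: G1_def G2_def sum.distrib add.assoc)
    finally show "ln (norm (f (z + c) / f z)) \<le> K * P z + G1 z + G2 z" .
  qed
  hence "nev_m t (\<lambda>z. f (z + c) / f z) \<le> cmean t (\<lambda>z. K * P z + G1 z + G2 z)"
    unfolding nev_m_eq_cmean
    by (intro cmean_mono) (use tcirc tcc P G1 G2 in \<open>auto intro!: continuous_on_log_plus_norm continuous_intros\<close>)
  also have "\<dots> = K * cmean R v + cmean t G1 + cmean t G2"
    using P G1(2) G2 tcirc(1)
    by (simp add: cmean_add cmean_cmult continuous_on_add continuous_on_mult continuous_on_const)
  also have "\<dots> \<le> K * cmean R v + counting (zer f) R + counting (pol (\<lambda>z. f (z + c))) (R + norm c)"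
    using G1(1) G2m by simp
  also have "cmean R v = nev_m R f + nev_m R (\<lambda>z. 1 / f z)" unfolding v_def by (rule nev_m_sum_eq[OF R, symmetric])
  also have "counting (zer f) R = nev_N R (\<lambda>z. 1 / f z)"
    using Rc(1) by (simp add: nev_N_eq_counting nonzero_meromorphic_inverse f pol_inverse)
  also have "counting (pol (\<lambda>z. f (z + c))) (R + norm c) = nev_N (R + norm c) (\<lambda>z. f (z + c))"
    using Rc(1) by (simp add: nev_N_eq_counting nonzero_meromorphic_shift f add_pos_nonneg)
  finally show ?thesis by (simp add: K_def)
qed

text \<open>Rearranged, it compares the weight \<open>ln r - ln x\<close> of a pole with its weight
  after both radii grow by \<open>d\<close>. The derivative has the sign of
  \<open>d * (s - 1)\<close>, so for \<open>d > 0\<close> the factor \<open>1 + d\<close> is the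
  smallest that works from \<open>s = 1\<close> on.\<close>

lemma ln_shift_monotone:
  fixes x r d :: real
  assumes "1 \<le> x" "x \<le> r" "0 \<le> d"
  shows "(1 + d) * ln (x + d) - ln x \<le> (1 + d) * ln (r + d) - ln r"
proof (rule DERIV_nonneg_imp_nondecreasing[OF assms(2)])
  fix s assume s: "x \<le> s" "s \<le> r"
  hence s1: "1 \<le> s" using assms by simp
  have "((\<lambda>s. (1 + d) * ln (s + d) - ln s) has_real_derivative ((1 + d) * (1 / (s + d)) - 1 / s)) (at s)"
    using s1 assms(3) by (auto intro!: derivative_eq_intros)
  moreover have "(1 + d) * (1 / (s + d)) - 1 / s = d * (s - 1) / ((s + d) * s)"
    using s1 assms(3) by (simp add: divide_simps) (simp add: algebra_simps)
  moreover have "\<dots> \<ge> 0" using s1 assms(3) by simp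
  ultimately show "\<exists>y. ((\<lambda>s. (1 + d) * ln (s + d) - ln s) has_real_derivative y) (at s) \<and> y \<ge> 0" by metis
qed

text \<open>A pole \<open>q\<close> of the shifted function is the pole \<open>q + c\<close> of
  \<open>f\<close>, and \<open>norm (q + c) \<le> norm q + norm c\<close>. Outside the unit disc the
  weights are compared by \<open>ln_shift_monotone\<close>; the finitely many poles inside give the
  logarithmic term. The factor \<open>1 + norm c\<close> does no harm, since the bound is applied to
  counting functions that are o(T).\<close>

lemma nev_N_shift:
  assumes f: "nonzero_meromorphic f"
  obtains A where "A \<ge> 0" "\<And>r. 1 \<le> r \<Longrightarrow> nev_N r (\<lambda>z. f (z + c)) \<le> (1 + norm c) * nev_N (r + norm c) f + A * (ln r + 1)"
proof -
  define D where "D = pol (\<lambda>z. f (z + c))"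
  define S where "S = {q. norm q \<le> 1 \<and> D q \<noteq> 0}"
  have finS: "finite S" unfolding S_def D_def by (rule finite_pol[OF nonzero_meromorphic_shift[OF f]])
  define A where "A = (\<Sum>q\<in>S. D q * (1 + \<bar>ln (norm q)\<bar>))"
  have D0: "0 \<le> D q" for q by (simp add: D_def)
  have A0: "A \<ge> 0" unfolding A_def by (intro sum_nonneg mult_nonneg_nonneg D0) auto
  have "nev_N r (\<lambda>z. f (z + c)) \<le> (1 + norm c) * nev_N (r + norm c) f + A * (ln r + 1)" if r: "1 \<le> r" for r
  proof -
    define U where "U = {q. norm q \<le> r \<and> D q \<noteq> 0}"
    have finU: "finite U" unfolding U_def D_def by (rule finite_pol[OF nonzero_meromorphic_shift[OF f]])
    have SU: "S \<subseteq> U" using r by (auto simp: S_def U_def)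
    have "nev_N r (\<lambda>z. f (z + c)) = (\<Sum>q\<in>U. D q * (ln r - ln (norm q)))"
      using r by (simp add: nev_N_eq_counting nonzero_meromorphic_shift f counting_def U_def D_def)
    also have "\<dots> = (\<Sum>q\<in>U-S. D q * (ln r - ln (norm q))) + (\<Sum>q\<in>S. D q * (ln r - ln (norm q)))"
      by (rule sum.subset_diff[OF SU finU])
    also have "(\<Sum>q\<in>S. D q * (ln r - ln (norm q))) \<le> (\<Sum>q\<in>S. D q * (1 + \<bar>ln (norm q)\<bar>) * (ln r + 1))"
    proof (rule sum_mono)
      fix q :: complex
      have "ln r - ln (norm q) \<le> (1 + \<bar>ln (norm q)\<bar>) * (ln r + 1)"
      proof -
        have "0 \<le> ln r" "0 \<le> \<bar>ln (norm q)\<bar> * ln r" using r by auto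
        moreover have "- ln (norm q) \<le> \<bar>ln (norm q)\<bar>" by linarith
        ultimately show ?thesis unfolding distrib_right distrib_left by linarith
      qed
      thus "D q * (ln r - ln (norm q)) \<le> D q * (1 + \<bar>ln (norm q)\<bar>) * (ln r + 1)"
        unfolding mult.assoc by (rule mult_left_mono) (rule D0)
    qed
    also have "\<dots> = A * (ln r + 1)" by (simp add: A_def sum_distrib_right)
    also have "(\<Sum>q\<in>U-S. D q * (ln r - ln (norm q)))
       \<le> (\<Sum>q\<in>U-S. (1 + norm c) * (pol f (q + c) * (ln (r + norm c) - ln (norm (q + c)))))"
    proof (rule sum_mono)
      fix q assume q: "q \<in> U - S"
      define x where "x = norm q"
      have x: "1 \<le> x" "x \<le> r" using q by (auto simp: U_def S_def x_def)
      have "ln r - ln x \<le> (1 + norm c) * (ln (r + norm c) - ln (x + norm c))"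
        using ln_shift_monotone[OF x, of "norm c"] by (simp add: algebra_simps)
      also have "\<dots> \<le> (1 + norm c) * (ln (r + norm c) - ln (norm (q + c)))"
      proof -
        have "ln (norm (q + c)) \<le> ln (x + norm c)"
        proof (cases "q + c = 0")
          case True
          have "1 \<le> x + norm c" using x by (simp add: add_increasing2)
          thus ?thesis using True by simp
        next
          case False
          have "x + norm c > 0" using x norm_ge_zero[of c] by linarith
          thus ?thesis using False norm_triangle_ineq[of q c] by (simp add: x_def)
        qed
        thus ?thesis by (intro mult_left_mono) auto
      qed
      finally have "ln r - ln x \<le> (1 + norm c) * (ln (r + norm c) - ln (norm (q + c)))" .
      from mult_left_mono[OF this D0[of q]]
      show "D q * (ln r - ln (norm q)) \<le> (1 + norm c) * (pol f (q + c) * (ln (r + norm c) - ln (norm (q + c))))"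
        by (simp add: x_def D_def pol_translate mult_ac)
    qed
    also have "\<dots> = (1 + norm c) * (\<Sum>p\<in>(\<lambda>q. q + c) ` (U-S). pol f p * (ln (r + norm c) - ln (norm p)))"
      by (subst sum.reindex) (auto simp: inj_on_def sum_distrib_left)
    also have "\<dots> \<le> (1 + norm c) * counting (pol f) (r + norm c)"
      unfolding counting_def
    proof (intro mult_left_mono sum_mono2)
      show "finite {p. norm p \<le> r + norm c \<and> pol f p \<noteq> 0}" by (rule finite_pol[OF f])
      show "(\<lambda>q. q + c) ` (U-S) \<subseteq> {p. norm p \<le> r + norm c \<and> pol f p \<noteq> 0}"
      proof (intro image_subsetI CollectI conjI)
        fix q assume q: "q \<in> U - S"
        thus "norm (q + c) \<le> r + norm c" using norm_triangle_ineq[of q c] by (simp add: U_def)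
        show "pol f (q + c) \<noteq> 0" using q by (simp add: U_def D_def pol_translate)
      qed
      fix p assume "p \<in> {p. norm p \<le> r + norm c \<and> pol f p \<noteq> 0} - (\<lambda>q. q + c) ` (U-S)"
      thus "0 \<le> pol f p * (ln (r + norm c) - ln (norm p))"
        using r by (intro mult_nonneg_nonneg counting_weight_nonneg) (auto simp: add_increasing2)
    qed auto
    also have "counting (pol f) (r + norm c) = nev_N (r + norm c) f"
      using r by (simp add: nev_N_eq_counting f add_pos_nonneg)
    finally show ?thesis by simp
  qed
  thus ?thesis using that A0 by blast
qed

text \<open>A point of the disc of radius \<open>r\<close> has weight at least
  \<open>ln s - ln r \<ge> 1 / s\<close> in the disc of radius \<open>s\<close>. The resulting
  factor \<open>s\<close> is harmless because the bound is used under a logarithm.\<close>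

lemma support_sum_le:
  assumes f: "nonzero_meromorphic f" and r: "1 \<le> r" "r + 1 \<le> s"
  shows "(\<Sum>p | norm p \<le> r \<and> zorder f p \<noteq> 0. zer f p + pol f p) \<le> s * (nev_N s f + nev_N s (\<lambda>z. 1 / f z))"
proof -
  define D where "D = (\<lambda>p. zer f p + pol f p)"
  have D0: "0 \<le> D p" for p by (simp add: D_def)
  have D: "D p \<noteq> 0 \<longleftrightarrow> zorder f p \<noteq> 0" for p by (auto simp: D_def zer_def pol_def)
  have "1 / s \<le> ln s - ln r"
  proof -
    have "ln r - ln s = ln (r / s)" using r by (simp add: ln_div)
    also have "\<dots> \<le> r / s - 1" by (rule ln_le_minus_one) (use r in auto)
    also have "\<dots> \<le> - (1 / s)"
    proof -
      have "(r + 1) / s \<le> 1" using r by simp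
      thus ?thesis by (simp add: add_divide_distrib)
    qed
    finally show ?thesis by simp
  qed
  hence w: "1 / s \<le> ln s - ln (norm p)" if "norm p \<le> r" for p :: complex
    using that r by (cases "p = 0") (auto intro: order_trans[of _ "ln s - ln r"])
  have "(\<Sum>p | norm p \<le> r \<and> zorder f p \<noteq> 0. D p) = (\<Sum>p | norm p \<le> r \<and> zorder f p \<noteq> 0. s * (D p * (1 / s)))"
    using r by simp
  also have "\<dots> \<le> (\<Sum>p | norm p \<le> r \<and> zorder f p \<noteq> 0. s * (D p * (ln s - ln (norm p))))"
    by (intro sum_mono mult_left_mono D0) (use w r in auto)
  also have "\<dots> = s * (\<Sum>p | norm p \<le> r \<and> D p \<noteq> 0. D p * (ln s - ln (norm p)))"
    by (simp add: D sum_distrib_left)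
  also have "\<dots> \<le> s * counting D s" unfolding counting_def
  proof (intro mult_left_mono sum_mono2)
    show "finite {p. norm p \<le> s \<and> D p \<noteq> 0}" using finite_zorder_support[OF f] by (simp add: D)
  qed (use r D0 counting_weight_nonneg[of s] in auto)
  also have "counting D s = nev_N s f + nev_N s (\<lambda>z. 1 / f z)"
    using r by (simp add: D_def counting_add finite_zer finite_pol f nev_N_eq_counting nonzero_meromorphic_inverse pol_inverse)
  finally show ?thesis by (simp add: D_def)
qed

text \<open>The logarithmic derivative is \<open>1 / (z - p) + cnj p / d\<close> with
  \<open>d\<close> the denominator. From \<open>R - norm z \<ge> 1\<close> one gets
  \<open>norm d \<ge> R\<close>. Hence the Blaschke factor is at most \<open>norm (z - p)\<close> in
  modulus, and the second summand has modulus at most 1. Both summands are therefore at most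
  \<open>1 / norm (blaschke R p z)\<close>.\<close>

lemma logderiv_blaschke:
  assumes z: "norm z < R" and p: "norm p < R" "z \<noteq> p" and R: "R - norm z \<ge> 1"
  shows "\<exists>b'. (blaschke R p has_field_derivative b') (at z) \<and> norm (b' / blaschke R p z) \<le> 2 / norm (blaschke R p z)"
proof -
  define d where "d = of_real (R\<^sup>2) - cnj p * z"
  have R0: "R > 0" using z norm_ge_zero[of z] by linarith
  have d0: "d \<noteq> 0" unfolding d_def using denominator_nonzero[OF p(1), of z] z by simp
  have "R * 1 \<le> R * (R - norm z)" using R R0 by (intro mult_left_mono) auto
  also have "\<dots> = norm (of_real (R\<^sup>2) :: complex) - R * norm z"
    by (simp add: norm_mult power2_eq_square algebra_simps)
  also have "\<dots> \<le> norm (of_real (R\<^sup>2) :: complex) - norm (cnj p * z)"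
    using p z by (auto simp: norm_mult intro!: mult_right_mono)
  also have "\<dots> \<le> norm d" unfolding d_def by (rule norm_triangle_ineq2)
  finally have dR: "R \<le> norm d" by simp
  have b: "norm (blaschke R p z) = R * norm (z - p) / norm d"
    using R0 by (simp add: blaschke_def d_def norm_mult norm_divide del: of_real_power)
  have zp: "0 < norm (z - p)" using p by simp
  have bpos: "0 < norm (blaschke R p z)" unfolding b using R0 d0 zp by simp
  have b1: "norm (blaschke R p z) \<le> 1" by (rule norm_blaschke_le_1) (use z p in auto)
  have "R * norm (z - p) \<le> norm d * norm (z - p)" using dR by (intro mult_right_mono) auto
  hence b2: "norm (blaschke R p z) \<le> norm (z - p)" unfolding b using d0 by (simp add: divide_le_eq mult.commute)
  define L where "L = 1 / (z - p) + cnj p / d"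
  have eq: "blaschke R p z * L = (of_real R * d - of_real R * (z - p) * - cnj p) / (d * d)"
    unfolding L_def blaschke_def d_def[symmetric] using p(2) d0
    by (simp add: divide_simps) (simp add: algebra_simps)
  have "(blaschke R p has_field_derivative (blaschke R p z * L)) (at z)"
    unfolding eq unfolding blaschke_def[abs_def] d_def
    by (rule derivative_eq_intros refl | use d0 in \<open>simp add: d_def\<close>)+
  moreover have "norm L \<le> 2 / norm (blaschke R p z)"
  proof -
    have "norm L \<le> 1 / norm (z - p) + norm p / norm d"
      unfolding L_def using norm_triangle_ineq[of "1 / (z - p)" "cnj p / d"] by (simp add: norm_divide)
    moreover have "1 / norm (z - p) \<le> 1 / norm (blaschke R p z)"
      using b2 bpos zp by (intro divide_left_mono) auto
    moreover have "norm p / norm d \<le> 1" using p dR R0 by (simp add: divide_le_eq_1)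
    moreover have "1 \<le> 1 / norm (blaschke R p z)" using b1 bpos by simp
    ultimately have "norm L \<le> 1 / norm (blaschke R p z) + 1 / norm (blaschke R p z)" by linarith
    thus ?thesis by simp
  qed
  ultimately show ?thesis using bpos by (intro exI[of _ "blaschke R p z * L"]) auto
qed

text \<open>Every factor \<open>1 / \<bar>B_p\<bar>\<close> is at least \<open>1\<close>, so the sum in the logarithmic derivative
  is bounded by a product, whose logarithm has a mean controlled by the counting functions.\<close>

lemma nev_m_logderiv:
  assumes f: "nonzero_meromorphic f" and R: "regular_on_circle f R" and t: "regular_on_circle f t"
    and le: "1 \<le> t" "t + 1 \<le> R" "R + 1 \<le> s"
  shows "nev_m t (\<lambda>z. deriv f z / f z) \<le>
    ln (1 + 8 * R * (nev_m R f + nev_m R (\<lambda>z. 1 / f z)) + 2 * s * (nev_N s f + nev_N s (\<lambda>z. 1 / f z)))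
    + nev_N R f + nev_N R (\<lambda>z. 1 / f z)"
proof -
  have tR: "t < R" using le by linarith
  define Z where "Z = {p. norm p \<le> R \<and> zorder f p \<noteq> 0}"
  have finZ: "finite Z" unfolding Z_def by (rule finite_zorder_support[OF f])
  have Z: "norm p < R \<and> norm p \<noteq> t" if "p \<in> Z" for p
    using support_norm_less[OF R, of p] regular_on_circleD(5)[OF t, of p] that by (auto simp: Z_def)
  obtain h where h: "h holomorphic_on cball 0 R"
    "\<And>z. norm z \<le> R \<Longrightarrow> f analytic_on {z} \<Longrightarrow> f z \<noteq> 0
      \<Longrightarrow> f z = exp (h z) * (\<Prod>p\<in>Z. blaschke R p z powi zorder f p)"
    "\<And>z. norm z \<le> R \<Longrightarrow> f analytic_on {z} \<Longrightarrow> f z \<noteq> 0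
      \<Longrightarrow> ln (norm (f z)) = Re (h z) + (\<Sum>p\<in>Z. (zer f p - pol f p) * ln (norm (blaschke R p z)))"
    "\<And>z. norm z = R \<Longrightarrow> Re (h z) = ln (norm (f z))"
    using log_factorization[OF f R, folded Z_def] by blast
  note Rc = regular_on_circleD[OF R] and tc = regular_on_circleD[OF t]
  define A where "A = nev_m R f + nev_m R (\<lambda>z. 1 / f z)"
  define n where "n = (\<Sum>p\<in>Z. zer f p + pol f p)"
  define D where "D = (\<lambda>p. zer f p + pol f p)"
  define G where "G = (\<lambda>z. \<Sum>p\<in>Z. D p * - ln (norm (blaschke R p z)))"
  define C where "C = 1 + 8 * R * A + 2 * n"
  have ch: "continuous_on (sphere 0 R) h"
    by (rule continuous_on_subset[OF holomorphic_on_imp_continuous_on[OF h(1)]]) auto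
  have A0: "0 \<le> A" unfolding A_def using Rc(1) by (intro add_nonneg_nonneg nev_m_nonneg) auto
  have n0: "0 \<le> n" unfolding n_def by (intro sum_nonneg) auto
  have C1: "1 \<le> C" using A0 n0 Rc(1) by (simp add: C_def)
  have G: "cmean t G \<le> counting D R" "continuous_on (sphere 0 t) G"
    unfolding G_def
    by (rule cmean_sum_ln_blaschke[OF finZ Z]; use le tR in \<open>auto simp: Z_def D_def zer_def pol_def\<close>)+
  have ptw: "log_plus (norm (deriv f z / f z)) \<le> ln C + G z" if z: "norm z = t" for z
  proof -
    have zR: "norm z \<le> R" "norm z < R" using z tR by auto
    have nz: "z \<noteq> p" if "p \<in> Z" for p using Z[OF that] z by auto
    have bpos: "0 < norm (blaschke R p z)" if "p \<in> Z" for p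
      using blaschke_eq_0_iff[OF zR(1)] Z[OF that] nz[OF that] by auto
    have b1: "norm (blaschke R p z) \<le> 1" if "p \<in> Z" for p
      using norm_blaschke_le_1[OF zR(1)] Z[OF that] by auto
    have ln0: "0 \<le> - ln (norm (blaschke R p z))" if "p \<in> Z" for p
      using ln_blaschke(2)[OF zR(1)] Z[OF that] nz[OF that] by auto
    have D1: "1 \<le> D p" if "p \<in> Z" for p using that by (auto simp: D_def Z_def zer_def pol_def)
    have G0: "0 \<le> G z" unfolding G_def
      by (intro sum_nonneg mult_nonneg_nonneg ln0) (auto simp: D_def)
    have "\<forall>p\<in>Z. \<exists>b'. (blaschke R p has_field_derivative b') (at z) \<and> norm (b' / blaschke R p z) \<le> 2 / norm (blaschke R p z)"
      using logderiv_blaschke[OF zR(2)] Z nz z le by auto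
    then obtain b' where b': "\<And>p. p \<in> Z \<Longrightarrow> (blaschke R p has_field_derivative b' p) (at z)"
      "\<And>p. p \<in> Z \<Longrightarrow> norm (b' p / blaschke R p z) \<le> 2 / norm (blaschke R p z)"
      by metis
    define F where "F = (\<lambda>z. exp (h z) * (\<Prod>p\<in>Z. blaschke R p z powi zorder f p))"
    have fz: "f analytic_on {z}" "f z \<noteq> 0" using tc(3,4)[OF z] by auto
    \<comment> \<open>The factorization is available only at points where \<open>f\<close> is
      analytic and nonzero. It has to hold on a whole neighbourhood before derivatives can be
      compared.\<close>
    have "eventually (\<lambda>w. f w = F w) (nhds z)"
    proof -
      have "eventually (\<lambda>w. f analytic_on {w}) (nhds z)"
      proof -
        obtain S where S: "open S" "z \<in> S" "f holomorphic_on S" using fz(1) by (auto simp: analytic_at)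
        have "f analytic_on {w}" if "w \<in> S" for w using S that by (auto simp: analytic_at)
        thus ?thesis using S by (auto simp: eventually_nhds)
      qed
      moreover have "eventually (\<lambda>w. f w \<noteq> 0) (nhds z)"
      proof -
        have "eventually (\<lambda>w. f w \<noteq> 0) (at z)"
          using analytic_at_imp_isCont[OF fz(1)] fz(2) by (auto simp: isCont_def intro: tendsto_imp_eventually_ne)
        thus ?thesis using fz(2) by (auto simp: eventually_at_filter elim: eventually_mono)
      qed
      moreover have "eventually (\<lambda>w. w \<in> ball 0 R) (nhds z)"
        by (rule eventually_nhds_in_open) (use zR in auto)
      ultimately show ?thesis
        by eventually_elim (use h(2) in \<open>auto simp: F_def\<close>)
    qed
    hence "deriv f z = deriv F z" "f z = F z"
      by (auto intro: deriv_cong_ev dest: eventually_nhds_x_imp_x)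
    have dh: "(h has_field_derivative deriv h z) (at z)"
      by (rule holomorphic_derivI[where S="ball 0 R"]) (use zR in \<open>auto intro!: holomorphic_on_subset[OF h(1)]\<close>)
    have "((\<lambda>z. \<Prod>p\<in>Z. blaschke R p z powi zorder f p) has_field_derivative
       ((\<Prod>p\<in>Z. blaschke R p z powi zorder f p) *
        (\<Sum>p\<in>Z. (of_int (zorder f p) * blaschke R p z powi (zorder f p - 1) * b' p) / (blaschke R p z powi zorder f p)))) (at z)"
      by (rule has_field_derivative_prod') (use b' bpos in \<open>auto intro!: DERIV_power_int\<close>)
    also have "(\<Sum>p\<in>Z. (of_int (zorder f p) * blaschke R p z powi (zorder f p - 1) * b' p) / (blaschke R p z powi zorder f p))
       = (\<Sum>p\<in>Z. of_int (zorder f p) * (b' p / blaschke R p z))"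
      by (intro sum.cong refl) (use bpos in \<open>auto simp: power_int_diff\<close>)
    finally have dP: "((\<lambda>z. \<Prod>p\<in>Z. blaschke R p z powi zorder f p) has_field_derivative
       ((\<Prod>p\<in>Z. blaschke R p z powi zorder f p) * (\<Sum>p\<in>Z. of_int (zorder f p) * (b' p / blaschke R p z)))) (at z)" .
    have "(F has_field_derivative (F z * (deriv h z + (\<Sum>p\<in>Z. of_int (zorder f p) * (b' p / blaschke R p z))))) (at z)"
      unfolding F_def by (rule derivative_eq_intros dh dP refl)+ (simp add: algebra_simps)
    hence "deriv F z = F z * (deriv h z + (\<Sum>p\<in>Z. of_int (zorder f p) * (b' p / blaschke R p z)))"
      by (rule DERIV_imp_deriv)
    hence "deriv f z / f z = deriv h z + (\<Sum>p\<in>Z. of_int (zorder f p) * (b' p / blaschke R p z))"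
      using \<open>deriv f z = deriv F z\<close> \<open>f z = F z\<close> fz(2) by simp
    hence "norm (deriv f z / f z) \<le> norm (deriv h z) + (\<Sum>p\<in>Z. norm (of_int (zorder f p) * (b' p / blaschke R p z)))"
      using norm_triangle_le[OF add_left_mono[OF norm_sum]] by metis
    also have "norm (deriv h z) \<le> 8 * R * A"
    proof -
      have "norm (deriv h z) \<le> 4 / (R - t) * cmean R (\<lambda>w. \<bar>Re (h w)\<bar> * PK z w)"
        using holomorphic_deriv_bound[OF h(1) zR(2)] z by simp
      \<comment> \<open>Unlike for shifts, the kernel can be estimated crudely here: the resulting
        factor of order \<open>R\<close> ends up inside a logarithm.\<close>
      also have "cmean R (\<lambda>w. \<bar>Re (h w)\<bar> * PK z w) \<le> cmean R (\<lambda>w. (R + t) / (R - t) * \<bar>Re (h w)\<bar>)"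
      proof (rule cmean_mono)
        fix w :: complex assume "norm w = R"
        thus "\<bar>Re (h w)\<bar> * PK z w \<le> (R + t) / (R - t) * \<bar>Re (h w)\<bar>"
          using PK_le[of z w] z tR mult_left_mono[of "PK z w" "(R + t) / (R - t)" "\<bar>Re (h w)\<bar>"] by (simp add: mult.commute)
      qed (use Rc ch zR tR in \<open>auto intro!: continuous_intros continuous_on_PK\<close>)
      also have "\<dots> = (R + t) / (R - t) * cmean R (\<lambda>w. \<bar>Re (h w)\<bar>)" by (rule cmean_cmult)
      also have "cmean R (\<lambda>w. \<bar>Re (h w)\<bar>) = cmean R (\<lambda>w. \<bar>ln (norm (f w))\<bar>)"
        by (rule cmean_cong) (use h(4) Rc in auto)
      also have "\<dots> = A" unfolding A_def by (rule nev_m_sum_eq[OF R, symmetric])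
      finally have "norm (deriv h z) \<le> 4 / (R - t) * ((R + t) / (R - t) * A)"
        using tR by (simp add: divide_right_mono)
      also have "\<dots> \<le> 4 / 1 * ((2 * R) / 1 * A)"
        using A0 le tR tc(1) by (intro mult_mono frac_le) auto
      finally show ?thesis by simp
    qed
    also have "(\<Sum>p\<in>Z. norm (of_int (zorder f p) * (b' p / blaschke R p z))) \<le> (\<Sum>p\<in>Z. D p * (2 * exp (G z)))"
    proof (rule sum_mono)
      fix p assume p: "p \<in> Z"
      have "norm (of_int (zorder f p) * (b' p / blaschke R p z)) = \<bar>of_int (zorder f p)\<bar> * norm (b' p / blaschke R p z)"
        by (simp only: norm_mult norm_of_int)
      also have "\<bar>of_int (zorder f p)\<bar> = D p" by (simp add: D_def zer_def pol_def)
      also have "norm (b' p / blaschke R p z) \<le> 2 / norm (blaschke R p z)" by (rule b'(2)[OF p])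
      also have "2 / norm (blaschke R p z) = 2 * exp (- ln (norm (blaschke R p z)))"
        using bpos[OF p] by (simp add: exp_minus field_simps)
      also have "\<dots> \<le> 2 * exp (G z)"
      proof -
        have "- ln (norm (blaschke R p z)) \<le> D p * - ln (norm (blaschke R p z))"
          using mult_right_mono[OF D1[OF p] ln0[OF p]] by simp
        also have "\<dots> \<le> G z" unfolding G_def
        proof (rule member_le_sum[OF p _ finZ])
          fix x assume "x \<in> Z - {p}"
          thus "0 \<le> D x * - ln (norm (blaschke R x z))"
            using ln0[of x] by (intro mult_nonneg_nonneg) (auto simp: D_def)
        qed
        finally show ?thesis by simp
      qed
      finally show "norm (of_int (zorder f p) * (b' p / blaschke R p z)) \<le> D p * (2 * exp (G z))"
        by (simp add: D_def mult_left_mono)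
    qed
    also have "\<dots> = 2 * n * exp (G z)" by (simp add: n_def D_def flip: sum_distrib_right)
    finally have "norm (deriv f z / f z) \<le> 8 * R * A * 1 + 2 * n * exp (G z)" by simp
    also have "\<dots> \<le> 8 * R * A * exp (G z) + 2 * n * exp (G z)"
      using A0 Rc(1) G0 by (intro add_right_mono mult_left_mono) auto
    also have "\<dots> \<le> C * exp (G z)" by (simp add: C_def distrib_right)
    finally have "norm (deriv f z / f z) \<le> C * exp (G z)" .
    hence "log_plus (norm (deriv f z / f z)) \<le> log_plus (C * exp (G z))" by (intro log_plus_mono) auto
    also have "\<dots> = ln C + G z" using C1 G0 by (simp add: log_plus_def ln_mult)
    finally show ?thesis .
  qed
  have cf: "continuous_on (sphere 0 t) (\<lambda>z. deriv f z / f z)"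
  proof -
    have "f analytic_on sphere 0 t" using tc(4) by (subst analytic_on_analytic_at) auto
    hence "(\<lambda>z. deriv f z / f z) analytic_on sphere 0 t"
      using tc(3) by (intro analytic_on_divide analytic_deriv) auto
    thus ?thesis by (intro holomorphic_on_imp_continuous_on analytic_imp_holomorphic)
  qed
  have "nev_m t (\<lambda>z. deriv f z / f z) \<le> cmean t (\<lambda>z. ln C + G z)"
    unfolding nev_m_eq_cmean
    by (intro cmean_mono continuous_on_log_plus_norm cf continuous_on_add continuous_on_const G(2) ptw)
       (use tc(1) in auto)
  also have "\<dots> = ln C + cmean t G" using G(2) tc(1) by (simp add: cmean_add)
  also have "\<dots> \<le> ln C + counting D R" using G(1) by simp
  also have "counting D R = nev_N R f + nev_N R (\<lambda>z. 1 / f z)"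
    using Rc(1) by (simp add: D_def counting_add finite_zer finite_pol f nev_N_eq_counting nonzero_meromorphic_inverse pol_inverse)
  also have "ln C \<le> ln (1 + 8 * R * A + 2 * s * (nev_N s f + nev_N s (\<lambda>z. 1 / f z)))"
  proof -
    have "n \<le> s * (nev_N s f + nev_N s (\<lambda>z. 1 / f z))"
      unfolding n_def Z_def by (rule support_sum_le[OF f]) (use le in auto)
    hence "C \<le> 1 + 8 * R * A + 2 * s * (nev_N s f + nev_N s (\<lambda>z. 1 / f z))" by (simp add: C_def)
    thus ?thesis using C1 by simp
  qed
  finally show ?thesis by (simp add: A_def)
qed

subsection \<open>Growth of transcendental functions\<close>

lemma nev_T_ge_N: "0 < r \<Longrightarrow> nev_N r f \<le> nev_T r f"
  by (simp add: nev_T_def nev_m_nonneg)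

lemma nev_T_ge_m: "nonzero_meromorphic f \<Longrightarrow> 1 \<le> r \<Longrightarrow> nev_m r f \<le> nev_T r f"
  by (simp add: nev_T_def nev_N_nonneg)

lemma nev_T_nonneg: "nonzero_meromorphic f \<Longrightarrow> 1 \<le> r \<Longrightarrow> 0 \<le> nev_T r f"
  by (simp add: nev_T_def nev_N_nonneg nev_m_nonneg)

text \<open>\<open>M\<close> points of the divisor contribute at least \<open>M * (ln r / 2)\<close>
  to the counting functions of zeros and poles once \<open>r\<close> exceeds the squares of their
  moduli, while these counting functions sum to at most \<open>2 * C * ln r + B\<close>.\<close>

lemma finite_divisor_if_log_growth:
  assumes f: "nonzero_meromorphic f"
    and freq: "\<And>r0. \<exists>r\<ge>r0. regular_on_circle f r \<and> nev_T r f \<le> C * ln r" and C: "0 \<le> C"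
  shows "finite {p. zorder f p \<noteq> 0}"
proof (rule ccontr)
  assume inf: "infinite {p. zorder f p \<noteq> 0}"
  define B where "B = \<bar>ln (norm (zor_poly f 0 0))\<bar>"
  obtain M :: nat where M: "real M > 4 * C + 2 * B" using reals_Archimedean2 by blast
  obtain U where U: "finite U" "card U = M" "U \<subseteq> {p. zorder f p \<noteq> 0}"
    using infinite_arbitrarily_large[OF inf] by metis
  define D where "D = (\<lambda>p. zer f p + pol f p)"
  have D0: "0 \<le> D p" for p by (simp add: D_def)
  have D: "D p \<noteq> 0 \<longleftrightarrow> zorder f p \<noteq> 0" for p by (auto simp: D_def zer_def pol_def)
  have D1: "1 \<le> D p" if "p \<in> U" for p using U(3) that by (auto simp: D_def zer_def pol_def)
  obtain b where b: "\<And>p. p \<in> U \<Longrightarrow> norm p \<le> b" "1 \<le> b"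
    using finite_imp_bounded[OF U(1)] by (auto simp: bounded_iff) (meson linear order.trans)
  \<comment> \<open>\<open>b\<^sup>2\<close> gives every point the weight \<open>ln r / 2\<close>,
    and \<open>exp 1\<close> gives \<open>1 \<le> ln r\<close>, so that the constant
    \<open>B\<close> is absorbed by \<open>B * ln r\<close>.\<close>
  obtain r where r: "r \<ge> max (b\<^sup>2) (exp 1)" "regular_on_circle f r" "nev_T r f \<le> C * ln r" using freq by blast
  have r1: "1 \<le> r" "0 < r" "b \<le> r" "1 \<le> ln r"
  proof -
    show "1 \<le> r" using r(1) exp_ge_add_one_self[of 1] by linarith
    thus "0 < r" by simp
    have "b * 1 \<le> b * b" using b by (intro mult_left_mono) auto
    thus "b \<le> r" using r(1) by (simp add: power2_eq_square)
    show "1 \<le> ln r" using r(1) \<open>0 < r\<close> by (subst ln_ge_iff) auto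
  qed
  have "ln (b\<^sup>2) \<le> ln r" using r b r1 by (subst ln_le_cancel_iff) auto
  hence lb: "ln b \<le> ln r / 2" using b by (simp add: ln_realpow)
  have w: "ln r / 2 \<le> ln r - ln (norm p)" if "p \<in> U" for p
  proof (cases "p = 0")
    case False
    hence "ln (norm p) \<le> ln b" using b that by simp
    thus ?thesis using lb by simp
  qed (use r1 in simp)
  have "real M * (ln r / 2) = (\<Sum>p\<in>U. 1 * (ln r / 2))" using U by simp
  also have "\<dots> \<le> (\<Sum>p\<in>U. D p * (ln r - ln (norm p)))"
    by (intro sum_mono mult_mono D1 w D0) (use r1 in auto)
  also have "\<dots> \<le> counting D r" unfolding counting_def
  proof (rule sum_mono2)
    show "finite {p. norm p \<le> r \<and> D p \<noteq> 0}" using finite_zorder_support[OF f] by (simp add: D)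
    show "U \<subseteq> {p. norm p \<le> r \<and> D p \<noteq> 0}" using U(3) b r1 D by (auto intro: order_trans)
  qed (use r1 D0 counting_weight_nonneg in auto)
  also have "\<dots> = nev_N r f + nev_N r (\<lambda>z. 1 / f z)"
    using r1 by (simp add: D_def counting_add finite_zer finite_pol f nev_N_eq_counting nonzero_meromorphic_inverse pol_inverse)
  also have "\<dots> \<le> nev_T r f + nev_T r (\<lambda>z. 1 / f z)" using r1 by (intro add_mono nev_T_ge_N) auto
  also have "\<dots> \<le> 2 * C * ln r + B" unfolding nev_T_inverse[OF f r(2)] B_def using r(3) by simp
  also have "\<dots> \<le> 2 * C * ln r + B * ln r" using r1 by (simp add: B_def mult_le_cancel_left1)
  finally have "real M * ln r \<le> (4 * C + 2 * B) * ln r" by (simp add: algebra_simps)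
  hence "real M \<le> 4 * C + 2 * B" by (rule mult_right_le_imp_le) (use r1(4) in linarith)
  thus False using M by simp
qed

lemma transcendental_nonzero:
  assumes "transcendental_meromorphic f"
  shows "nonzero_meromorphic f"
proof -
  have "\<not> (\<forall>\<^sub>\<approx>z. f z = 0)"
  proof
    assume "\<forall>\<^sub>\<approx>z. f z = 0"
    hence "\<forall>\<^sub>\<approx>z. f z = poly 0 z / poly 1 z" by simp
    thus False using assms unfolding transcendental_meromorphic_def by (metis zero_neq_one)
  qed
  thus ?thesis using meromorphic_zero_or_nonzero assms by (auto simp: transcendental_meromorphic_def)
qed

text \<open>A Liouville argument: the kernel \<open>PK 0 w\<close> equals 1, so the increment bound
  at the origin reads \<open>4 * norm z / r\<close> times a mean of logarithmic size, and this tends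
  to 0.\<close>

lemma entire_constant_if_log_growth:
  assumes h: "h holomorphic_on UNIV"
    and freq: "\<And>r0. \<exists>r\<ge>r0. cmean r (\<lambda>w. \<bar>Re (h w)\<bar>) \<le> A * ln r + B"
  shows "h z = h 0"
proof (rule ccontr)
  assume ne: "h z \<noteq> h 0"
  have "((\<lambda>r. 4 * norm z / r * (A * ln r + B)) \<longlongrightarrow> 0) at_top"
  proof -
    have 1: "((\<lambda>r. ln r / r) \<longlongrightarrow> 0) (at_top :: real filter)" by (rule ln_x_over_x_tendsto_0)
    have 2: "((\<lambda>r::real. 1 / r) \<longlongrightarrow> 0) at_top"
      using tendsto_inverse_0_at_top[OF filterlim_ident] by (simp add: field_simps)
    have "((\<lambda>r. 4 * norm z * (A * (ln r / r) + B * (1 / r))) \<longlongrightarrow> 4 * norm z * (A * 0 + B * 0)) at_top"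
      by (intro tendsto_intros 1 2)
    thus ?thesis by (simp add: field_simps add_divide_distrib)
  qed
  hence "eventually (\<lambda>r. 4 * norm z / r * (A * ln r + B) < norm (h z - h 0)) at_top"
    by (rule order_tendstoD) (use ne in auto)
  then obtain r0 where r0: "\<And>r. r \<ge> r0 \<Longrightarrow> 4 * norm z / r * (A * ln r + B) < norm (h z - h 0)"
    by (auto simp: eventually_at_top_linorder)
  obtain r where r: "r \<ge> max r0 (2 * norm z + 1)" "cmean r (\<lambda>w. \<bar>Re (h w)\<bar>) \<le> A * ln r + B"
    using freq by blast
  have rpos: "r > 0" using r(1) norm_ge_zero[of z] by linarith
  have "norm (h z - h 0) \<le> 4 * norm (z - 0) / (r - norm (0::complex)) * cmean r (\<lambda>w. \<bar>Re (h w)\<bar> * PK 0 w)"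
    by (rule holomorphic_increment_bound) (use r rpos holomorphic_on_subset[OF h] in auto)
  also have "cmean r (\<lambda>w. \<bar>Re (h w)\<bar> * PK 0 w) = cmean r (\<lambda>w. \<bar>Re (h w)\<bar>)"
    by (rule cmean_cong) (use rpos in \<open>auto simp: PK_def\<close>)
  also have "4 * norm (z - 0) / (r - norm (0::complex)) * \<dots> \<le> 4 * norm z / r * (A * ln r + B)"
    using mult_left_mono[OF r(2), of "4 * norm z / r"] rpos by simp
  also have "\<dots> < norm (h z - h 0)" using r0[of r] r(1) by simp
  finally show False by simp
qed

lemma powi_eq_power_divide: "(x::complex) powi n = x ^ nat n / x ^ nat (- n)"
  by (cases "n \<ge> 0") (auto simp: power_int_def inverse_eq_divide power_one_over)

text \<open>The divisor is finite, so \<open>f\<close> is \<open>exp h\<close> times finitely many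
  powers of linear factors. On large circles these change \<open>ln (norm (f z))\<close> by only
  O(ln r), hence the mean of the absolute value of \<open>Re h\<close> is logarithmic and
  \<open>h\<close> is constant.\<close>

lemma rational_if_log_growth:
  assumes f: "nonzero_meromorphic f"
    and freq: "\<And>r0. \<exists>r\<ge>r0. regular_on_circle f r \<and> nev_T r f \<le> C * ln r" and C: "0 \<le> C"
  shows "\<exists>p q. q \<noteq> 0 \<and> (\<forall>\<^sub>\<approx>z. f z = poly p z / poly q z)"
proof -
  define Z where "Z = {p. zorder f p \<noteq> 0}"
  have finZ: "finite Z" unfolding Z_def by (rule finite_divisor_if_log_growth[OF assms])
  obtain h where h: "h holomorphic_on UNIV"
    "\<And>z. f analytic_on {z} \<Longrightarrow> (\<And>p. p \<in> Z \<Longrightarrow> (\<lambda>z. z - p) analytic_on {z} \<and> z - p \<noteq> 0)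
      \<Longrightarrow> f z = exp (h z) * (\<Prod>p\<in>Z. (z - p) powi zorder f p)"
  proof (rule factorization_on_contractible[OF f, of UNIV Z "\<lambda>p z. z - p"])
    show "nonzero_meromorphic (\<lambda>z. z - p)" for p
      using nonzero_meromorphic_linear[of "- p" 1] by simp
    show "zorder (\<lambda>z. z - p) p = 1" for p :: complex
      by (rule zorder_eqI[of UNIV p "\<lambda>_. 1"]) auto
    show "zorder (\<lambda>z. z - p) q = 0" if "q \<noteq> p" for p q :: complex
      by (rule zorder_eq_0_analytic) (use that in \<open>auto intro!: analytic_intros\<close>)
  qed (use finZ in \<open>auto simp: Z_def contractible_UNIV\<close>)
  have hz: "f z = exp (h z) * (\<Prod>p\<in>Z. (z - p) powi zorder f p)" if "f analytic_on {z}" "f z \<noteq> 0" for z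
    by (rule h(2)) (use that zorder_eq_0_analytic[OF that] in \<open>auto simp: Z_def intro!: analytic_intros\<close>)
  obtain b where b: "\<And>p. p \<in> Z \<Longrightarrow> norm p \<le> b" "0 \<le> b"
    using finite_imp_bounded[OF finZ] by (auto simp: bounded_iff) (meson linear order.trans)
  define M where "M = (\<Sum>p\<in>Z. \<bar>of_int (zorder f p)\<bar> :: real)"
  define B where "B = \<bar>ln (norm (zor_poly f 0 0))\<bar>"
  have M0: "0 \<le> M" by (simp add: M_def sum_nonneg)
  have "\<exists>r\<ge>r0. cmean r (\<lambda>w. \<bar>Re (h w)\<bar>) \<le> (2 * C + M) * ln r + (B + M * ln 2)" for r0
  proof -
    obtain r where r: "r \<ge> max r0 (b + 1)" "regular_on_circle f r" "nev_T r f \<le> C * ln r" using freq by blast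
    note rc = regular_on_circleD[OF r(2)]
    have r1: "1 \<le> r" "b + 1 \<le> r" using r b by auto
    have bd: "\<bar>Re (h z)\<bar> \<le> \<bar>ln (norm (f z))\<bar> + M * (ln r + ln 2)" if z: "norm z = r" for z
    proof -
      have zp: "1 \<le> norm (z - p)" "norm (z - p) \<le> 2 * r" if "p \<in> Z" for p
        using norm_triangle_ineq2[of z p] norm_triangle_ineq4[of z p] b(1)[OF that] z r1 by auto
      have zp0: "z \<noteq> p" if "p \<in> Z" for p using zp[OF that] by auto
      have "norm (f z) = exp (Re (h z)) * (\<Prod>p\<in>Z. norm (z - p) powi zorder f p)"
        by (subst hz) (use rc z in \<open>auto simp: norm_mult norm_power_int simp flip: prod_norm\<close>)
      hence "ln (norm (f z)) = Re (h z) + (\<Sum>p\<in>Z. of_int (zorder f p) * ln (norm (z - p)))"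
        using zp0 finZ by (simp add: ln_mult ln_prod ln_powi)
      moreover have "\<bar>\<Sum>p\<in>Z. of_int (zorder f p) * ln (norm (z - p))\<bar> \<le> (\<Sum>p\<in>Z. \<bar>of_int (zorder f p)\<bar> * (ln r + ln 2))"
      proof (rule order_trans[OF sum_abs], rule sum_mono)
        fix p assume p: "p \<in> Z"
        have "ln (norm (z - p)) \<le> ln (2 * r)" using zp[OF p] zp0[OF p] r1 by (subst ln_le_cancel_iff) auto
        moreover have "0 \<le> ln (norm (z - p))" using zp[OF p] by simp
        ultimately show "\<bar>of_int (zorder f p) * ln (norm (z - p))\<bar> \<le> \<bar>of_int (zorder f p)\<bar> * (ln r + ln 2)"
          unfolding abs_mult using r1 by (intro mult_left_mono) (auto simp: ln_mult)
      qed
      moreover have "(\<Sum>p\<in>Z. \<bar>of_int (zorder f p)\<bar> * (ln r + ln 2)) = M * (ln r + ln 2)"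
        by (simp add: M_def sum_distrib_right)
      ultimately show ?thesis by linarith
    qed
    have ch: "continuous_on (sphere 0 r) h"
      by (rule continuous_on_subset[OF holomorphic_on_imp_continuous_on[OF h(1)]]) auto
    have "cmean r (\<lambda>w. \<bar>Re (h w)\<bar>) \<le> cmean r (\<lambda>z. \<bar>ln (norm (f z))\<bar> + M * (ln r + ln 2))"
      by (rule cmean_mono) (use rc bd ch in \<open>auto intro!: continuous_on_rabs continuous_on_ln_norm r continuous_on_add continuous_on_const continuous_on_Re\<close>)
    also have "\<dots> = cmean r (\<lambda>z. \<bar>ln (norm (f z))\<bar>) + M * (ln r + ln 2)"
      by (subst cmean_add) (use rc in \<open>auto intro!: continuous_on_rabs continuous_on_ln_norm r\<close>)
    also have "cmean r (\<lambda>z. \<bar>ln (norm (f z))\<bar>) = nev_m r f + nev_m r (\<lambda>z. 1 / f z)"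
      by (rule nev_m_sum_eq[OF r(2), symmetric])
    also have "\<dots> \<le> nev_T r f + nev_T r (\<lambda>z. 1 / f z)"
      using r1 by (intro add_mono nev_T_ge_m f nonzero_meromorphic_inverse) auto
    also have "\<dots> \<le> 2 * (C * ln r) + B" unfolding nev_T_inverse[OF f r(2)] B_def using r(3) by simp
    finally show ?thesis using r(1) by (intro exI[of _ r]) (auto simp: algebra_simps)
  qed
  hence hc: "h z = h 0" for z by (rule entire_constant_if_log_growth[OF h(1)])
  define P where "P = smult (exp (h 0)) (\<Prod>p\<in>Z. [:- p, 1:] ^ nat (zorder f p))"
  define Q where "Q = (\<Prod>p\<in>Z. [:- p, 1:] ^ nat (- zorder f p))"
  have "Q \<noteq> 0" using finZ by (simp add: Q_def)
  moreover have "\<forall>\<^sub>\<approx>z. f z = poly P z / poly Q z"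
    using regular_cosparse[OF f]
  proof eventually_elim
    case (elim z)
    have "f z = exp (h 0) * (\<Prod>p\<in>Z. (z - p) powi zorder f p)" using hz[of z] hc[of z] elim by simp
    also have "(\<Prod>p\<in>Z. (z - p) powi zorder f p)
        = (\<Prod>p\<in>Z. (z - p) ^ nat (zorder f p)) / (\<Prod>p\<in>Z. (z - p) ^ nat (- zorder f p))"
      by (simp add: powi_eq_power_divide prod_dividef)
    finally show ?case by (simp add: P_def Q_def poly_prod)
  qed
  ultimately show ?thesis by blast
qed

text \<open>\<open>rational_if_log_growth\<close> asks for slow growth only along an unbounded set
  of regular radii. Its contrapositive is therefore a lower bound at all large regular
  radii.\<close>

lemma transcendental_growth:
  assumes "transcendental_meromorphic f"
  shows "\<exists>r0. \<forall>r\<ge>r0. regular_on_circle f r \<longrightarrow> C * ln r \<le> nev_T r f"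
proof (rule ccontr)
  assume "\<not> ?thesis"
  hence *: "\<exists>r\<ge>r0. regular_on_circle f r \<and> nev_T r f \<le> C * ln r" for r0 by (meson linear)
  \<comment> \<open>\<open>C\<close> may be negative, whereas \<open>rational_if_log_growth\<close>
    takes a nonnegative constant.\<close>
  have "\<exists>r\<ge>r0. regular_on_circle f r \<and> nev_T r f \<le> max C 0 * ln r" for r0
  proof -
    obtain r where r: "r \<ge> max r0 1" "regular_on_circle f r" "nev_T r f \<le> C * ln r" using * by blast
    have "C * ln r \<le> max C 0 * ln r" using r(1) by (intro mult_right_mono) auto
    thus ?thesis using r by (intro exI[of _ r]) auto
  qed
  from rational_if_log_growth[OF transcendental_nonzero[OF assms] this]
  show False using assms by (auto simp: transcendental_meromorphic_def)
qed

text \<open>Hyper-order below some \<open>\<sigma> < 1\<close> means that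
  \<open>ln (nev_T r f)\<close> is eventually below \<open>r powr \<sigma>\<close>, which is
  o(r).\<close>

lemma hyper_order_less_1_growth:
  assumes "hyper_order f < 1" "0 < \<delta>"
  shows "eventually (\<lambda>r. nev_T r f \<le> exp (\<delta> * r)) at_top"
proof -
  obtain \<sigma> where \<sigma>: "hyper_order f < ereal \<sigma>" "\<sigma> < 1"
    using ereal_dense2[OF assms(1)] by (auto simp: one_ereal_def)
  have "eventually (\<lambda>r. ereal (ln (ln (nev_T r f)) / ln r) < ereal \<sigma>) at_top"
    using \<sigma>(1) unfolding hyper_order_def by (rule Limsup_lessD)
  moreover have "eventually (\<lambda>r. r powr \<sigma> < \<delta> * r) at_top"
  proof -
    have "((\<lambda>r. r powr (\<sigma> - 1)) \<longlongrightarrow> 0) at_top"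
      using tendsto_neg_powr[of "\<sigma> - 1" "\<lambda>r. r" at_top] \<sigma>(2) filterlim_ident by auto
    hence "eventually (\<lambda>r. r powr (\<sigma> - 1) < \<delta>) at_top" by (rule order_tendstoD) fact
    thus ?thesis using eventually_gt_at_top[of 0]
      by eventually_elim (simp add: powr_diff field_simps)
  qed
  ultimately show ?thesis using eventually_gt_at_top[of 1]
  proof eventually_elim
    case (elim r)
    show ?case
    proof (cases "nev_T r f \<le> 1")
      \<comment> \<open>The iterated logarithm carries no information when the characteristic is at
        most 1, but then the bound is trivial.\<close>
      case True
      thus ?thesis using assms(2) elim by (auto intro: order_trans[of _ 1])
    next
      case False
      hence T: "0 < ln (nev_T r f)" by simp
      have "ln (ln (nev_T r f)) < \<sigma> * ln r" using elim by (simp add: divide_less_eq)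
      hence "ln (nev_T r f) < exp (\<sigma> * ln r)" using T by (metis exp_less_cancel_iff exp_ln)
      also have "\<dots> = r powr \<sigma>" using elim by (simp add: powr_def)
      also have "\<dots> < \<delta> * r" using elim by simp
      finally show ?thesis using False by (metis exp_less_cancel_iff exp_ln less_eq_real_def less_trans not_le zero_less_one)
    qed
  qed
qed

text \<open>If \<open>T\<close> more than doubled over every admissible step of length
  \<open>n\<close>, it would grow at least like \<open>2 ^ j\<close> along an arithmetic progression
  of step \<open>n\<close>, against the assumed subexponential growth.\<close>

lemma slow_growth_radius:
  fixes T :: "real \<Rightarrow> real"
  assumes B: "countable B" and pos: "\<And>r. r \<ge> r0 \<Longrightarrow> r \<notin> B \<Longrightarrow> 0 < T r"
    and growth: "\<And>\<delta>. 0 < \<delta> \<Longrightarrow> eventually (\<lambda>r. T r \<le> C * exp (\<delta> * r)) at_top" and n: "0 < n"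
  shows "\<exists>r\<ge>r0. r \<notin> B \<and> r + n \<notin> B \<and> T (r + n) \<le> 2 * T r"
proof (rule ccontr)
  assume "\<not> ?thesis"
  hence neg: "2 * T r < T (r + n)" if "r \<ge> r0" "r \<notin> B" "r + n \<notin> B" for r
    using that by force
  \<comment> \<open>The start of the progression is chosen outside countably many translates of
    \<open>B\<close>, so that all its members avoid \<open>B\<close>.\<close>
  have "countable (\<Union>j::nat. (\<lambda>x. x - real j * n) ` B)" using B by auto
  moreover have "uncountable {r0<..<r0+1}" by (rule uncountable_open_interval[THEN iffD2]) simp
  ultimately obtain x where x: "x \<in> {r0<..<r0+1}" "x \<notin> (\<Union>j::nat. (\<lambda>x. x - real j * n) ` B)"
    by (meson countable_subset subsetI)
  have xB: "x + real j * n \<notin> B" for j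
  proof
    assume "x + real j * n \<in> B"
    hence "(x + real j * n) - real j * n \<in> (\<lambda>x. x - real j * n) ` B" by blast
    thus False using x(2) by auto
  qed
  have T0: "0 < T x" using pos[of x] x xB[of 0] by simp
  have grow: "2 ^ j * T x \<le> T (x + real j * n)" for j
  proof (induction j)
    case (Suc j)
    have "r0 \<le> x + real j * n" using x n by (auto intro: add_increasing2)
    from neg[OF this] have "2 * T (x + real j * n) < T (x + real j * n + n)"
      using xB[of j] xB[of "Suc j"] by (simp add: algebra_simps)
    thus ?case using Suc.IH by (simp add: algebra_simps)
  qed simp
  \<comment> \<open>Chosen so that one step multiplies \<open>exp (\<delta> * r)\<close> by
    \<open>3/2\<close>. Any number strictly between 1 and 2 would do; the surplus ratio is
    \<open>4/3\<close>.\<close>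
  define \<delta> where "\<delta> = ln (3/2) / n"
  have \<delta>: "0 < \<delta>" using n by (simp add: \<delta>_def)
  have ej: "exp (\<delta> * (x + real j * n)) = exp (\<delta> * x) * (3/2) ^ j" for j
  proof -
    have "exp (\<delta> * (x + real j * n)) = exp (\<delta> * x) * exp (real j * ln (3/2))"
      using n by (simp add: \<delta>_def field_simps flip: exp_add)
    also have "exp (real j * ln (3/2)) = (3/2) ^ j" by (subst exp_of_nat_mult) simp
    finally show ?thesis .
  qed
  obtain r1 where r1: "\<And>r. r \<ge> r1 \<Longrightarrow> T r \<le> C * exp (\<delta> * r)"
    using growth[OF \<delta>] by (auto simp: eventually_at_top_linorder)
  obtain j1 :: nat where j1: "real j1 > (r1 - x) / n" using reals_Archimedean2 by blast
  obtain j2 where j2: "C * exp (\<delta> * x) / T x < (4/3) ^ j2" using real_arch_pow[of "4/3"] by auto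
  define j where "j = max j1 j2"
  have "real j1 * n \<le> real j * n" using n by (intro mult_right_mono) (auto simp: j_def)
  moreover have "r1 - x < real j1 * n" using j1 n by (simp add: divide_less_eq)
  ultimately have "r1 \<le> x + real j * n" by linarith
  from r1[OF this] have "T (x + real j * n) \<le> C * exp (\<delta> * x) * (3/2) ^ j" by (simp add: ej mult.assoc)
  with grow[of j] have "2 ^ j * T x \<le> C * exp (\<delta> * x) * (3/2) ^ j" by linarith
  moreover have "(2::real) ^ j = (4/3) ^ j * (3/2) ^ j" by (simp flip: power_mult_distrib)
  ultimately have "((4/3) ^ j * T x) * (3/2) ^ j \<le> (C * exp (\<delta> * x)) * (3/2) ^ j" by (simp add: mult_ac)
  hence "(4/3) ^ j * T x \<le> C * exp (\<delta> * x)" by (rule mult_right_le_imp_le) simp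
  hence "(4/3) ^ j \<le> C * exp (\<delta> * x) / T x" using T0 by (simp add: le_divide_eq)
  moreover have "(4/3 :: real) ^ j2 \<le> (4/3) ^ j" by (rule power_increasing) (auto simp: j_def)
  ultimately show False using j2 by linarith
qed

subsection \<open>Radii of slow growth\<close>

lemma nev_m_mult:
  assumes "regular_on_circle f r" "regular_on_circle g r"
  shows "nev_m r (\<lambda>z. f z * g z) \<le> nev_m r f + nev_m r g"
proof -
  note f = regular_on_circleD[OF assms(1)] and g = regular_on_circleD[OF assms(2)]
  have "nev_m r (\<lambda>z. f z * g z) \<le> cmean r (\<lambda>z. log_plus (norm (f z)) + log_plus (norm (g z)))"
    unfolding nev_m_eq_cmean
  proof (rule cmean_mono)
    fix z :: complex assume z: "norm z = r"
    have "ln (norm (f z * g z)) = ln (norm (f z)) + ln (norm (g z))"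
      using f(3)[OF z] g(3)[OF z] by (simp add: norm_mult ln_mult)
    thus "log_plus (norm (f z * g z)) \<le> log_plus (norm (f z)) + log_plus (norm (g z))"
      by (intro log_plus_leI add_nonneg_nonneg) (auto intro: add_mono ln_le_log_plus)
  qed (use f g in \<open>auto intro!: continuous_on_log_plus_norm continuous_intros\<close>)
  also have "\<dots> = nev_m r f + nev_m r g" unfolding nev_m_eq_cmean
    by (rule cmean_add) (use f g in \<open>auto intro!: continuous_on_log_plus_norm\<close>)
  finally show ?thesis .
qed

lemma nev_m_diff:
  assumes "regular_on_circle f r" "regular_on_circle g r"
  shows "nev_m r (\<lambda>z. f z - g z) \<le> nev_m r f + nev_m r g + ln 2"
proof -
  note f = regular_on_circleD[OF assms(1)] and g = regular_on_circleD[OF assms(2)]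
  have "nev_m r (\<lambda>z. f z - g z) \<le> cmean r (\<lambda>z. log_plus (norm (f z)) + log_plus (norm (g z)) + ln 2)"
    unfolding nev_m_eq_cmean
  proof (rule cmean_mono)
    fix z :: complex assume z: "norm z = r"
    define x y where "x = max 1 (norm (f z))" and "y = max 1 (norm (g z))"
    have xy: "1 \<le> x" "1 \<le> y" by (auto simp: x_def y_def)
    have "norm (f z - g z) \<le> norm (f z) + norm (g z)" by (rule norm_triangle_ineq4)
    also have "\<dots> \<le> x + y" by (auto simp: x_def y_def)
    also have "\<dots> \<le> x * y * 2"
    proof -
      have "1 * y \<le> x * y" "x * 1 \<le> x * y" using xy by (intro mult_right_mono mult_left_mono; simp)+
      thus ?thesis by simp
    qed
    finally have le: "norm (f z - g z) \<le> x * y * 2" .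
    have "1 * 1 \<le> x * y" using xy by (intro mult_mono) auto
    hence "max 1 (norm (f z - g z)) \<le> x * y * 2" using le by simp
    hence "log_plus (norm (f z - g z)) \<le> ln (x * y * 2)"
      by (simp add: log_plus_eq_ln_max)
    also have "\<dots> = ln x + ln y + ln 2" using xy by (simp add: ln_mult)
    finally show "log_plus (norm (f z - g z)) \<le> log_plus (norm (f z)) + log_plus (norm (g z)) + ln 2"
      by (simp add: log_plus_eq_ln_max x_def y_def)
  qed (use f g in \<open>auto intro!: continuous_on_log_plus_norm continuous_intros\<close>)
  also have "\<dots> = nev_m r f + nev_m r g + ln 2" unfolding nev_m_eq_cmean
    by (subst cmean_add, (use f g in \<open>auto intro!: continuous_on_log_plus_norm continuous_intros\<close>)[3],
        subst cmean_add) (use f g in \<open>auto intro!: continuous_on_log_plus_norm\<close>)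
  finally show ?thesis .
qed

lemma nev_N_le_if_pol_le:
  assumes f: "nonzero_meromorphic f" and g: "nonzero_meromorphic g" and h: "nonzero_meromorphic h" and r: "1 \<le> r"
    and le: "\<And>p. pol h p \<le> pol f p + pol g p"
  shows "nev_N r h \<le> nev_N r f + nev_N r g"
proof -
  have "finite {p. norm p \<le> r \<and> pol f p + pol g p \<noteq> 0}"
    by (rule finite_subset[OF _ finite_UnI[OF finite_pol[OF f, of r] finite_pol[OF g, of r]]]) auto
  hence "counting (pol h) r \<le> counting (\<lambda>p. pol f p + pol g p) r"
    by (rule counting_le) (use le r in auto)
  thus ?thesis using r by (simp add: nev_N_eq_counting f g h counting_add finite_pol)
qed

lemma pol_mult:
  assumes "nonzero_meromorphic f" "nonzero_meromorphic g"
  shows "pol (\<lambda>z. f z * g z) p \<le> pol f p + pol g p"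
proof -
  have "zorder (\<lambda>z. f z * g z) p = zorder f p + zorder g p"
    by (intro zorder_mult nonzero_meromorphicD assms)
  thus ?thesis by (simp add: pol_def)
qed

lemma pol_diff:
  assumes "nonzero_meromorphic f" "nonzero_meromorphic g" "nonzero_meromorphic (\<lambda>z. f z - g z)"
  shows "pol (\<lambda>z. f z - g z) p \<le> pol f p + pol g p"
proof -
  have fr: "frequently (\<lambda>z. f z \<noteq> g z) (at p)" using nonzero_meromorphicD(3)[OF assms(3), of p] by simp
  have "zorder (\<lambda>z. f z - g z) p \<ge> min (zorder f p) (zorder g p)"
    by (rule zorder_diff_ge) (use fr nonzero_meromorphicD[OF assms(1)] nonzero_meromorphicD[OF assms(2)] in auto)
  thus ?thesis by (auto simp: pol_def)
qed

text \<open>At a zero or pole of \<open>f\<close> the quotient has a simple pole, and 1 is at most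
  the multiplicity of \<open>f\<close> there. At a point of order zero neither \<open>f\<close> nor
  its derivative has a pole.\<close>

lemma pol_logderiv:
  assumes f: "nonzero_meromorphic f" and d: "nonzero_meromorphic (deriv f)"
  shows "pol (\<lambda>z. deriv f z / f z) p \<le> pol f p + pol (\<lambda>z. 1 / f z) p"
proof -
  have q: "zorder (\<lambda>z. deriv f z / f z) p = zorder (deriv f) p - zorder f p"
    by (intro zorder_divide nonzero_meromorphicD f d)
  show ?thesis
  proof (cases "zorder f p = 0")
    case True
    hence "\<not> is_pole f p" by (simp add: is_pole_iff_zorder[OF f])
    hence "\<not> is_pole (deriv f) p" using is_pole_deriv_iff[of f p] nonzero_meromorphicD(1)[OF f] by auto
    thus ?thesis using True q by (simp add: is_pole_iff_zorder[OF d] pol_def)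
  next
    case False
    have "zorder (deriv f) p = zorder f p - 1"
      by (rule zorder_deriv_minus_1) (use False nonzero_meromorphicD[OF f] in auto)
    hence "pol (\<lambda>z. deriv f z / f z) p = 1" using q by (simp add: pol_def)
    thus ?thesis using False f by (auto simp: pol_inverse) (auto simp: pol_def zer_def)
  qed
qed

text \<open>The complement of a sparse set in the plane is open and connected, so a vanishing
  derivative there forces a single constant.\<close>

lemma meromorphic_deriv_zero:
  assumes f: "f meromorphic_on UNIV" and d: "\<forall>\<^sub>\<approx>z. deriv f z = 0"
  shows "\<exists>c. \<forall>\<^sub>\<approx>z. f z = c"
proof -
  define B where "B = {z. \<not> (f analytic_on {z} \<and> deriv f z = 0)}"
  have "\<forall>\<^sub>\<approx>z. f analytic_on {z} \<and> deriv f z = 0"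
    by (intro eventually_conj meromorphic_on_imp_analytic_cosparse f d)
  hence B: "B sparse_in UNIV" by (simp only: eventually_cosparse B_def)
  have "connected (UNIV - B)" by (rule sparse_imp_connected) (use B in auto)
  moreover have "open (UNIV - B)" by (rule open_diff_sparse_pts) (use B in auto)
  moreover have "(f has_field_derivative 0) (at z)" if "z \<in> UNIV - B" for z
  proof -
    have "f field_differentiable at z" "deriv f z = 0"
      using that by (auto simp: B_def intro: analytic_on_imp_differentiable_at)
    thus ?thesis using DERIV_deriv_iff_field_differentiable by metis
  qed
  ultimately have "f constant_on (UNIV - B)"
    by (intro has_field_derivative_0_imp_constant_on)
  then obtain c where "\<And>z. z \<in> UNIV - B \<Longrightarrow> f z = c" by (auto simp: constant_on_def)
  hence "\<forall>\<^sub>\<approx>z. f z = c" using eventually_not_in_cosparse[OF B] by (auto elim!: eventually_mono)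
  thus ?thesis by blast
qed

text \<open>Bounded changes of the radius and countably many exceptional radii near each \<open>\<rho> n\<close> are
  invisible to this filter, so a radius may always be enlarged by a constant and moved off the
  zeros and poles.\<close>

definition near_filter :: "(nat \<Rightarrow> real) \<Rightarrow> real filter" where
  "near_filter \<rho> = Abs_filter (\<lambda>P. \<forall>K. \<forall>\<^sub>F n in sequentially. countable {t \<in> {\<rho> n..\<rho> n + K}. \<not> P t})"

lemma eventually_near_filter:
  "eventually P (near_filter \<rho>) \<longleftrightarrow> (\<forall>K. \<forall>\<^sub>F n in sequentially. countable {t \<in> {\<rho> n..\<rho> n + K}. \<not> P t})"
  unfolding near_filter_def
proof (rule eventually_Abs_filter, standard, goal_cases)
  case (2 P Q)
  show ?case
  proof
    fix K
    from 2(1)[rule_format, of K] 2(2)[rule_format, of K]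
    show "\<forall>\<^sub>F n in sequentially. countable {t \<in> {\<rho> n..\<rho> n + K}. \<not> (P t \<and> Q t)}"
    proof eventually_elim
      case (elim n)
      show ?case by (rule countable_subset[OF _ countable_Un[OF elim]]) auto
    qed
  qed
next
  case (3 P Q)
  show ?case
  proof
    fix K
    from 3(2)[rule_format, of K]
    show "\<forall>\<^sub>F n in sequentially. countable {t \<in> {\<rho> n..\<rho> n + K}. \<not> Q t}"
    proof eventually_elim
      case (elim n)
      show ?case by (rule countable_subset[OF _ elim]) (use 3(1) in auto)
    qed
  qed
qed auto

lemma near_filter_countable:
  assumes "countable B" "eventually (\<lambda>t. t \<notin> B \<longrightarrow> P t) (near_filter \<rho>)"
  shows "eventually P (near_filter \<rho>)"
proof -
  have "eventually (\<lambda>t. t \<notin> B) (near_filter \<rho>)" unfolding eventually_near_filter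
    by (intro allI always_eventually countable_subset[OF _ assms(1)]) auto
  thus ?thesis using assms(2) by eventually_elim simp
qed

text \<open>The window after \<open>\<rho> n\<close> has length \<open>n\<close>, so a single
  sequence serves every constant \<open>K\<close>. In the application \<open>B\<close> consists of
  the radii of circles that are not regular for \<open>f\<close> or \<open>g\<close>, and the
  monotonicity and the lower bound for \<open>T\<close> are available only off
  \<open>B\<close>.\<close>

locale slow_radii =
  fixes T :: "real \<Rightarrow> real" and B :: "real set" and \<rho> :: "nat \<Rightarrow> real"
  assumes countable_B: "countable B"
    and T_mono: "\<And>r s. 1 \<le> r \<Longrightarrow> r \<le> s \<Longrightarrow> r \<notin> B \<Longrightarrow> s \<notin> B \<Longrightarrow> T r \<le> T s"
    and T_log: "\<And>C. \<exists>r0. \<forall>r\<ge>r0. r \<notin> B \<longrightarrow> C * ln r \<le> T r"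
    and \<rho>: "\<And>n. real n \<le> \<rho> n" "\<And>n. \<rho> n \<notin> B" "\<And>n. \<rho> n + real n \<notin> B" "\<And>n. T (\<rho> n + real n) \<le> 2 * T (\<rho> n)"
begin

abbreviation \<F> :: "real filter" where "\<F> \<equiv> near_filter \<rho>"

section \<open>Asymptotics along the slow radii\<close>

lemma \<rho>_ge: "\<forall>\<^sub>F n in sequentially. K \<le> \<rho> n"
proof -
  have "\<forall>\<^sub>F n in sequentially. K \<le> real n" using filterlim_real_sequentially by (simp add: filterlim_at_top)
  thus ?thesis by eventually_elim (use \<rho>(1) in \<open>auto intro: order_trans\<close>)
qed

lemma eventually_\<F>_ge: "\<forall>\<^sub>F t in \<F>. K \<le> t"
  unfolding eventually_near_filter
proof
  fix L show "\<forall>\<^sub>F n in sequentially. countable {t \<in> {\<rho> n..\<rho> n + L}. \<not> K \<le> t}"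
    using \<rho>_ge[of K]
  proof eventually_elim
    case (elim n)
    hence "{t \<in> {\<rho> n..\<rho> n + L}. \<not> K \<le> t} = {}" by auto
    thus ?case by (simp only: countable_empty)
  qed
qed

lemma \<F>_le_at_top: "\<F> \<le> at_top"
  using eventually_\<F>_ge by (simp add: le_filter_def eventually_at_top_linorder) (metis (mono_tags, lifting) eventually_mono)

lemma eventually_\<F>_not_in: "countable A \<Longrightarrow> \<forall>\<^sub>F t in \<F>. t \<notin> A"
  using near_filter_countable[of A "\<lambda>t. t \<notin> A"] by simp

text \<open>Intervals of positive length are uncountable, so disregarding countable sets does not
  empty them. The final contradiction needs this.\<close>

lemma \<F>_neq_bot: "\<F> \<noteq> bot"
proof
  assume "\<F> = bot"
  hence "eventually (\<lambda>_. False) \<F>" by simp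
  hence "\<forall>\<^sub>F n in sequentially. countable {t \<in> {\<rho> n..\<rho> n + 1}. \<not> False}"
    unfolding eventually_near_filter by blast
  then obtain n where "countable {t \<in> {\<rho> n..\<rho> n + 1}. \<not> False}"
    using eventually_happens'[OF sequentially_bot] by blast
  moreover have "{t \<in> {\<rho> n..\<rho> n + 1}. \<not> False} = {\<rho> n..\<rho> n + 1}" by blast
  ultimately have "countable {\<rho> n..\<rho> n + 1}" by (simp only:)
  thus False using uncountable_closed_interval[of "\<rho> n" "\<rho> n + 1"] by simp
qed

lemma eventually_regular:
  assumes "nonzero_meromorphic f"
  shows "\<forall>\<^sub>F t in \<F>. regular_on_circle f t"
  using eventually_\<F>_not_in[OF countable_not_regular[OF assms]] eventually_\<F>_ge[of 1]
  by eventually_elim auto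

text \<open>For \<open>n \<ge> L + K\<close> both \<open>t\<close> and \<open>s\<close> lie between
  \<open>\<rho> n\<close> and \<open>\<rho> n + n\<close>. Off \<open>B\<close> this gives \<open>T
  s \<le> T (\<rho> n + n) \<le> 2 * T (\<rho> n) \<le> 2 * T t\<close>.\<close>

lemma eventually_T_ahead: "\<forall>\<^sub>F t in \<F>. \<forall>s\<in>{t..t+K} - B. T s \<le> 2 * T t"
  unfolding eventually_near_filter
proof
  fix L
  obtain N :: nat where N: "real N \<ge> L + K" using real_arch_simple by blast
  show "\<forall>\<^sub>F n in sequentially. countable {t \<in> {\<rho> n..\<rho> n + L}. \<not> (\<forall>s\<in>{t..t+K} - B. T s \<le> 2 * T t)}"
    using \<rho>_ge[of 1] eventually_ge_at_top[of N]
  proof eventually_elim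
    case (elim n)
    have "T s \<le> 2 * T t" if t: "t \<in> {\<rho> n..\<rho> n + L}" "t \<notin> B" and s: "s \<in> {t..t+K} - B" for s t
    proof -
      have "real N \<le> real n" using elim by simp
      hence "s \<le> \<rho> n + real n" using s t N by auto
      hence "T s \<le> T (\<rho> n + real n)" using s t elim \<rho>(3) by (intro T_mono) auto
      also have "\<dots> \<le> 2 * T (\<rho> n)" by (rule \<rho>(4))
      also have "T (\<rho> n) \<le> T t" using t elim \<rho>(2) by (intro T_mono) auto
      finally show ?thesis by simp
    qed
    hence "{t \<in> {\<rho> n..\<rho> n + L}. \<not> (\<forall>s\<in>{t..t+K} - B. T s \<le> 2 * T t)} \<subseteq> B" by blast
    thus ?case using countable_B by (rule countable_subset)
  qed
qed

text \<open>An interval of length one cannot be covered by \<open>B\<close> and the countably many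
  failures of \<open>P\<close>. This supplies the outer radius in all later estimates, together with
  whatever has to hold there.\<close>

lemma eventually_ahead:
  assumes "eventually P \<F>" "0 \<le> K"
  shows "\<forall>\<^sub>F t in \<F>. \<exists>R\<in>{t+K..t+K+1}. P R \<and> R \<notin> B \<and> T R \<le> 2 * T t"
proof -
  have "\<forall>\<^sub>F t in \<F>. \<exists>R\<in>{t+K..t+K+1}. P R \<and> R \<notin> B"
    unfolding eventually_near_filter
  proof
    fix L
    have "\<forall>\<^sub>F n in sequentially. countable {t \<in> {\<rho> n..\<rho> n + (L + K + 1)}. \<not> P t}"
      using assms(1) unfolding eventually_near_filter by blast
    thus "\<forall>\<^sub>F n in sequentially. countable {t \<in> {\<rho> n..\<rho> n + L}. \<not> (\<exists>R\<in>{t+K..t+K+1}. P R \<and> R \<notin> B)}"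
    proof eventually_elim
      case (elim n)
      have "\<exists>R\<in>{t+K..t+K+1}. P R \<and> R \<notin> B" if t: "t \<in> {\<rho> n..\<rho> n + L}" for t
      proof (rule ccontr)
        assume *: "\<not> ?thesis"
        have "{t+K..t+K+1} \<subseteq> {t \<in> {\<rho> n..\<rho> n + (L + K + 1)}. \<not> P t} \<union> B"
        proof
          fix R assume R: "R \<in> {t+K..t+K+1}"
          hence "R \<in> {\<rho> n..\<rho> n + (L + K + 1)}" using t assms(2) by auto
          thus "R \<in> {t \<in> {\<rho> n..\<rho> n + (L + K + 1)}. \<not> P t} \<union> B" using * R by blast
        qed
        hence "countable {t+K..t+K+1}" using countable_Un[OF elim countable_B] by (rule countable_subset)
        thus False using uncountable_closed_interval[of "t+K" "t+K+1"] by simp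
      qed
      hence "{t \<in> {\<rho> n..\<rho> n + L}. \<not> (\<exists>R\<in>{t+K..t+K+1}. P R \<and> R \<notin> B)} = {}" by blast
      thus ?case by (simp only: countable_empty)
    qed
  qed
  thus ?thesis using eventually_T_ahead[of "K + 1"]
  proof eventually_elim
    case (elim t)
    then obtain R where R: "R\<in>{t+K..t+K+1}" "P R" "R \<notin> B" by blast
    hence "R \<in> {t..t + (K + 1)} - B" using assms(2) by auto
    thus ?case using elim(2) R by blast
  qed
qed

lemma ln_small: "ln \<in> o[\<F>](T)"
proof (rule landau_o.smallI)
  fix c :: real assume c: "0 < c"
  obtain r0 where r0: "\<And>r. r \<ge> r0 \<Longrightarrow> r \<notin> B \<Longrightarrow> 1 / c * ln r \<le> T r" using T_log by blast
  show "\<forall>\<^sub>F x in \<F>. norm (ln x) \<le> c * norm (T x)"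
    using eventually_\<F>_ge[of "max r0 1"] eventually_\<F>_not_in[OF countable_B]
  proof eventually_elim
    case (elim t)
    hence "ln t \<le> c * T t" using r0[of t] c by (simp add: field_simps)
    moreover have "0 \<le> ln t" using elim by simp
    moreover have "c * T t \<le> c * \<bar>T t\<bar>" using c by (intro mult_left_mono) auto
    ultimately show ?case by simp
  qed
qed

lemma T_at_top: "filterlim T at_top \<F>"
  unfolding filterlim_at_top
proof
  fix Z
  obtain r0 where r0: "\<And>r. r \<ge> r0 \<Longrightarrow> r \<notin> B \<Longrightarrow> \<bar>Z\<bar> * ln r \<le> T r" using T_log by blast
  show "\<forall>\<^sub>F x in \<F>. Z \<le> T x"
    using eventually_\<F>_ge[of "max r0 (exp 1)"] eventually_\<F>_not_in[OF countable_B]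
  proof eventually_elim
    case (elim t)
    have "0 < t" using elim exp_gt_zero[of "1::real"] by linarith
    hence "1 \<le> ln t" using elim by (subst ln_ge_iff) auto
    hence "\<bar>Z\<bar> * 1 \<le> \<bar>Z\<bar> * ln t" by (intro mult_left_mono) auto
    thus ?case using r0[of t] elim by auto
  qed
qed

lemma T_ge: "\<forall>\<^sub>F t in \<F>. C \<le> T t"
  using T_at_top by (simp add: filterlim_at_top)

lemma const_small: "(\<lambda>_. C) \<in> o[\<F>](T)"
proof (rule landau_o.smallI)
  fix c :: real assume c: "0 < c"
  show "\<forall>\<^sub>F x in \<F>. norm C \<le> c * norm (T x)"
    using T_ge[of "\<bar>C\<bar> / c"] T_ge[of 0]
    by eventually_elim (use c in \<open>simp add: field_simps\<close>)
qed

lemma ln_T_small: "(\<lambda>t. ln (T t)) \<in> o[\<F>](T)"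
proof -
  have "ln \<in> o[at_top](\<lambda>x::real. x)"
    by (rule smalloI_tendsto) (use ln_x_over_x_tendsto_0 eventually_gt_at_top[of 0] in \<open>auto elim: eventually_mono\<close>)
  from landau_o.small.compose[OF this T_at_top] show ?thesis by simp
qed

lemma small_le:
  assumes "\<forall>\<^sub>F t in \<F>. 0 \<le> p t \<and> p t \<le> q t" "q \<in> o[\<F>](T)"
  shows "p \<in> o[\<F>](T)"
  by (rule landau_o.big_small_trans[OF landau_o.bigI[of 1] assms(2)])
     (use assms(1) in \<open>auto elim!: eventually_mono\<close>)

lemma smallD: "q \<in> o[\<F>](T) \<Longrightarrow> 0 < \<epsilon> \<Longrightarrow> \<forall>\<^sub>F t in \<F>. q t \<le> \<epsilon> * T t"
  using landau_o.smallD[of q \<F> T \<epsilon>] T_ge[of 0] by (auto elim: eventually_elim2)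

lemma smallI:
  assumes "\<And>\<epsilon>. 0 < \<epsilon> \<Longrightarrow> \<forall>\<^sub>F t in \<F>. 0 \<le> q t \<and> q t \<le> \<epsilon> * T t"
  shows "q \<in> o[\<F>](T)"
proof (rule landau_o.smallI)
  fix c :: real assume c: "0 < c"
  show "\<forall>\<^sub>F x in \<F>. norm (q x) \<le> c * norm (T x)"
    using assms[OF c] T_ge[of 0] by eventually_elim simp
qed

text \<open>Pass to a good radius \<open>R\<close> beyond \<open>t + K\<close>, where
  \<open>q\<close> is at most \<open>\<epsilon> / 2 * T R\<close>. The factor \<open>1 / 2\<close>
  pays for \<open>T R \<le> 2 * T t\<close>.\<close>

lemma small_ahead:
  assumes q: "q \<in> o[\<F>](T)" and mono: "\<And>r s. 1 \<le> r \<Longrightarrow> r \<le> s \<Longrightarrow> q r \<le> q s" and nonneg: "\<And>r. 1 \<le> r \<Longrightarrow> 0 \<le> q r"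
    and K: "0 \<le> K"
  shows "(\<lambda>t. q (t + K)) \<in> o[\<F>](T)"
proof (rule smallI)
  fix \<epsilon> :: real assume \<epsilon>: "0 < \<epsilon>"
  show "\<forall>\<^sub>F t in \<F>. 0 \<le> q (t + K) \<and> q (t + K) \<le> \<epsilon> * T t"
    using eventually_ahead[OF smallD[OF q half_gt_zero[OF \<epsilon>]] K] eventually_\<F>_ge[of 1]
  proof eventually_elim
    case (elim t)
    then obtain R where R: "R\<in>{t+K..t+K+1}" "q R \<le> \<epsilon> / 2 * T R" "T R \<le> 2 * T t" by auto
    have "q (t + K) \<le> q R" using R elim K by (intro mono) auto
    also have "\<dots> \<le> \<epsilon> / 2 * (2 * T t)" using R \<epsilon> by (intro order_trans[OF R(2)] mult_left_mono) auto
    finally show ?case using nonneg[of "t + K"] elim K by simp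
  qed
qed

end

subsection \<open>Small functions\<close>

lemma eventually_cosparse_circle:
  fixes P :: "complex \<Rightarrow> bool"
  assumes "\<forall>\<^sub>\<approx>z. P z"
  shows "countable {r. \<not> (\<forall>z. norm z = r \<longrightarrow> P z)}"
proof -
  have "{z. \<not> P z} sparse_in UNIV" using assms by (simp only: eventually_cosparse)
  hence "countable (norm ` {z. \<not> P z})" using sparse_imp_countable[of UNIV "{z. \<not> P z}"] by simp
  thus ?thesis by (rule countable_subset[rotated]) auto
qed

lemma pol_cong:
  assumes "\<forall>\<^sub>\<approx>z. u z = v z"
  shows "pol u = pol v"
proof
  fix p
  have "zorder u p = zorder v p"
    by (rule zorder_cong) (use eventually_cosparse_imp_eventually_at[OF assms, of p UNIV] in auto)
  thus "pol u p = pol v p" by (simp add: pol_def)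
qed

lemma nev_N_cong:
  assumes "\<forall>\<^sub>\<approx>z. u z = v z" "nonzero_meromorphic u" "0 < r"
  shows "nev_N r u = nev_N r v"
  using nonzero_meromorphic_cong[OF assms(1)] assms by (simp add: nev_N_eq_counting pol_cong[OF assms(1)])

lemma pol_const: "c \<noteq> 0 \<Longrightarrow> pol (\<lambda>_. c) p = 0"
  by (simp add: pol_def zorder_eq_0_analytic)

lemma nev_N_const: "c \<noteq> 0 \<Longrightarrow> 0 < r \<Longrightarrow> nev_N r (\<lambda>_. c) = 0"
  by (simp add: nev_N_eq_counting nonzero_meromorphic_const counting_def pol_const)

lemma deriv_diff_const: "deriv (\<lambda>z. f z - c) = deriv (f :: complex \<Rightarrow> complex)"
proof
  fix z
  have "((\<lambda>z. f z - c) has_field_derivative D) (at z) \<longleftrightarrow> (f has_field_derivative D) (at z)" for D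
  proof
    assume "((\<lambda>z. f z - c) has_field_derivative D) (at z)"
    hence "((\<lambda>z. (f z - c) + c) has_field_derivative D + 0) (at z)" by (intro derivative_intros)
    thus "(f has_field_derivative D) (at z)" by simp
  next
    assume "(f has_field_derivative D) (at z)"
    hence "((\<lambda>z. f z - c) has_field_derivative D - 0) (at z)" by (intro derivative_intros)
    thus "((\<lambda>z. f z - c) has_field_derivative D) (at z)" by simp
  qed
  thus "deriv (\<lambda>z. f z - c) z = deriv f z" by (simp add: deriv_def)
qed

lemma higher_deriv_shift: "(deriv ^^ k) (\<lambda>z. f (z + c)) = (\<lambda>z. (deriv ^^ k) f (z + c :: complex))"
proof (induction k)
  case (Suc k)
  have "deriv (\<lambda>z. F (z + c)) = (\<lambda>z. deriv F (z + c))" for F :: "complex \<Rightarrow> complex"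
  proof
    fix z
    have "((\<lambda>z. F (z + c)) has_field_derivative D) (at z) \<longleftrightarrow> (F has_field_derivative D) (at (z + c))" for D
      by (rule DERIV_shift[symmetric])
    thus "deriv (\<lambda>z. F (z + c)) z = deriv F (z + c)" by (simp add: deriv_def)
  qed
  thus ?case using Suc.IH by simp
qed simp

context slow_radii
begin

text \<open>The zero function is excluded, so the class is closed under quotients; differences need
  a separate proof that they do not vanish identically.\<close>

definition small_char :: "(complex \<Rightarrow> complex) \<Rightarrow> bool" where
  "small_char u \<longleftrightarrow> nonzero_meromorphic u \<and> (\<lambda>t. nev_T t u) \<in> o[\<F>](T)"

text \<open>The properties of \<open>f\<close> and \<open>g\<close> that the estimates use: few
  zeros and poles, and a proximity function of order at most \<open>T\<close>. Jensen's formula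
  gives the same bound for the reciprocal (\<open>small_divisor_inverse\<close>).\<close>

definition small_divisor :: "(complex \<Rightarrow> complex) \<Rightarrow> bool" where
  "small_divisor u \<longleftrightarrow> nonzero_meromorphic u \<and> (\<lambda>t. nev_N t u) \<in> o[\<F>](T) \<and>
     (\<lambda>t. nev_N t (\<lambda>z. 1 / u z)) \<in> o[\<F>](T) \<and> (\<exists>C. \<forall>\<^sub>F t in \<F>. nev_m t u \<le> C * T t)"

section \<open>Closure properties of functions with small characteristic or small divisor\<close>

lemma nev_m_cong:
  assumes "\<forall>\<^sub>\<approx>z. u z = v z"
  shows "\<forall>\<^sub>F t in \<F>. nev_m t u = nev_m t v"
  using eventually_\<F>_not_in[OF eventually_cosparse_circle[OF assms]] eventually_\<F>_ge[of 1]
  by eventually_elim (auto simp: nev_m_eq_cmean intro!: cmean_cong)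

lemma small_char_cong:
  assumes "\<forall>\<^sub>\<approx>z. u z = v z" "small_char u"
  shows "small_char v"
proof -
  have u: "nonzero_meromorphic u" using assms(2) by (simp add: small_char_def)
  hence v: "nonzero_meromorphic v" using nonzero_meromorphic_cong[OF assms(1)] by simp
  have "\<forall>\<^sub>F t in \<F>. 0 \<le> nev_T t v \<and> nev_T t v \<le> nev_T t u"
    using nev_m_cong[OF assms(1)] eventually_\<F>_ge[of 1]
    by eventually_elim (auto simp: nev_T_nonneg v, simp add: nev_T_def nev_N_cong[OF assms(1) u])
  thus ?thesis using small_le[of "\<lambda>t. nev_T t v"] assms(2) v by (auto simp: small_char_def)
qed

lemma small_divisor_cong:
  assumes "\<forall>\<^sub>\<approx>z. u z = v z" "small_divisor u"
  shows "small_divisor v"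
proof -
  have u: "nonzero_meromorphic u" using assms(2) by (simp add: small_divisor_def)
  hence v: "nonzero_meromorphic v" using nonzero_meromorphic_cong[OF assms(1)] by simp
  have inv: "\<forall>\<^sub>\<approx>z. 1 / u z = 1 / v z" using assms(1) by eventually_elim simp
  have "\<forall>\<^sub>F t in \<F>. 0 \<le> nev_N t v \<and> nev_N t v \<le> nev_N t u"
    using eventually_\<F>_ge[of 1]
    by eventually_elim (auto simp: nev_N_nonneg v, simp add: nev_N_cong[OF assms(1) u])
  moreover have "\<forall>\<^sub>F t in \<F>. 0 \<le> nev_N t (\<lambda>z. 1 / v z) \<and> nev_N t (\<lambda>z. 1 / v z) \<le> nev_N t (\<lambda>z. 1 / u z)"
    using eventually_\<F>_ge[of 1]
    by eventually_elim (auto simp: nev_N_nonneg nonzero_meromorphic_inverse v, simp add: nev_N_cong[OF inv nonzero_meromorphic_inverse[OF u]])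
  moreover obtain C where "\<forall>\<^sub>F t in \<F>. nev_m t u \<le> C * T t" using assms(2) by (auto simp: small_divisor_def)
  hence "\<forall>\<^sub>F t in \<F>. nev_m t v \<le> C * T t"
    using nev_m_cong[OF assms(1)] by eventually_elim simp
  ultimately show ?thesis using small_le[of "\<lambda>t. nev_N t v" "\<lambda>t. nev_N t u"]
      small_le[of "\<lambda>t. nev_N t (\<lambda>z. 1 / v z)" "\<lambda>t. nev_N t (\<lambda>z. 1 / u z)"] assms(2) v
    unfolding small_divisor_def by blast
qed

lemma small_char_const:
  assumes "c \<noteq> 0"
  shows "small_char (\<lambda>_. c)"
proof -
  have "\<forall>\<^sub>F t in \<F>. 0 \<le> nev_T t (\<lambda>_. c) \<and> nev_T t (\<lambda>_. c) \<le> log_plus (norm c)"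
    using eventually_\<F>_ge[of 1]
    by eventually_elim
       (use assms in \<open>auto simp: nev_T_nonneg nonzero_meromorphic_const nev_T_def nev_N_const nev_m_eq_cmean\<close>)
  thus ?thesis using small_le[OF _ const_small] assms by (simp add: small_char_def nonzero_meromorphic_const)
qed

lemma small_char_mult:
  assumes "small_char u" "small_char v"
  shows "small_char (\<lambda>z. u z * v z)"
proof -
  have u: "nonzero_meromorphic u" "nonzero_meromorphic v" "nonzero_meromorphic (\<lambda>z. u z * v z)"
    using assms by (auto simp: small_char_def intro: nonzero_meromorphic_mult)
  have "\<forall>\<^sub>F t in \<F>. 0 \<le> nev_T t (\<lambda>z. u z * v z) \<and> nev_T t (\<lambda>z. u z * v z) \<le> nev_T t u + nev_T t v"
    using eventually_\<F>_ge[of 1] eventually_regular[OF u(1)] eventually_regular[OF u(2)]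
  proof eventually_elim
    case (elim t)
    thus ?case using nev_T_nonneg[OF u(3) elim(1)] nev_m_mult[OF elim(2,3)]
        nev_N_le_if_pol_le[OF u elim(1) pol_mult[OF u(1,2)]] by (simp add: nev_T_def)
  qed
  moreover have "(\<lambda>t. nev_T t u + nev_T t v) \<in> o[\<F>](T)"
    using assms by (auto simp: small_char_def intro!: sum_in_smallo)
  ultimately show ?thesis using small_le u by (auto simp: small_char_def)
qed

lemma small_char_diff:
  assumes "small_char u" "small_char v" "nonzero_meromorphic (\<lambda>z. u z - v z)"
  shows "small_char (\<lambda>z. u z - v z)"
proof -
  have u: "nonzero_meromorphic u" "nonzero_meromorphic v" using assms by (auto simp: small_char_def)
  have "\<forall>\<^sub>F t in \<F>. 0 \<le> nev_T t (\<lambda>z. u z - v z) \<and> nev_T t (\<lambda>z. u z - v z) \<le> nev_T t u + nev_T t v + ln 2"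
    using eventually_\<F>_ge[of 1] eventually_regular[OF u(1)] eventually_regular[OF u(2)]
  proof eventually_elim
    case (elim t)
    thus ?case using nev_T_nonneg[OF assms(3) elim(1)] nev_m_diff[OF elim(2,3)]
        nev_N_le_if_pol_le[OF u assms(3) elim(1) pol_diff[OF u assms(3)]] by (simp add: nev_T_def)
  qed
  moreover have "(\<lambda>t. nev_T t u + nev_T t v + ln 2) \<in> o[\<F>](T)"
    using assms const_small by (auto simp: small_char_def intro!: sum_in_smallo)
  ultimately show ?thesis using small_le assms(3) by (auto simp: small_char_def)
qed

lemma small_char_inverse:
  assumes "small_char u"
  shows "small_char (\<lambda>z. 1 / u z)"
proof -
  have u: "nonzero_meromorphic u" "nonzero_meromorphic (\<lambda>z. 1 / u z)"
    using assms by (auto simp: small_char_def nonzero_meromorphic_inverse)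
  have "\<forall>\<^sub>F t in \<F>. 0 \<le> nev_T t (\<lambda>z. 1 / u z) \<and> nev_T t (\<lambda>z. 1 / u z) \<le> nev_T t u - ln (norm (zor_poly u 0 0))"
    using eventually_\<F>_ge[of 1] eventually_regular[OF u(1)]
  proof eventually_elim
    case (elim t)
    thus ?case using nev_T_nonneg[OF u(2) elim(1)] nev_T_inverse[OF u(1) elim(2)] by simp
  qed
  moreover have "(\<lambda>t. nev_T t u - ln (norm (zor_poly u 0 0))) \<in> o[\<F>](T)"
    using assms const_small by (auto simp: small_char_def intro!: sum_in_smallo)
  ultimately show ?thesis using small_le u by (auto simp: small_char_def)
qed

lemma small_char_divide: "small_char u \<Longrightarrow> small_char v \<Longrightarrow> small_char (\<lambda>z. u z / v z)"
  using small_char_mult[of u "\<lambda>z. 1 / v z"] small_char_inverse[of v] by simp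

lemma small_char_imp_small_divisor:
  assumes "small_char u"
  shows "small_divisor u"
proof -
  have u: "nonzero_meromorphic u" "nonzero_meromorphic (\<lambda>z. 1 / u z)" "(\<lambda>t. nev_T t u) \<in> o[\<F>](T)"
    using assms by (auto simp: small_char_def nonzero_meromorphic_inverse)
  have u': "(\<lambda>t. nev_T t (\<lambda>z. 1 / u z)) \<in> o[\<F>](T)" using small_char_inverse[OF assms] by (simp add: small_char_def)
  have 1: "\<forall>\<^sub>F t in \<F>. 0 \<le> nev_N t u \<and> nev_N t u \<le> nev_T t u"
    using eventually_\<F>_ge[of 1] by eventually_elim (auto intro: nev_N_nonneg u nev_T_ge_N)
  have 2: "\<forall>\<^sub>F t in \<F>. 0 \<le> nev_N t (\<lambda>z. 1 / u z) \<and> nev_N t (\<lambda>z. 1 / u z) \<le> nev_T t (\<lambda>z. 1 / u z)"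
    using eventually_\<F>_ge[of 1] by eventually_elim (auto intro: nev_N_nonneg u nev_T_ge_N)
  have 3: "\<forall>\<^sub>F t in \<F>. nev_m t u \<le> 1 * T t"
    using eventually_\<F>_ge[of 1] smallD[OF u(3) zero_less_one]
    by eventually_elim (use nev_T_ge_m[OF u(1)] in \<open>auto intro: order_trans\<close>)
  show ?thesis using u(1) small_le[OF 1 u(3)] small_le[OF 2 u'] 3 unfolding small_divisor_def by blast
qed

lemma small_divisor_inverse:
  assumes "small_divisor u"
  shows "small_divisor (\<lambda>z. 1 / u z)"
proof -
  have u: "nonzero_meromorphic u" "nonzero_meromorphic (\<lambda>z. 1 / u z)"
      "(\<lambda>t. nev_N t u) \<in> o[\<F>](T)" "(\<lambda>t. nev_N t (\<lambda>z. 1 / u z)) \<in> o[\<F>](T)"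
    using assms by (auto simp: small_divisor_def nonzero_meromorphic_inverse)
  obtain C where C: "\<forall>\<^sub>F t in \<F>. nev_m t u \<le> C * T t" using assms by (auto simp: small_divisor_def)
  \<comment> \<open>One extra \<open>T t\<close> covers the counting function of the poles of
    \<open>u\<close>, the other the constant in Jensen's formula.\<close>
  have "\<forall>\<^sub>F t in \<F>. nev_m t (\<lambda>z. 1 / u z) \<le> (C + 2) * T t"
    using C smallD[OF u(3), of 1, simplified] T_ge[of "- ln (norm (zor_poly u 0 0))"]
      eventually_\<F>_ge[of 1] eventually_regular[OF u(1)]
  proof eventually_elim
    case (elim t)
    have "nev_m t (\<lambda>z. 1 / u z) \<le> nev_T t (\<lambda>z. 1 / u z)" by (rule nev_T_ge_m[OF u(2) elim(4)])
    also have "\<dots> = nev_m t u + nev_N t u - ln (norm (zor_poly u 0 0))"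
      using nev_T_inverse[OF u(1) elim(5)] by (simp add: nev_T_def)
    finally show ?case using elim by (simp add: distrib_right)
  qed
  thus ?thesis using u unfolding small_divisor_def by auto
qed

lemma small_divisor_mult:
  assumes "small_divisor u" "small_divisor v"
  shows "small_divisor (\<lambda>z. u z * v z)"
proof -
  have u: "nonzero_meromorphic u" "nonzero_meromorphic v" "nonzero_meromorphic (\<lambda>z. u z * v z)"
    "nonzero_meromorphic (\<lambda>z. 1 / u z)" "nonzero_meromorphic (\<lambda>z. 1 / v z)" "nonzero_meromorphic (\<lambda>z. 1 / (u z * v z))"
    using assms by (auto simp: small_divisor_def intro!: nonzero_meromorphic_mult nonzero_meromorphic_inverse)
  obtain C where C: "\<forall>\<^sub>F t in \<F>. nev_m t u \<le> C * T t" using assms by (auto simp: small_divisor_def)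
  obtain D where D: "\<forall>\<^sub>F t in \<F>. nev_m t v \<le> D * T t" using assms by (auto simp: small_divisor_def)
  have p: "pol (\<lambda>z. 1 / (u z * v z)) p \<le> pol (\<lambda>z. 1 / u z) p + pol (\<lambda>z. 1 / v z) p" for p
    using pol_mult[OF u(4,5), of p] by simp
  have 1: "\<forall>\<^sub>F t in \<F>. 0 \<le> nev_N t (\<lambda>z. u z * v z) \<and> nev_N t (\<lambda>z. u z * v z) \<le> nev_N t u + nev_N t v"
    using eventually_\<F>_ge[of 1]
    by eventually_elim (use nev_N_le_if_pol_le[OF u(1,2,3) _ pol_mult[OF u(1,2)]] nev_N_nonneg[OF u(3)] in auto)
  have 2: "\<forall>\<^sub>F t in \<F>. 0 \<le> nev_N t (\<lambda>z. 1 / (u z * v z)) \<and>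
      nev_N t (\<lambda>z. 1 / (u z * v z)) \<le> nev_N t (\<lambda>z. 1 / u z) + nev_N t (\<lambda>z. 1 / v z)"
    using eventually_\<F>_ge[of 1]
    by eventually_elim (use nev_N_le_if_pol_le[OF u(4,5,6) _ p] nev_N_nonneg[OF u(6)] in auto)
  have 3: "\<forall>\<^sub>F t in \<F>. nev_m t (\<lambda>z. u z * v z) \<le> (C + D) * T t"
    using C D eventually_regular[OF u(1)] eventually_regular[OF u(2)]
  proof eventually_elim
    case (elim t)
    thus ?case using nev_m_mult[OF elim(3,4)] by (simp add: distrib_right)
  qed
  have 4: "(\<lambda>t. nev_N t u + nev_N t v) \<in> o[\<F>](T)"
      "(\<lambda>t. nev_N t (\<lambda>z. 1 / u z) + nev_N t (\<lambda>z. 1 / v z)) \<in> o[\<F>](T)"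
    using assms by (auto simp: small_divisor_def intro!: sum_in_smallo)
  show ?thesis using u(3) small_le[OF 1 4(1)] small_le[OF 2 4(2)] 3 unfolding small_divisor_def by blast
qed

section \<open>Logarithmic derivatives, shift quotients and almost omitted values\<close>

lemma small_cmult:
  assumes "q \<in> o[\<F>](T)"
  shows "(\<lambda>t. c * q t) \<in> o[\<F>](T)"
  using assms const_small[of 0] by (cases "c = 0") auto

lemma small_N_ahead:
  assumes "nonzero_meromorphic u" "(\<lambda>t. nev_N t u) \<in> o[\<F>](T)" "0 \<le> K"
  shows "(\<lambda>t. nev_N (t + K) u) \<in> o[\<F>](T)"
  by (rule small_ahead[OF assms(2) nev_N_mono[OF assms(1)] nev_N_nonneg[OF assms(1)] assms(3)])

text \<open>Two applications of \<open>eventually_ahead\<close> provide the radii \<open>R\<close>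
  and \<open>s\<close> of \<open>nev_m_logderiv\<close> within distance 4 of \<open>t\<close>. The
  quantities under the logarithm are then O(t * T t), so the logarithm is o(T).\<close>

lemma small_char_logderiv:
  assumes S: "small_divisor u" and d: "nonzero_meromorphic (deriv u)"
  shows "small_char (\<lambda>z. deriv u z / u z)"
proof -
  have u: "nonzero_meromorphic u" "nonzero_meromorphic (\<lambda>z. 1 / u z)" "nonzero_meromorphic (\<lambda>z. deriv u z / u z)"
      "(\<lambda>t. nev_N t u) \<in> o[\<F>](T)" "(\<lambda>t. nev_N t (\<lambda>z. 1 / u z)) \<in> o[\<F>](T)"
    using S d by (auto simp: small_divisor_def intro: nonzero_meromorphic_inverse nonzero_meromorphic_divide)
  obtain C where C: "\<forall>\<^sub>F t in \<F>. nev_m t u \<le> C * T t" using S by (auto simp: small_divisor_def)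
  obtain D where D: "\<forall>\<^sub>F t in \<F>. nev_m t (\<lambda>z. 1 / u z) \<le> D * T t"
    using small_divisor_inverse[OF S] by (auto simp: small_divisor_def)
  define A where "A = \<bar>C\<bar> + \<bar>D\<bar>"
  have A0: "0 \<le> A" by (simp add: A_def)
  define N where "N = (\<lambda>t. nev_N t u + nev_N t (\<lambda>z. 1 / u z))"
  have N: "N \<in> o[\<F>](T)" unfolding N_def using u by (intro sum_in_smallo)
  define P where "P = (\<lambda>R. regular_on_circle u R \<and> nev_m R u + nev_m R (\<lambda>z. 1 / u z) \<le> A * T R \<and> N R \<le> T R \<and> 1 \<le> T R)"
  have P: "\<forall>\<^sub>F t in \<F>. P t"
    using C D smallD[OF N, of 1, simplified] T_ge[of 1] eventually_regular[OF u(1)]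
  proof eventually_elim
    case (elim t)
    have "C * T t \<le> \<bar>C\<bar> * T t" "D * T t \<le> \<bar>D\<bar> * T t" using elim by (auto intro: mult_right_mono)
    hence "nev_m t u + nev_m t (\<lambda>z. 1 / u z) \<le> \<bar>C\<bar> * T t + \<bar>D\<bar> * T t" using elim(1,2) by linarith
    thus ?case using elim by (simp add: P_def A_def distrib_right)
  qed
  have "\<forall>\<^sub>F R in \<F>. P R \<and> (\<exists>s\<in>{R+1..R+1+1}. P s \<and> s \<notin> B \<and> T s \<le> 2 * T R)"
    using P eventually_ahead[OF P zero_le_one] by eventually_elim auto
  from eventually_ahead[OF this, of 1]
  have ahead: "\<forall>\<^sub>F t in \<F>. \<exists>R\<in>{t+1..t+1+1}. (P R \<and> (\<exists>s\<in>{R+1..R+1+1}. P s \<and> s \<notin> B \<and> T s \<le> 2 * T R)) \<and> R \<notin> B \<and> T R \<le> 2 * T t"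
    by simp
  \<comment> \<open>From \<open>R \<le> 3 * t\<close>, \<open>s \<le> 5 * t\<close>,
    \<open>T R \<le> 2 * T t\<close> and \<open>T s \<le> 4 * T t\<close>, the three summands under
    the logarithm are at most \<open>1\<close>, \<open>48 * A\<close> and \<open>40\<close> times
    \<open>t * T t\<close>.\<close>
  define K where "K = 41 + 48 * A"
  have "\<forall>\<^sub>F t in \<F>. 0 \<le> nev_T t (\<lambda>z. deriv u z / u z) \<and> nev_T t (\<lambda>z. deriv u z / u z)
     \<le> ln K + ln t + ln (T t) + (nev_N (t + 2) u + nev_N (t + 2) (\<lambda>z. 1 / u z)) + N t"
    using ahead eventually_\<F>_ge[of 1] T_ge[of 1] eventually_regular[OF u(1)]
  proof eventually_elim
    case (elim t)
    then obtain R s where Rs: "R \<in> {t+1..t+1+1}" "P R" "s \<in> {R+1..R+1+1}" "P s" "T s \<le> 2 * T R" "T R \<le> 2 * T t"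
      by blast
    have "nev_m t (\<lambda>z. deriv u z / u z) \<le>
      ln (1 + 8 * R * (nev_m R u + nev_m R (\<lambda>z. 1 / u z)) + 2 * s * N s) + nev_N R u + nev_N R (\<lambda>z. 1 / u z)"
      unfolding N_def by (rule nev_m_logderiv[OF u(1)]) (use Rs elim in \<open>auto simp: P_def\<close>)
    moreover have "nev_N R u \<le> nev_N (t + 2) u" using Rs elim by (intro nev_N_mono u) auto
    moreover have "nev_N R (\<lambda>z. 1 / u z) \<le> nev_N (t + 2) (\<lambda>z. 1 / u z)" using Rs elim by (intro nev_N_mono u) auto
    moreover have "ln (1 + 8 * R * (nev_m R u + nev_m R (\<lambda>z. 1 / u z)) + 2 * s * N s) \<le> ln (K * (t * T t))"
    proof -
      have R3: "0 \<le> R" "R \<le> 3 * t" "0 \<le> s" "s \<le> 5 * t" using Rs elim by auto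
      have m0: "0 \<le> nev_m R u + nev_m R (\<lambda>z. 1 / u z)" using R3 by (intro add_nonneg_nonneg nev_m_nonneg) auto
      have N0: "0 \<le> N s" unfolding N_def using Rs elim by (intro add_nonneg_nonneg nev_N_nonneg u) auto
      have Nle: "N s \<le> 4 * T t" using Rs by (auto simp: P_def)
      have "nev_m R u + nev_m R (\<lambda>z. 1 / u z) \<le> A * T R" using Rs by (simp add: P_def)
      moreover have "\<dots> \<le> A * (2 * T t)" using Rs A0 by (intro mult_left_mono) auto
      finally have mle: "nev_m R u + nev_m R (\<lambda>z. 1 / u z) \<le> A * (2 * T t)" .
      have "R * (nev_m R u + nev_m R (\<lambda>z. 1 / u z)) \<le> (3 * t) * (A * (2 * T t))"
        using R3 m0 mle elim by (intro mult_mono) auto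
      moreover have "s * N s \<le> (5 * t) * (4 * T t)"
        using R3 N0 Nle elim by (intro mult_mono) auto
      moreover have "1 \<le> t * T t" using elim mult_mono[of 1 t 1 "T t"] by simp
      ultimately have "1 + 8 * R * (nev_m R u + nev_m R (\<lambda>z. 1 / u z)) + 2 * s * N s \<le> K * (t * T t)"
        by (simp add: K_def algebra_simps)
      moreover have "0 < 1 + 8 * R * (nev_m R u + nev_m R (\<lambda>z. 1 / u z)) + 2 * s * N s"
        using R3 m0 N0 by (intro add_pos_nonneg) auto
      ultimately show ?thesis by (subst ln_le_cancel_iff) linarith+
    qed
    moreover have "ln (K * (t * T t)) = ln K + ln t + ln (T t)"
      using elim A0 by (subst ln_mult | simp add: K_def)+
    ultimately have "nev_m t (\<lambda>z. deriv u z / u z) \<le> ln K + ln t + ln (T t) + nev_N (t + 2) u + nev_N (t + 2) (\<lambda>z. 1 / u z)"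
      by linarith
    moreover have "nev_N t (\<lambda>z. deriv u z / u z) \<le> N t" unfolding N_def
      by (rule nev_N_le_if_pol_le[OF u(1,2,3) elim(2) pol_logderiv[OF u(1) d]])
    ultimately show ?case using nev_T_nonneg[OF u(3) elim(2)] by (simp add: nev_T_def)
  qed
  moreover have "(\<lambda>t. ln K + ln t + ln (T t) + (nev_N (t + 2) u + nev_N (t + 2) (\<lambda>z. 1 / u z)) + N t) \<in> o[\<F>](T)"
    using const_small[of "ln K"] ln_small ln_T_small N small_N_ahead[OF u(1) u(4), of 2] small_N_ahead[OF u(2) u(5), of 2]
    by (intro sum_in_smallo) auto
  ultimately show ?thesis using small_le u(3) by (auto simp: small_char_def)
qed

text \<open>Second main theorem for \<open>0\<close>, \<open>1\<close>, \<open>\<infinity>\<close>: with \<open>w\<^sub>1 = u'/u\<close> and \<open>w\<^sub>2 = u'/(u - 1)\<close> one has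
  \<open>u = w\<^sub>2 / (w\<^sub>2 - w\<^sub>1)\<close>.\<close>

lemma small_char_if_omits_three:
  assumes S: "small_divisor u" and u1: "nonzero_meromorphic (\<lambda>z. u z - 1)"
    and N1: "(\<lambda>t. nev_N t (\<lambda>z. 1 / (u z - 1))) \<in> o[\<F>](T)"
  shows "small_char u"
proof -
  have u: "nonzero_meromorphic u" "(\<lambda>t. nev_N t u) \<in> o[\<F>](T)" using S by (auto simp: small_divisor_def)
  have "deriv u meromorphic_on UNIV" using u(1) by (auto simp: nonzero_meromorphic_def intro: meromorphic_intros)
  then consider "\<forall>\<^sub>\<approx>z. deriv u z = 0" | "nonzero_meromorphic (deriv u)"
    using meromorphic_zero_or_nonzero by blast
  thus ?thesis
  proof cases
    \<comment> \<open>For constant \<open>u\<close> both logarithmic derivatives vanish and the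
      formula for \<open>u\<close> becomes 0 / 0, so this case is treated directly.\<close>
    case 1
    then obtain c where c: "\<forall>\<^sub>\<approx>z. u z = c"
      using meromorphic_deriv_zero[of u] u(1) by (auto simp: nonzero_meromorphic_def)
    have "c \<noteq> 0"
    proof
      assume "c = 0"
      have "\<forall>\<^sub>\<approx>z. u z \<noteq> 0" using u(1) by (simp add: nonzero_meromorphic_def)
      with c have "\<forall>\<^sub>\<approx>z::complex. False" by eventually_elim (use \<open>c = 0\<close> in simp)
      thus False by (simp add: eventually_False)
    qed
    hence "small_char (\<lambda>_. c)" by (rule small_char_const)
    moreover have "\<forall>\<^sub>\<approx>z. c = u z" using c by eventually_elim simp
    ultimately show ?thesis by (rule small_char_cong[rotated])
  next
    case 2
    have one: "nonzero_meromorphic (\<lambda>_. 1)" by (rule nonzero_meromorphic_const) simp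
    have S1: "small_divisor (\<lambda>z. u z - 1)"
    proof -
      have "\<forall>\<^sub>F t in \<F>. 0 \<le> nev_N t (\<lambda>z. u z - 1) \<and> nev_N t (\<lambda>z. u z - 1) \<le> nev_N t u"
        using eventually_\<F>_ge[of 1]
      proof eventually_elim
        case (elim t)
        thus ?case using nev_N_le_if_pol_le[OF u(1) one u1 elim pol_diff[OF u(1) one u1]] nev_N_nonneg[OF u1]
          by (simp add: nev_N_const)
      qed
      hence "(\<lambda>t. nev_N t (\<lambda>z. u z - 1)) \<in> o[\<F>](T)" using u(2) by (rule small_le)
      moreover obtain C where C: "\<forall>\<^sub>F t in \<F>. nev_m t u \<le> C * T t" using S by (auto simp: small_divisor_def)
      have "\<forall>\<^sub>F t in \<F>. nev_m t (\<lambda>z. u z - 1) \<le> (C + 1) * T t"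
        using C T_ge[of "ln 2"] eventually_regular[OF u(1)] eventually_regular[OF one]
      proof eventually_elim
        case (elim t)
        have "nev_m t (\<lambda>_. 1) = 0" by (simp add: nev_m_eq_cmean log_plus_def)
        thus ?case using nev_m_diff[OF elim(3,4)] elim by (simp add: distrib_right)
      qed
      ultimately show ?thesis using u1 N1 unfolding small_divisor_def by blast
    qed
    define w1 where "w1 = (\<lambda>z. deriv u z / u z)"
    define w2 where "w2 = (\<lambda>z. deriv u z / (u z - 1))"
    have w1: "small_char w1" unfolding w1_def by (rule small_char_logderiv[OF S 2])
    have w2: "small_char w2" unfolding w2_def
      using small_char_logderiv[OF S1] 2 by (simp add: deriv_diff_const)
    have ev: "\<forall>\<^sub>\<approx>z. u z \<noteq> 0 \<and> u z - 1 \<noteq> 0 \<and> deriv u z \<noteq> 0"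
      using u(1) u1 2 by (auto simp: nonzero_meromorphic_def intro!: eventually_conj)
    have eq: "\<forall>\<^sub>\<approx>z. w2 z - w1 z = deriv u z / (u z * (u z - 1))"
      using ev by eventually_elim (simp add: w1_def w2_def divide_simps, simp add: algebra_simps)
    have nz: "nonzero_meromorphic (\<lambda>z. w2 z - w1 z)"
      by (subst nonzero_meromorphic_cong[OF eq]) (intro nonzero_meromorphic_divide nonzero_meromorphic_mult 2 u u1)
    have "small_char (\<lambda>z. w2 z / (w2 z - w1 z))"
      by (intro small_char_divide small_char_diff w1 w2 nz)
    moreover have "\<forall>\<^sub>\<approx>z. w2 z / (w2 z - w1 z) = u z"
      using ev eq by eventually_elim (simp add: w2_def)
    ultimately show ?thesis by (rule small_char_cong[rotated])
  qed
qed

lemma small_N_shift: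
  assumes S: "small_divisor g"
  shows "(\<lambda>t. nev_N t (\<lambda>z. g (z + c))) \<in> o[\<F>](T)"
proof -
  have g: "nonzero_meromorphic g" "(\<lambda>t. nev_N t g) \<in> o[\<F>](T)" using S by (auto simp: small_divisor_def)
  obtain A where A: "A \<ge> 0" "\<And>r. 1 \<le> r \<Longrightarrow> nev_N r (\<lambda>z. g (z + c)) \<le> (1 + norm c) * nev_N (r + norm c) g + A * (ln r + 1)"
    using nev_N_shift[OF g(1)] by blast
  have "\<forall>\<^sub>F t in \<F>. 0 \<le> nev_N t (\<lambda>z. g (z + c)) \<and> nev_N t (\<lambda>z. g (z + c)) \<le> (1 + norm c) * nev_N (t + norm c) g + A * (ln t + 1)"
    using eventually_\<F>_ge[of 1]
    by eventually_elim (use A(2) nev_N_nonneg[OF nonzero_meromorphic_shift[OF g(1)]] in auto)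
  moreover have "(\<lambda>t. (1 + norm c) * nev_N (t + norm c) g + A * (ln t + 1)) \<in> o[\<F>](T)"
  proof (rule sum_in_smallo)
    show "(\<lambda>t. (1 + norm c) * nev_N (t + norm c) g) \<in> o[\<F>](T)"
      using small_N_ahead[OF g, of "norm c"] by (intro small_cmult) auto
    have "(\<lambda>t. ln t + 1) \<in> o[\<F>](T)" using ln_small const_small[of 1] by (intro sum_in_smallo)
    thus "(\<lambda>t. A * (ln t + 1)) \<in> o[\<F>](T)" by (intro small_cmult) auto
  qed
  ultimately show ?thesis by (rule small_le)
qed

text \<open>The gap between the two radii is at our disposal. For each \<open>\<epsilon>\<close> a
  constant gap \<open>K\<close> makes the main term at most \<open>\<epsilon> / 3 * T t\<close>, and
  for that fixed \<open>K\<close> both counting functions ahead of \<open>t\<close> are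
  o(T).\<close>

lemma small_char_shift_quotient:
  assumes S: "small_divisor g" and c: "c \<noteq> 0"
  shows "small_char (\<lambda>z. g (z + c) / g z)"
proof -
  define G where "G = (\<lambda>z. g (z + c))"
  have g: "nonzero_meromorphic g" "nonzero_meromorphic (\<lambda>z. 1 / g z)" "nonzero_meromorphic G" "nonzero_meromorphic (\<lambda>z. G z / g z)"
      "(\<lambda>t. nev_N t (\<lambda>z. 1 / g z)) \<in> o[\<F>](T)"
    using S by (auto simp: small_divisor_def G_def intro!: nonzero_meromorphic_divide nonzero_meromorphic_shift nonzero_meromorphic_inverse)
  have NG: "(\<lambda>t. nev_N t G) \<in> o[\<F>](T)" unfolding G_def by (rule small_N_shift[OF S])
  have "(\<lambda>t. nev_N t G + nev_N t (\<lambda>z. 1 / g z)) \<in> o[\<F>](T)" using g NG by (intro sum_in_smallo)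
  moreover have "\<forall>\<^sub>F t in \<F>. 0 \<le> nev_N t (\<lambda>z. G z / g z) \<and> nev_N t (\<lambda>z. G z / g z) \<le> nev_N t G + nev_N t (\<lambda>z. 1 / g z)"
    using eventually_\<F>_ge[of 1]
  proof eventually_elim
    case (elim t)
    have "pol (\<lambda>z. G z / g z) p \<le> pol G p + pol (\<lambda>z. 1 / g z) p" for p
      using pol_mult[OF g(3,2), of p] by simp
    thus ?case using nev_N_le_if_pol_le[OF g(3,2,4) elim] nev_N_nonneg[OF g(4) elim] by auto
  qed
  ultimately have N: "(\<lambda>t. nev_N t (\<lambda>z. G z / g z)) \<in> o[\<F>](T)" by (rule small_le[rotated])
  obtain C where C: "\<forall>\<^sub>F t in \<F>. nev_m t g \<le> C * T t" using S by (auto simp: small_divisor_def)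
  obtain D where D: "\<forall>\<^sub>F t in \<F>. nev_m t (\<lambda>z. 1 / g z) \<le> D * T t"
    using small_divisor_inverse[OF S] by (auto simp: small_divisor_def)
  define A where "A = \<bar>C\<bar> + \<bar>D\<bar>"
  have A0: "0 \<le> A" by (simp add: A_def)
  have m: "(\<lambda>t. nev_m t (\<lambda>z. G z / g z)) \<in> o[\<F>](T)"
  proof (rule smallI)
    fix \<epsilon> :: real assume \<epsilon>: "0 < \<epsilon>"
    \<comment> \<open>The first summand meets the gap condition of
      \<open>nev_m_shift_quotient\<close> and keeps \<open>K\<close> positive if
      \<open>A = 0\<close>. The second turns \<open>4 * norm c / K * (A * (2 * T t))\<close> into at
      most \<open>\<epsilon> / 3 * T t\<close>.\<close>
    define K where "K = 2 * norm c + 24 * norm c * A / \<epsilon>"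
    have K: "0 \<le> K" "2 * norm c \<le> K" using A0 \<epsilon> by (auto simp: K_def)
    have K0: "0 < K" using K c by (metis less_le_trans mult_pos_pos zero_less_norm_iff zero_less_numeral)
    have KA: "4 * norm c * A / K \<le> \<epsilon> / 6"
    proof -
      have "24 * norm c * A \<le> K * \<epsilon>" using \<epsilon> by (simp add: K_def distrib_right)
      thus ?thesis using K0 \<epsilon> by (simp add: field_simps)
    qed
    define P where "P = (\<lambda>R. regular_on_circle g R \<and> nev_m R g + nev_m R (\<lambda>z. 1 / g z) \<le> A * T R)"
    have P: "\<forall>\<^sub>F t in \<F>. P t"
      using C D T_ge[of 0] eventually_regular[OF g(1)]
    proof eventually_elim
      case (elim t)
      have "C * T t \<le> \<bar>C\<bar> * T t" "D * T t \<le> \<bar>D\<bar> * T t" using elim by (auto intro: mult_right_mono)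
      hence "nev_m t g + nev_m t (\<lambda>z. 1 / g z) \<le> \<bar>C\<bar> * T t + \<bar>D\<bar> * T t" using elim(1,2) by linarith
      thus ?case using elim by (simp add: P_def A_def distrib_right)
    qed
    have N1: "(\<lambda>t. nev_N (t + (K + 1)) (\<lambda>z. 1 / g z)) \<in> o[\<F>](T)"
      using small_N_ahead[OF g(2,5)] K by simp
    have N2: "(\<lambda>t. nev_N (t + (K + 1 + norm c)) G) \<in> o[\<F>](T)"
      using small_N_ahead[OF g(3) NG] K by simp
    have \<epsilon>3: "0 < \<epsilon> / 3" using \<epsilon> by simp
    show "\<forall>\<^sub>F t in \<F>. 0 \<le> nev_m t (\<lambda>z. G z / g z) \<and> nev_m t (\<lambda>z. G z / g z) \<le> \<epsilon> * T t"
      using eventually_ahead[OF P K(1)] smallD[OF N1 \<epsilon>3] smallD[OF N2 \<epsilon>3]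
        eventually_\<F>_ge[of 1] T_ge[of 0] eventually_regular[OF g(1)] eventually_regular[OF g(3)]
    proof eventually_elim
      case (elim t)
      then obtain R where R: "R \<in> {t+K..t+K+1}" "P R" "T R \<le> 2 * T t" by auto
      have "nev_m t (\<lambda>z. g (z + c) / g z) \<le> 4 * norm c / (R - t) * (nev_m R g + nev_m R (\<lambda>z. 1 / g z))
          + nev_N R (\<lambda>z. 1 / g z) + nev_N (R + norm c) (\<lambda>z. g (z + c))"
        by (rule nev_m_shift_quotient[OF g(1)]) (use R elim K c in \<open>auto simp: P_def G_def\<close>)
      also have "4 * norm c / (R - t) * (nev_m R g + nev_m R (\<lambda>z. 1 / g z)) \<le> 4 * norm c / K * (A * (2 * T t))"
      proof (rule mult_mono)
        show "4 * norm c / (R - t) \<le> 4 * norm c / K" using R K0 by (intro divide_left_mono) (auto intro!: mult_pos_pos)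
        have "A * T R \<le> A * (2 * T t)" using R A0 by (intro mult_left_mono) auto
        thus "nev_m R g + nev_m R (\<lambda>z. 1 / g z) \<le> A * (2 * T t)" using R by (simp add: P_def)
      qed (use R K0 elim in \<open>auto intro!: add_nonneg_nonneg nev_m_nonneg\<close>)
      also have "4 * norm c / K * (A * (2 * T t)) = (4 * norm c * A / K) * (2 * T t)" by simp
      also have "\<dots> \<le> \<epsilon> / 6 * (2 * T t)" using KA elim by (intro mult_right_mono) auto
      also have "nev_N R (\<lambda>z. 1 / g z) \<le> nev_N (t + (K + 1)) (\<lambda>z. 1 / g z)"
        using R elim K by (intro nev_N_mono g) auto
      also have "\<dots> \<le> \<epsilon> / 3 * T t" using elim by simp
      also have "nev_N (R + norm c) (\<lambda>z. g (z + c)) \<le> nev_N (t + (K + 1 + norm c)) G"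
      proof -
        have R': "t + K \<le> R" "R \<le> t + K + 1" using R(1) by auto
        have "1 \<le> R + norm c" "R + norm c \<le> t + (K + 1 + norm c)"
          using R'(1) R'(2) elim(4) K(1) norm_ge_zero[of c] by linarith+
        thus ?thesis unfolding G_def by (intro nev_N_mono nonzero_meromorphic_shift g)
      qed
      also have "\<dots> \<le> \<epsilon> / 3 * T t" using elim by simp
      finally show ?case using nev_m_nonneg[of t] elim by (simp add: G_def)
    qed
  qed
  show ?thesis using sum_in_smallo(1)[OF m N] g(4) by (simp add: small_char_def nev_T_def G_def)
qed

text \<open>The quotient is a product of successive logarithmic derivatives. By induction the
  \<open>k\<close>-th derivative is \<open>G\<close> times a function of small characteristic, so it
  has a small divisor itself and \<open>small_char_logderiv\<close> applies to it.\<close>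

lemma small_char_higher_deriv:
  assumes S: "small_divisor G" and nz: "\<And>j. j \<le> k \<Longrightarrow> nonzero_meromorphic ((deriv ^^ j) G)"
  shows "small_char (\<lambda>z. (deriv ^^ k) G z / G z)"
  using nz
proof (induction k)
  case 0
  have "\<forall>\<^sub>\<approx>z. G z \<noteq> 0" using S by (simp add: small_divisor_def nonzero_meromorphic_def)
  hence "\<forall>\<^sub>\<approx>z. 1 = (deriv ^^ 0) G z / G z" by eventually_elim simp
  thus ?case by (rule small_char_cong) (simp add: small_char_const)
next
  case (Suc k)
  have G0: "\<forall>\<^sub>\<approx>z. G z \<noteq> 0" using S by (simp add: small_divisor_def nonzero_meromorphic_def)
  have IH: "small_char (\<lambda>z. (deriv ^^ k) G z / G z)" using Suc by auto
  have "small_divisor (\<lambda>z. G z * ((deriv ^^ k) G z / G z))"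
    by (intro small_divisor_mult S small_char_imp_small_divisor IH)
  moreover have "\<forall>\<^sub>\<approx>z. G z * ((deriv ^^ k) G z / G z) = (deriv ^^ k) G z"
    using G0 by eventually_elim simp
  ultimately have "small_divisor ((deriv ^^ k) G)" by (rule small_divisor_cong[rotated])
  moreover have "nonzero_meromorphic (deriv ((deriv ^^ k) G))" using Suc.prems[of "Suc k"] by simp
  ultimately have "small_char (\<lambda>z. deriv ((deriv ^^ k) G) z / (deriv ^^ k) G z)" by (rule small_char_logderiv)
  from small_char_mult[OF this IH]
  have "small_char (\<lambda>z. deriv ((deriv ^^ k) G) z / (deriv ^^ k) G z * ((deriv ^^ k) G z / G z))" .
  moreover have "\<forall>\<^sub>\<approx>z. (deriv ^^ k) G z \<noteq> 0" using Suc.prems[of k] by (simp add: nonzero_meromorphic_def)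
  hence "\<forall>\<^sub>\<approx>z. deriv ((deriv ^^ k) G) z / (deriv ^^ k) G z * ((deriv ^^ k) G z / G z) = (deriv ^^ Suc k) G z / G z"
    by eventually_elim simp
  ultimately show ?case by (rule small_char_cong[rotated])
qed

text \<open>Finitely many zeros give a counting function of size O(ln t), which is o(T) by the
  growth of transcendental functions.\<close>

lemma small_N_finite_zeros:
  assumes F: "nonzero_meromorphic F" and fin: "finite (zeros F)"
  shows "(\<lambda>t. nev_N t (\<lambda>z. 1 / F z)) \<in> o[\<F>](T)"
proof -
  define Z where "Z = {p. zer F p \<noteq> 0}"
  have "Z \<subseteq> zeros F"
  proof
    fix p assume "p \<in> Z"
    hence "isolated_zero F p"
      by (intro zorder_pos_imp_isolated_zero nonzero_meromorphicD F) (simp add: Z_def zer_def)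
    thus "p \<in> zeros F" by (auto simp: isolated_zero_def zeros_def)
  qed
  hence finZ: "finite Z" using fin finite_subset by blast
  define A where "A = (\<Sum>p\<in>Z. zer F p)"
  define C where "C = (\<Sum>p\<in>Z. zer F p * \<bar>ln (norm p)\<bar>)"
  have "\<forall>\<^sub>F t in \<F>. 0 \<le> nev_N t (\<lambda>z. 1 / F z) \<and> nev_N t (\<lambda>z. 1 / F z) \<le> A * ln t + C"
    using eventually_\<F>_ge[of 1]
  proof eventually_elim
    case (elim t)
    have "nev_N t (\<lambda>z. 1 / F z) = counting (zer F) t"
      using elim by (simp add: nev_N_eq_counting nonzero_meromorphic_inverse F pol_inverse)
    also have "\<dots> \<le> (\<Sum>p | norm p \<le> t \<and> zer F p \<noteq> 0. zer F p * (ln t + \<bar>ln (norm p)\<bar>))"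
      unfolding counting_def by (intro sum_mono mult_left_mono) auto
    also have "\<dots> \<le> (\<Sum>p\<in>Z. zer F p * (ln t + \<bar>ln (norm p)\<bar>))"
      by (rule sum_mono2) (use finZ elim in \<open>auto simp: Z_def\<close>)
    also have "\<dots> = A * ln t + C" by (simp add: A_def C_def distrib_left sum.distrib sum_distrib_right)
    finally show ?case using nev_N_nonneg[OF nonzero_meromorphic_inverse[OF F] elim] by simp
  qed
  moreover have "(\<lambda>t. A * ln t + C) \<in> o[\<F>](T)"
    using ln_small const_small[of C] by (intro sum_in_smallo small_cmult) auto
  ultimately show ?thesis by (rule small_le)
qed

text \<open>With \<open>F\<close> the expression whose zeros are finite in number and
  \<open>u\<close> as below, \<open>u - 1 = F / a\<close>. The 1-points of \<open>u\<close> are thus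
  counted by the zeros of \<open>F\<close> and the poles of \<open>a\<close>, while \<open>u\<close>
  has a small divisor as a product of such functions. Once \<open>u\<close> is small, the small
  factors \<open>a\<close> and \<open>H / g\<close> can be divided out again.\<close>

lemma small_char_product_if_finite_zeros:
  assumes f: "small_divisor f" and g: "small_divisor g" and a: "small_char a"
    and q: "small_char (\<lambda>z. H z / g z)" and H: "nonzero_meromorphic H"
    and fin: "finite (zeros (\<lambda>z. (f z)\<^sup>2 * H z - a z))"
  shows "small_char (\<lambda>z. (f z)\<^sup>2 * g z)"
proof -
  define F where "F = (\<lambda>z. (f z)\<^sup>2 * H z - a z)"
  have nz: "nonzero_meromorphic f" "nonzero_meromorphic g" "nonzero_meromorphic a"
    using f g a by (auto simp: small_divisor_def small_char_def)
  have ev: "\<forall>\<^sub>\<approx>z. f z \<noteq> 0 \<and> g z \<noteq> 0 \<and> a z \<noteq> 0 \<and> H z \<noteq> 0"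
    using nz H by (auto simp: nonzero_meromorphic_def intro!: eventually_conj)
  have "F meromorphic_on UNIV"
    using nz H by (auto simp: F_def nonzero_meromorphic_def intro!: meromorphic_intros)
  hence "(\<forall>\<^sub>\<approx>z. F z = 0) \<or> nonzero_meromorphic F" by (rule meromorphic_zero_or_nonzero)
  hence F: "nonzero_meromorphic F"
  proof
    \<comment> \<open>If \<open>F\<close> vanished identically, every point would be a zero in the
      limit sense, contradicting finiteness.\<close>
    assume F0: "\<forall>\<^sub>\<approx>z. F z = 0"
    have "F \<midarrow>z\<rightarrow> 0" for z
      by (rule tendsto_eventually) (use eventually_cosparse_imp_eventually_at[OF F0, of z UNIV] in simp)
    hence "zeros F = UNIV" by (auto simp: zeros_def)
    hence "finite (UNIV :: complex set)" using fin by (simp add: F_def)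
    thus ?thesis using infinite_UNIV_char_0 by blast
  qed
  define u where "u = (\<lambda>z. (f z)\<^sup>2 * H z / a z)"
  have "small_divisor (\<lambda>z. f z * f z * g z * (H z / g z) * (1 / a z))"
    by (intro small_divisor_mult f g small_char_imp_small_divisor q small_char_inverse a)
  moreover have "\<forall>\<^sub>\<approx>z. f z * f z * g z * (H z / g z) * (1 / a z) = u z"
    using ev by eventually_elim (simp add: u_def power2_eq_square)
  ultimately have u: "small_divisor u" by (rule small_divisor_cong[rotated])
  have eq: "\<forall>\<^sub>\<approx>z. u z - 1 = F z / a z" using ev by eventually_elim (simp add: u_def F_def field_simps)
  have u1: "nonzero_meromorphic (\<lambda>z. u z - 1)"
    by (subst nonzero_meromorphic_cong[OF eq]) (intro nonzero_meromorphic_divide F nz)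
  have Fi: "nonzero_meromorphic (\<lambda>z. 1 / F z)" by (rule nonzero_meromorphic_inverse[OF F])
  have aF: "nonzero_meromorphic (\<lambda>z. a z * (1 / F z))" by (rule nonzero_meromorphic_mult[OF nz(3) Fi])
  have eq': "\<forall>\<^sub>\<approx>z. 1 / (u z - 1) = a z * (1 / F z)" using eq by eventually_elim simp
  have N1: "(\<lambda>t. nev_N t (\<lambda>z. 1 / (u z - 1))) \<in> o[\<F>](T)"
  proof (rule small_le)
    show "\<forall>\<^sub>F t in \<F>. 0 \<le> nev_N t (\<lambda>z. 1 / (u z - 1)) \<and> nev_N t (\<lambda>z. 1 / (u z - 1)) \<le> nev_N t a + nev_N t (\<lambda>z. 1 / F z)"
      using eventually_\<F>_ge[of 1]
    proof eventually_elim
      case (elim t)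
      have "nev_N t (\<lambda>z. 1 / (u z - 1)) = nev_N t (\<lambda>z. a z * (1 / F z))"
        by (rule nev_N_cong[OF eq' nonzero_meromorphic_inverse[OF u1]]) (use elim in simp)
      thus ?case using nev_N_le_if_pol_le[OF nz(3) Fi aF elim pol_mult[OF nz(3) Fi]] nev_N_nonneg[OF aF elim] by simp
    qed
    show "(\<lambda>t. nev_N t a + nev_N t (\<lambda>z. 1 / F z)) \<in> o[\<F>](T)"
      using small_char_imp_small_divisor[OF a] small_N_finite_zeros[OF F] fin
      by (intro sum_in_smallo) (auto simp: small_divisor_def F_def)
  qed
  have "small_char u" by (rule small_char_if_omits_three[OF u u1 N1])
  hence "small_char (\<lambda>z. u z * a z / (H z / g z))" by (intro small_char_divide small_char_mult a q)
  moreover have "\<forall>\<^sub>\<approx>z. u z * a z / (H z / g z) = (f z)\<^sup>2 * g z"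
    using ev by eventually_elim (simp add: u_def)
  ultimately show ?thesis by (rule small_char_cong[rotated])
qed

text \<open>Cubing can only increase \<open>log_plus\<close> of the modulus and the multiplicity of
  each pole.\<close>

lemma small_char_of_cube:
  assumes f: "nonzero_meromorphic f" and "small_char (\<lambda>z. (f z) ^ 3)"
  shows "small_char f"
proof -
  have f3: "nonzero_meromorphic (\<lambda>z. (f z) ^ 3)" by (rule nonzero_meromorphic_power[OF f])
  have "\<forall>\<^sub>F t in \<F>. 0 \<le> nev_T t f \<and> nev_T t f \<le> nev_T t (\<lambda>z. (f z) ^ 3)"
    using eventually_\<F>_ge[of 1] eventually_regular[OF f]
  proof eventually_elim
    case (elim t)
    note r = regular_on_circleD[OF elim(2)]
    have "nev_m t f \<le> nev_m t (\<lambda>z. (f z) ^ 3)" unfolding nev_m_eq_cmean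
    proof (rule cmean_mono)
      fix z
      show "log_plus (norm (f z)) \<le> log_plus (norm (f z ^ 3))"
        by (auto simp: log_plus_def norm_power ln_realpow max_def)
    qed (use r in \<open>auto intro!: continuous_on_log_plus_norm continuous_on_power\<close>)
    moreover have "nev_N t f \<le> nev_N t (\<lambda>z. (f z) ^ 3)"
    proof -
      have "zorder (\<lambda>z. (f z) ^ 3) p = 3 * zorder f p" for p
        using zorder_power[of f p 3] nonzero_meromorphicD[OF f] by simp
      hence "pol f p \<le> pol (\<lambda>z. (f z) ^ 3) p" for p by (simp add: pol_def)
      hence "counting (pol f) t \<le> counting (pol (\<lambda>z. (f z) ^ 3)) t"
        by (intro counting_le finite_pol[OF f3]) (use elim in auto)
      thus ?thesis using elim by (simp add: nev_N_eq_counting f f3)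
    qed
    ultimately show ?case using nev_T_nonneg[OF f elim(1)] by (simp add: nev_T_def)
  qed
  thus ?thesis using small_le assms by (auto simp: small_char_def)
qed

text \<open>An interval of length \<open>measure lebesgue E + 1\<close> cannot be covered by
  \<open>E\<close> and a countable set, so it contains a radius \<open>R\<close> where the
  o-estimate holds. Monotonicity of \<open>\<phi>\<close> and the slow growth of \<open>T\<close>
  carry the estimate back to \<open>t\<close>.\<close>

lemma nev_S_imp_small:
  assumes S: "nev_S f \<phi>" and B': "countable B'"
    and mono: "\<And>r s. 1 \<le> r \<Longrightarrow> r \<le> s \<Longrightarrow> r \<notin> B' \<Longrightarrow> s \<notin> B' \<Longrightarrow> \<phi> r \<le> \<phi> s"
    and nonneg: "\<And>r. 1 \<le> r \<Longrightarrow> 0 \<le> \<phi> r"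
    and Tf: "\<And>r. 1 \<le> r \<Longrightarrow> \<bar>nev_T r f\<bar> \<le> T r"
  shows "\<phi> \<in> o[\<F>](T)"
proof (rule smallI)
  fix \<epsilon> :: real assume \<epsilon>: "0 < \<epsilon>"
  obtain E where E: "E \<in> lmeasurable" "\<phi> \<in> o[inf at_top (principal (- E))](\<lambda>r. nev_T r f)"
    using S by (auto simp: nev_S_def)
  define K where "K = measure lebesgue E + 1"
  have K0: "0 \<le> K" by (simp add: K_def)
  have "eventually (\<lambda>r. norm (\<phi> r) \<le> \<epsilon> / 2 * norm (nev_T r f)) (inf at_top (principal (- E)))"
    using landau_o.smallD[OF E(2), of "\<epsilon> / 2"] \<epsilon> by simp
  then obtain r0 where r0: "\<And>r. r \<ge> r0 \<Longrightarrow> r \<notin> E \<Longrightarrow> \<bar>\<phi> r\<bar> \<le> \<epsilon> / 2 * \<bar>nev_T r f\<bar>"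
    by (auto simp: eventually_inf_principal eventually_at_top_linorder)
  show "\<forall>\<^sub>F t in \<F>. 0 \<le> \<phi> t \<and> \<phi> t \<le> \<epsilon> * T t"
    using eventually_T_ahead[of K] eventually_\<F>_ge[of "max r0 1"] eventually_\<F>_not_in[OF B']
  proof eventually_elim
    case (elim t)
    have "\<not> {t..t+K} \<subseteq> E \<union> (B \<union> B')"
    proof
      assume sub: "{t..t+K} \<subseteq> E \<union> (B \<union> B')"
      have "B \<union> B' \<in> null_sets lborel" by (rule countable_imp_null_set_lborel) (use countable_B B' in auto)
      hence neg: "negligible (B \<union> B')" by (simp add: negligible_iff_null_sets null_sets_completionI)
      hence lm: "B \<union> B' \<in> lmeasurable" by (rule negligible_imp_measurable)
      have "K = measure lebesgue {t..t+K}" using K0 by simp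
      also have "\<dots> \<le> measure lebesgue (E \<union> (B \<union> B'))"
        by (rule measure_mono_fmeasurable[OF sub]) (use E lm in \<open>auto intro: fmeasurable.Un\<close>)
      also have "\<dots> \<le> measure lebesgue E + measure lebesgue (B \<union> B')"
        by (rule measure_Un_le) (use E lm in \<open>auto intro: fmeasurableD\<close>)
      also have "measure lebesgue (B \<union> B') = 0" by (rule negligible_imp_measure0[OF neg])
      finally show False by (simp add: K_def)
    qed
    then obtain R where R: "R \<in> {t..t+K}" "R \<notin> E" "R \<notin> B" "R \<notin> B'" by blast
    have "\<phi> t \<le> \<phi> R" by (rule mono) (use R elim in auto)
    also have "\<dots> \<le> \<epsilon> / 2 * \<bar>nev_T R f\<bar>" using r0[of R] R elim by auto
    also have "\<dots> \<le> \<epsilon> / 2 * T R" using Tf[of R] R elim \<epsilon> by (intro mult_left_mono) auto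
    also have "\<dots> \<le> \<epsilon> / 2 * (2 * T t)" using elim R \<epsilon> by (intro mult_left_mono) auto
    finally show ?case using nonneg[of t] elim by simp
  qed
qed

end

subsection \<open>Proof of the theorem\<close>

lemma slow_radii_exist:
  assumes f: "transcendental_meromorphic f" and g: "transcendental_meromorphic g"
    and ho: "hyper_order f < 1" "hyper_order g < 1"
  obtains B \<rho> where "slow_radii (\<lambda>r. nev_T r f + nev_T r g) B \<rho>"
proof -
  define T where "T = (\<lambda>r. nev_T r f + nev_T r g)"
  define B where "B = {r. 0 < r \<and> \<not> regular_on_circle f r} \<union> {r. 0 < r \<and> \<not> regular_on_circle g r}"
  have nz: "nonzero_meromorphic f" "nonzero_meromorphic g" using f g by (auto intro: transcendental_nonzero)
  have B: "countable B" unfolding B_def by (intro countable_Un countable_not_regular nz)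
  have reg: "regular_on_circle f r" "regular_on_circle g r" if "1 \<le> r" "r \<notin> B" for r
    using that by (auto simp: B_def)
  have T_mono: "T r \<le> T s" if "1 \<le> r" "r \<le> s" "r \<notin> B" "s \<notin> B" for r s
    unfolding T_def by (intro add_mono nev_T_mono nz reg) (use that in auto)
  have T_log: "\<exists>r0. \<forall>r\<ge>r0. r \<notin> B \<longrightarrow> C * ln r \<le> T r" for C
  proof -
    obtain r0 where r0: "\<And>r. r \<ge> r0 \<Longrightarrow> regular_on_circle f r \<Longrightarrow> C * ln r \<le> nev_T r f"
      using transcendental_growth[OF f] by blast
    have "C * ln r \<le> T r" if "r \<ge> max r0 1" "r \<notin> B" for r
      using r0[of r] reg[of r] nev_T_nonneg[OF nz(2), of r] that by (auto simp: T_def)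
    thus ?thesis by blast
  qed
  obtain r1 where r1: "\<And>r. r \<ge> r1 \<Longrightarrow> r \<notin> B \<Longrightarrow> 1 * ln r \<le> T r" using T_log by blast
  have pos: "0 < T r" if "r \<ge> max r1 2" "r \<notin> B" for r
  proof -
    have "0 < ln r" using that by simp
    moreover have "ln r \<le> T r" using r1[of r] that by simp
    ultimately show ?thesis by linarith
  qed
  have growth: "eventually (\<lambda>r. T r \<le> 2 * exp (\<delta> * r)) at_top" if "0 < \<delta>" for \<delta>
    using hyper_order_less_1_growth[OF ho(1) that] hyper_order_less_1_growth[OF ho(2) that]
    by eventually_elim (simp add: T_def)
  have "\<exists>r. real n \<le> r \<and> r \<notin> B \<and> r + real n \<notin> B \<and> T (r + real n) \<le> 2 * T r" for n
  proof -
    \<comment> \<open>\<open>slow_growth_radius\<close> needs a positive step. For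
      \<open>n = 0\<close> the required inequality only says that \<open>T r\<close> is
      nonnegative.\<close>
    define d where "d = max (real n) 1"
    have d: "0 < d" by (simp add: d_def)
    have "\<exists>r\<ge>max (max r1 2) (real n). r \<notin> B \<and> r + d \<notin> B \<and> T (r + d) \<le> 2 * T r"
      by (rule slow_growth_radius[OF B _ growth d]) (use pos in simp_all)
    then obtain r where r: "r \<ge> max (max r1 2) (real n)" "r \<notin> B" "r + d \<notin> B" "T (r + d) \<le> 2 * T r"
      by blast
    show ?thesis
    proof (cases "n = 0")
      case True
      thus ?thesis using r pos[of r] by (intro exI[of _ r]) auto
    next
      case False
      hence "d = real n" by (simp add: d_def)
      thus ?thesis using r by (intro exI[of _ r]) auto
    qed
  qed
  then obtain \<rho> where \<rho>: "\<And>n. real n \<le> \<rho> n \<and> \<rho> n \<notin> B \<and> \<rho> n + real n \<notin> B \<and> T (\<rho> n + real n) \<le> 2 * T (\<rho> n)"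
    by metis
  have "slow_radii T B \<rho>"
  proof
    show "real n \<le> \<rho> n" "\<rho> n \<notin> B" "\<rho> n + real n \<notin> B" "T (\<rho> n + real n) \<le> 2 * T (\<rho> n)" for n
      using \<rho>[of n] by auto
  qed (fact B T_mono T_log)+
  from this[unfolded T_def] show ?thesis by (rule that)
qed

context slow_radii
begin

lemma small_divisor_if_nev_S:
  assumes f: "nonzero_meromorphic f" and S: "nev_S f (\<lambda>r. nev_N r f + nev_N r (\<lambda>z. 1 / f z))"
    and Tf: "\<And>r. 1 \<le> r \<Longrightarrow> nev_T r f \<le> T r"
  shows "small_divisor f"
proof -
  have fi: "nonzero_meromorphic (\<lambda>z. 1 / f z)" by (rule nonzero_meromorphic_inverse[OF f])
  have N: "(\<lambda>r. nev_N r f + nev_N r (\<lambda>z. 1 / f z)) \<in> o[\<F>](T)"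
    by (rule nev_S_imp_small[OF S countable_empty])
       (use Tf nev_T_nonneg[OF f] in \<open>auto intro!: add_mono nev_N_mono add_nonneg_nonneg nev_N_nonneg f fi\<close>)
  have 1: "\<forall>\<^sub>F t in \<F>. 0 \<le> nev_N t f \<and> nev_N t f \<le> nev_N t f + nev_N t (\<lambda>z. 1 / f z)"
    using eventually_\<F>_ge[of 1] by eventually_elim (auto intro: nev_N_nonneg f fi)
  have 2: "\<forall>\<^sub>F t in \<F>. 0 \<le> nev_N t (\<lambda>z. 1 / f z) \<and> nev_N t (\<lambda>z. 1 / f z) \<le> nev_N t f + nev_N t (\<lambda>z. 1 / f z)"
    using eventually_\<F>_ge[of 1] by eventually_elim (auto intro: nev_N_nonneg f fi)
  have "\<forall>\<^sub>F t in \<F>. nev_m t f \<le> 1 * T t"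
    using eventually_\<F>_ge[of 1] by eventually_elim (use nev_T_ge_m[OF f] Tf in \<open>auto intro: order_trans\<close>)
  thus ?thesis using f small_le[OF 1 N] small_le[OF 2 N] unfolding small_divisor_def by blast
qed

lemma small_char_if_small_function:
  assumes f: "nonzero_meromorphic f" and a: "nonzero_meromorphic a" and S: "small_function a f"
    and Tf: "\<And>r. 1 \<le> r \<Longrightarrow> nev_T r f \<le> T r"
  shows "small_char a"
proof -
  have S: "nev_S f (\<lambda>r. nev_T r a)" using S by (simp add: small_function_def)
  have "(\<lambda>r. nev_T r a) \<in> o[\<F>](T)"
  proof (rule nev_S_imp_small[OF S countable_not_regular[OF a]])
    fix r s :: real
    assume "1 \<le> r" "r \<le> s" "r \<notin> {r. 0 < r \<and> \<not> regular_on_circle a r}" "s \<notin> {r. 0 < r \<and> \<not> regular_on_circle a r}"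
    thus "nev_T r a \<le> nev_T s a" by (intro nev_T_mono[OF a]) auto
  qed (use Tf nev_T_nonneg[OF f] nev_T_nonneg[OF a] in auto)
  thus ?thesis using a by (simp add: small_char_def)
qed

end

locale slow_radii_pair = slow_radii "\<lambda>r. nev_T r f + nev_T r g" B \<rho>
  for f g :: "complex \<Rightarrow> complex" and B \<rho>
begin

lemma not_both_small_char: "\<not> (small_char f \<and> small_char g)"
proof
  assume "small_char f \<and> small_char g"
  hence "(\<lambda>r. nev_T r f + nev_T r g) \<in> o[\<F>](\<lambda>r. nev_T r f + nev_T r g)"
    by (auto simp: small_char_def intro!: sum_in_smallo)
  from smallD[OF this, of "1/2"] have "\<forall>\<^sub>F t in \<F>. nev_T t f + nev_T t g \<le> 1/2 * (nev_T t f + nev_T t g)" by simp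
  hence "\<forall>\<^sub>F t in \<F>. False" using T_ge[of 1] by eventually_elim simp
  thus False using \<F>_neq_bot by (simp add: eventually_False)
qed

end

text \<open>If a derivative were the first to vanish identically, the preceding one would be a
  nonzero constant \<open>b\<close>. Then \<open>g\<close> would be a quotient of \<open>b\<close>
  by functions of small characteristic, hence small compared with itself. The radii are chosen for
  the pair \<open>g\<close>, \<open>g\<close>, so that the comparison function is twice the
  characteristic of \<open>g\<close>.\<close>

lemma nonzero_higher_deriv:
  assumes g: "transcendental_meromorphic g" "hyper_order g < 1"
    and S: "nev_S g (\<lambda>r. nev_N r g + nev_N r (\<lambda>z. 1 / g z))" and c: "c \<noteq> 0"
  shows "nonzero_meromorphic ((deriv ^^ k) (\<lambda>z. g (z + c)))"
proof -
  have nz: "nonzero_meromorphic g" by (rule transcendental_nonzero[OF g(1)])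
  obtain B \<rho> where "slow_radii (\<lambda>r. nev_T r g + nev_T r g) B \<rho>"
    using slow_radii_exist[OF g(1) g(1) g(2) g(2)] .
  then interpret slow_radii_pair g g B \<rho> by (simp add: slow_radii_pair_def)
  define G where "G = (\<lambda>z. g (z + c))"
  have Sg: "small_divisor g" by (rule small_divisor_if_nev_S[OF nz S]) (use nev_T_nonneg[OF nz] in auto)
  have Gq: "small_char (\<lambda>z. G z / g z)" unfolding G_def by (rule small_char_shift_quotient[OF Sg c])
  have g0: "\<forall>\<^sub>\<approx>z. g z \<noteq> 0" using nz by (simp add: nonzero_meromorphic_def)
  have G: "nonzero_meromorphic G" unfolding G_def by (rule nonzero_meromorphic_shift[OF nz])
  have G0: "\<forall>\<^sub>\<approx>z. G z \<noteq> 0" using G by (simp add: nonzero_meromorphic_def)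
  have SG: "small_divisor G"
  proof (rule small_divisor_cong)
    show "small_divisor (\<lambda>z. g z * (G z / g z))"
      by (intro small_divisor_mult Sg small_char_imp_small_divisor Gq)
    show "\<forall>\<^sub>\<approx>z. g z * (G z / g z) = G z" using g0 by eventually_elim simp
  qed
  have "\<forall>j\<le>k. nonzero_meromorphic ((deriv ^^ j) G)"
  proof (induction k)
    case 0
    thus ?case using G by simp
  next
    case (Suc k)
    have nzk: "nonzero_meromorphic ((deriv ^^ k) G)" using Suc by simp
    have "nonzero_meromorphic (deriv ((deriv ^^ k) G))"
    proof (rule ccontr)
      assume *: "\<not> ?thesis"
      have mk: "(deriv ^^ k) G meromorphic_on UNIV" using nzk by (simp add: nonzero_meromorphic_def)
      have "deriv ((deriv ^^ k) G) meromorphic_on UNIV" by (intro meromorphic_on_deriv mk)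
      hence "\<forall>\<^sub>\<approx>z. deriv ((deriv ^^ k) G) z = 0" using meromorphic_zero_or_nonzero * by blast
      then obtain b where b: "\<forall>\<^sub>\<approx>z. (deriv ^^ k) G z = b" using meromorphic_deriv_zero[OF mk] by blast
      have nzb: "\<forall>\<^sub>\<approx>z. (deriv ^^ k) G z \<noteq> 0" using nzk by (simp add: nonzero_meromorphic_def)
      have "b \<noteq> 0"
      proof
        assume "b = 0"
        from b nzb have "\<forall>\<^sub>\<approx>z::complex. False" by eventually_elim (use \<open>b = 0\<close> in simp)
        thus False by (simp add: eventually_False)
      qed
      hence b': "small_char (\<lambda>_. b)" by (rule small_char_const)
      have D: "small_char (\<lambda>z. (deriv ^^ k) G z / G z)" by (rule small_char_higher_deriv[OF SG]) (use Suc in auto)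
      have "small_char (\<lambda>z. b / ((deriv ^^ k) G z / G z) / (G z / g z))"
        by (intro small_char_divide b' D Gq)
      moreover have "\<forall>\<^sub>\<approx>z. b / ((deriv ^^ k) G z / G z) / (G z / g z) = g z"
        using b nzb g0 G0 by eventually_elim simp
      ultimately have "small_char g" by (rule small_char_cong[rotated])
      thus False using not_both_small_char by simp
    qed
    thus ?case using Suc by (auto simp: le_Suc_eq)
  qed
  thus ?thesis by (simp add: G_def)
qed

lemma operator_nonzero:
  assumes g: "transcendental_meromorphic g" "hyper_order g < 1"
    and S: "nev_S g (\<lambda>r. nev_N r g + nev_N r (\<lambda>z. 1 / g z))" and c: "c \<noteq> 0"
    and L: "L = shift_op c \<or> L = difference_op c \<or> (\<exists>k\<ge>1. L = deriv_shift_op k c)"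
    and Ld: "L = difference_op c \<Longrightarrow> \<not> identically_zero (L g)"
  shows "nonzero_meromorphic (L g)"
proof -
  have nz: "nonzero_meromorphic g" by (rule transcendental_nonzero[OF g(1)])
  have mero: "g meromorphic_on UNIV" using nz by (simp add: nonzero_meromorphic_def)
  from L show ?thesis
  proof (elim disjE exE conjE)
    assume "L = shift_op c"
    thus ?thesis using nonzero_meromorphic_shift[OF nz] by (simp add: shift_op_def)
  next
    assume L: "L = difference_op c"
    have "L g meromorphic_on UNIV" unfolding L difference_op_def
      by (intro meromorphic_intros meromorphic_shift mero)
    thus ?thesis using meromorphic_zero_or_nonzero Ld[OF L] by (auto simp: identically_zero_def)
  next
    fix k assume "L = deriv_shift_op k c"
    thus ?thesis using nonzero_higher_deriv[OF g S c, of k] by (simp add: deriv_shift_op_def higher_deriv_shift)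
  qed
qed

text \<open>With \<open>G\<close> the shifted function, the three quotients are
  \<open>G / g\<close>, \<open>G / g - 1\<close>, and the product of (deriv ^^ k) G / G with
  \<open>G / g\<close>. All of them reduce to the shift quotient and logarithmic
  derivatives.\<close>

lemma (in slow_radii) small_char_operator_quotient:
  assumes g: "transcendental_meromorphic g" "hyper_order g < 1"
    and S: "nev_S g (\<lambda>r. nev_N r g + nev_N r (\<lambda>z. 1 / g z))" and c: "c \<noteq> 0"
    and L: "L = shift_op c \<or> L = difference_op c \<or> (\<exists>k\<ge>1. L = deriv_shift_op k c)"
    and Ld: "L = difference_op c \<Longrightarrow> \<not> identically_zero (L g)"
    and Sg: "small_divisor g"
  shows "small_char (\<lambda>z. L g z / g z)"
proof -
  have nz: "nonzero_meromorphic g" by (rule transcendental_nonzero[OF g(1)])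
  have g0: "\<forall>\<^sub>\<approx>z. g z \<noteq> 0" using nz by (simp add: nonzero_meromorphic_def)
  define G where "G = (\<lambda>z. g (z + c))"
  have Gq: "small_char (\<lambda>z. G z / g z)" unfolding G_def by (rule small_char_shift_quotient[OF Sg c])
  have Lg: "nonzero_meromorphic (L g)" by (rule operator_nonzero[where L=L, OF g S c L]) (rule Ld)
  from L show ?thesis
  proof (elim disjE exE conjE)
    assume "L = shift_op c"
    thus ?thesis using Gq by (simp add: shift_op_def G_def)
  next
    assume L: "L = difference_op c"
    have eq: "\<forall>\<^sub>\<approx>z. G z / g z - 1 = L g z / g z"
      using g0 by eventually_elim (simp add: L difference_op_def G_def diff_divide_distrib)
    have "nonzero_meromorphic (\<lambda>z. G z / g z - 1)"
      by (subst nonzero_meromorphic_cong[OF eq]) (intro nonzero_meromorphic_divide Lg nz)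
    hence "small_char (\<lambda>z. G z / g z - 1)" by (intro small_char_diff Gq small_char_const) auto
    thus ?thesis by (rule small_char_cong[OF eq])
  next
    fix k assume L: "L = deriv_shift_op k c"
    have G0: "\<forall>\<^sub>\<approx>z. G z \<noteq> 0" using nonzero_meromorphic_shift[OF nz] by (simp add: nonzero_meromorphic_def G_def)
    have SG: "small_divisor G"
    proof (rule small_divisor_cong)
      show "small_divisor (\<lambda>z. g z * (G z / g z))"
        by (intro small_divisor_mult Sg small_char_imp_small_divisor Gq)
      show "\<forall>\<^sub>\<approx>z. g z * (G z / g z) = G z" using g0 by eventually_elim simp
    qed
    have "small_char (\<lambda>z. (deriv ^^ k) G z / G z)"
      by (rule small_char_higher_deriv[OF SG]) (unfold G_def, rule nonzero_higher_deriv[OF g S c])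
    hence "small_char (\<lambda>z. (deriv ^^ k) G z / G z * (G z / g z))" by (rule small_char_mult[OF _ Gq])
    moreover have "\<forall>\<^sub>\<approx>z. (deriv ^^ k) G z / G z * (G z / g z) = L g z / g z"
      using G0 by eventually_elim (simp add: L deriv_shift_op_def G_def higher_deriv_shift)
    ultimately show ?thesis by (rule small_char_cong[rotated])
  qed
qed

theorem theoremB:
  fixes f g a :: "complex \<Rightarrow> complex"
    and c :: complex
    and L :: "(complex \<Rightarrow> complex) \<Rightarrow> complex \<Rightarrow> complex"
  assumes "transcendental_meromorphic f" and "transcendental_meromorphic g"
    and "hyper_order f < 1" and "hyper_order g < 1"
    and "nev_S f (\<lambda>r. nev_N r f + nev_N r (\<lambda>z. 1 / f z))"
    and "nev_S g (\<lambda>r. nev_N r g + nev_N r (\<lambda>z. 1 / g z))"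
    and "a meromorphic_on UNIV" and "\<not> identically_zero a"
    and "small_function a f" and "small_function a g"
    and "c \<noteq> 0"
    and "L = shift_op c \<or> L = difference_op c \<or> (\<exists>k\<ge>1. L = deriv_shift_op k c)"
    and "L = difference_op c \<Longrightarrow> \<not> identically_zero (L f) \<and> \<not> identically_zero (L g)"
  shows "infinite (zeros (\<lambda>z. (f z)\<^sup>2 * L g z - a z)) \<or>
         infinite (zeros (\<lambda>z. (g z)\<^sup>2 * L f z - a z))"
proof (rule ccontr)
  assume "\<not> ?thesis"
  hence fin: "finite (zeros (\<lambda>z. (f z)\<^sup>2 * L g z - a z))" "finite (zeros (\<lambda>z. (g z)\<^sup>2 * L f z - a z))"
    by auto
  have nz: "nonzero_meromorphic f" "nonzero_meromorphic g" using assms(1,2) by (auto intro: transcendental_nonzero)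
  have a: "nonzero_meromorphic a"
    using meromorphic_zero_or_nonzero[OF assms(7)] assms(8) by (auto simp: identically_zero_def)
  obtain B \<rho> where "slow_radii (\<lambda>r. nev_T r f + nev_T r g) B \<rho>"
    using slow_radii_exist[OF assms(1-4)] .
  then interpret slow_radii_pair f g B \<rho> by (simp add: slow_radii_pair_def)
  have T: "nev_T r f \<le> nev_T r f + nev_T r g" "nev_T r g \<le> nev_T r f + nev_T r g" if "1 \<le> r" for r
    using nev_T_nonneg[OF nz(1) that] nev_T_nonneg[OF nz(2) that] by auto
  have Sf: "small_divisor f" by (rule small_divisor_if_nev_S[OF nz(1) assms(5) T(1)])
  have Sg: "small_divisor g" by (rule small_divisor_if_nev_S[OF nz(2) assms(6) T(2)])
  have Xa: "small_char a" by (rule small_char_if_small_function[OF nz(1) a assms(9) T(1)])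
  have Ld: "L = difference_op c \<Longrightarrow> \<not> identically_zero (L f)" "L = difference_op c \<Longrightarrow> \<not> identically_zero (L g)"
    using assms(13) by auto
  have Xf: "small_char (\<lambda>z. L f z / f z)"
    by (rule small_char_operator_quotient[where L=L, OF assms(1,3,5,11,12) _ Sf]) (rule Ld(1))
  have Xg: "small_char (\<lambda>z. L g z / g z)"
    by (rule small_char_operator_quotient[where L=L, OF assms(2,4,6,11,12) _ Sg]) (rule Ld(2))
  have Lf: "nonzero_meromorphic (L f)" by (rule operator_nonzero[where L=L, OF assms(1,3,5,11,12)]) (rule Ld(1))
  have Lg: "nonzero_meromorphic (L g)" by (rule operator_nonzero[where L=L, OF assms(2,4,6,11,12)]) (rule Ld(2))
  have fg: "small_char (\<lambda>z. (f z)\<^sup>2 * g z)"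
    by (rule small_char_product_if_finite_zeros[where H="L g", OF Sf Sg Xa Xg Lg fin(1)])
  have gf: "small_char (\<lambda>z. (g z)\<^sup>2 * f z)"
    by (rule small_char_product_if_finite_zeros[where H="L f", OF Sg Sf Xa Xf Lf fin(2)])
  have ev: "\<forall>\<^sub>\<approx>z. f z \<noteq> 0 \<and> g z \<noteq> 0"
    using nz by (auto simp: nonzero_meromorphic_def intro!: eventually_conj)
  have "\<forall>\<^sub>\<approx>z. ((f z)\<^sup>2 * g z) * ((f z)\<^sup>2 * g z) / ((g z)\<^sup>2 * f z) = f z ^ 3"
    using ev by eventually_elim (simp add: power2_eq_square power3_eq_cube)
  hence f3: "small_char (\<lambda>z. f z ^ 3)"
    by (rule small_char_cong) (intro small_char_divide small_char_mult fg gf)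
  have "\<forall>\<^sub>\<approx>z. ((g z)\<^sup>2 * f z) * ((g z)\<^sup>2 * f z) / ((f z)\<^sup>2 * g z) = g z ^ 3"
    using ev by eventually_elim (simp add: power2_eq_square power3_eq_cube)
  hence g3: "small_char (\<lambda>z. g z ^ 3)"
    by (rule small_char_cong) (intro small_char_divide small_char_mult fg gf)
  show False
    using not_both_small_char small_char_of_cube[OF nz(1) f3] small_char_of_cube[OF nz(2) g3] by simp
qed

end
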